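(* Let $B=B(x)$ be a smooth and divergence-free vector field over $\mathbb{T}^3$, with values in $\mathbb{R}^3$. Assume that for all $x_{\rm h}\in\mathbb{T}^2$, $B_{\rm h}(x_{\rm h},\cdot)$ has non-constant direction. Then, for $$\sup_{x_{\rm h}\in\mathbb{T}^2}\Big|\int_{\mathbb{T}}(B\cdot\nabla B_{\rm h})(x_{\rm h},x_3)\,dx_3\Big|$$ small enough, and for any smooth $F=F(x)=(F_{\rm h},F_3)$ with zero mean over $\mathbb{T}^3$, the equations $$-\int_{\mathbb{T}}(B\cdot\nabla)^2\,dx_3\,u_{g,{\rm h}}+u_{g,{\rm h}}\cdot\nabla_{\rm h}\int_{\mathbb{T}}B\cdot\nabla B_{\rm h}\,dx_3+\nabla_{\rm h}p=\int_{\mathbb{T}}F_{\rm h}\,dx_3,\qquad \operatorname{div}_{\rm h}u_{g,{\rm h}}=0\quad\text{on }\mathbb{T}^2$$ (for some $p=p(x_{\rm h})$), and $$-\int_{\mathbb{T}}(B\cdot\nabla)^2\,dx_3\,u_{g,3}=\int_{\mathbb{T}}F_3\,dx_3\quad\text{on }\mathbb{T}^2,$$ have unique smooth solutions $u_{g,{\rm h}}=u_{g,{\rm h}}(x_{\rm h})\in\mathbb{R}^2$ and $u_{g,3}=u_{g,3}(x_{\rm h})\in\mathbb{R}$ with zero mean over $\mathbb{T}^2$.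
   Context: $\mathbb{T}=\mathbb{R}/\mathbb{Z}$, $x=(x_{\rm h},x_3)\in\mathbb{T}^3$ with $x_{\rm h}=(x_1,x_2)\in\mathbb{T}^2$; $B_{\rm h}=(B_1,B_2)$, $F_{\rm h}=(F_1,F_2)$, $\nabla_{\rm h}=(\partial_1,\partial_2)$, $\operatorname{div}_{\rm h}v=\partial_1v_1+\partial_2v_2$. For a function $f=f(x_{\rm h})$ (scalar, or vector valued and then componentwise), $\int_{\mathbb{T}}(B\cdot\nabla)^2dx_3\,f$ denotes the function $x_{\rm h}\mapsto\int_{\mathbb{T}}\big(B\cdot\nabla(B\cdot\nabla f)\big)(x_{\rm h},x_3)\,dx_3$. The assumption that $B_{\rm h}(x_{\rm h},\cdot)$ has non-constant direction for all $x_{\rm h}$ is equivalent to the strict Cauchy–Schwarz inequality $\big|\int_{\mathbb{T}}(B_1B_2)(x_{\rm h},x_3)\,dx_3\big|^2<\int_{\mathbb{T}}|B_1(x_{\rm h},x_3)|^2dx_3\int_{\mathbb{T}}|B_2(x_{\rm h},x_3)|^2dx_3$ for all $x_{\rm h}\in\mathbb{T}^2$. *)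

theory Defs
  imports "HOL-Analysis.Analysis"
begin

text \<open>
  Functions on the torus of dimension \<open>CARD('n)\<close> are represented by functions on
  \<open>real ^ 'n\<close> that are 1-periodic in every coordinate. Integrals over the torus are integrals
  over the unit cube \<open>cbox 0 1\<close> (here \<open>1\<close> is the vector all of whose components are 1).
\<close>

definition torus_periodic :: "(real ^ 'n \<Rightarrow> 'b) \<Rightarrow> bool" where
  "torus_periodic f \<longleftrightarrow> (\<forall>x i. f (x + axis i 1) = f x)"

definition partial_deriv :: "'n \<Rightarrow> (real ^ 'n \<Rightarrow> 'b::real_normed_vector) \<Rightarrow> real ^ 'n \<Rightarrow> 'b" where
  "partial_deriv i f x = frechet_derivative f (at x) (axis i 1)"

primrec C_k :: "nat \<Rightarrow> (real ^ 'n \<Rightarrow> 'b::real_normed_vector) \<Rightarrow> bool" where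
  "C_k 0 f \<longleftrightarrow> continuous_on UNIV f"
| "C_k (Suc k) f \<longleftrightarrow> (\<forall>x. f differentiable at x) \<and> (\<forall>i. C_k k (partial_deriv i f))"

definition torus_smooth :: "(real ^ 'n \<Rightarrow> 'b::real_normed_vector) \<Rightarrow> bool" where
  "torus_smooth f \<longleftrightarrow> torus_periodic f \<and> (\<forall>k. C_k k f)"

definition torus_mean_zero :: "(real ^ 'n \<Rightarrow> 'b::real_normed_vector) \<Rightarrow> bool" where
  "torus_mean_zero f \<longleftrightarrow> integral (cbox 0 1) f = 0"

text \<open>The gradient, the divergence and the directional derivative \<open>v \<cdot> \<nabla> f\<close>; the last one acts
  componentwise on vector-valued \<open>f\<close>.\<close>

definition gradient :: "(real ^ 'n \<Rightarrow> real) \<Rightarrow> real ^ 'n \<Rightarrow> real ^ 'n" where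
  "gradient f x = (\<chi> i. partial_deriv i f x)"

definition divergence :: "(real ^ 'n \<Rightarrow> real ^ 'n) \<Rightarrow> real ^ 'n \<Rightarrow> real" where
  "divergence v x = (\<Sum>i\<in>UNIV. partial_deriv i (\<lambda>y. v y $ i) x)"

definition advect ::
  "(real ^ 'n \<Rightarrow> real ^ 'n) \<Rightarrow> (real ^ 'n \<Rightarrow> 'b::real_normed_vector) \<Rightarrow> real ^ 'n \<Rightarrow> 'b" where
  "advect v f x = (\<Sum>i\<in>UNIV. v x $ i *\<^sub>R partial_deriv i f x)"

definition horiz :: "real ^ 3 \<Rightarrow> real ^ 2" where
  "horiz x = vector [x $ 1, x $ 2]"

definition at_height :: "real ^ 2 \<Rightarrow> real \<Rightarrow> real ^ 3" where
  "at_height xh t = vector [xh $ 1, xh $ 2, t]"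

definition vert_avg :: "(real ^ 3 \<Rightarrow> 'b::real_normed_vector) \<Rightarrow> real ^ 2 \<Rightarrow> 'b" where
  "vert_avg f xh = integral {0..1} (\<lambda>t. f (at_height xh t))"

text \<open>The operator \<open>\<integral> (B \<cdot> \<nabla>)\<^sup>2 dx\<^sub>3\<close> acting on functions of the horizontal variable.\<close>

definition avg_B_grad_sq ::
  "(real ^ 3 \<Rightarrow> real ^ 3) \<Rightarrow> (real ^ 2 \<Rightarrow> 'b::real_normed_vector) \<Rightarrow> real ^ 2 \<Rightarrow> 'b" where
  "avg_B_grad_sq B f = vert_avg (advect B (advect B (\<lambda>x. f (horiz x))))"

definition avg_B_grad_Bh :: "(real ^ 3 \<Rightarrow> real ^ 3) \<Rightarrow> real ^ 2 \<Rightarrow> real ^ 2" where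
  "avg_B_grad_Bh B = vert_avg (advect B (\<lambda>x. horiz (B x)))"

text \<open>A direction is a line through the origin (zeros and sign changes are allowed), so that
  non-constancy for continuous \<open>w\<close> is exactly linear independence of the two components,
  i.e. strictness in the Cauchy--Schwarz inequality for them.\<close>

definition constant_direction :: "(real \<Rightarrow> real ^ 2) \<Rightarrow> bool" where
  "constant_direction w \<longleftrightarrow> (\<exists>e. e \<noteq> 0 \<and> (\<forall>t. \<exists>c. w t = c *\<^sub>R e))"

text \<open>The ellipticity constant of the averaged operator: the infimum over \<open>xh\<close> of the least
  eigenvalue of the matrix \<open>\<integral> B\<^sub>h \<otimes> B\<^sub>h dx\<^sub>3\<close>, the coefficient matrix of its second-order part.\<close>

definition ellipticity :: "(real ^ 3 \<Rightarrow> real ^ 3) \<Rightarrow> real" where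
  "ellipticity B =
     (INF (xh, \<xi>) \<in> UNIV \<times> sphere 0 1. vert_avg (\<lambda>x. (horiz (B x) \<bullet> \<xi>)\<^sup>2) xh)"

definition horiz_solution ::
  "(real ^ 3 \<Rightarrow> real ^ 3) \<Rightarrow> (real ^ 3 \<Rightarrow> real ^ 3) \<Rightarrow> (real ^ 2 \<Rightarrow> real ^ 2) \<Rightarrow> bool" where
  "horiz_solution B F u \<longleftrightarrow>
     (\<exists>p :: real ^ 2 \<Rightarrow> real. torus_smooth p \<and>
        (\<forall>xh. - avg_B_grad_sq B u xh + advect u (avg_B_grad_Bh B) xh + gradient p xh
              = vert_avg (\<lambda>x. horiz (F x)) xh)) \<and>
     (\<forall>xh. divergence u xh = 0)"

definition vert_solution ::
  "(real ^ 3 \<Rightarrow> real ^ 3) \<Rightarrow> (real ^ 3 \<Rightarrow> real ^ 3) \<Rightarrow> (real ^ 2 \<Rightarrow> real) \<Rightarrow> bool" where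
  "vert_solution B F u \<longleftrightarrow>
     (\<forall>xh. - avg_B_grad_sq B u xh = vert_avg (\<lambda>x. F x $ 3) xh)"

end

theory Submission
  imports Defs "HOL-Complex_Analysis.Great_Picard"
begin

text \<open>
  Since \<open>B\<close> is divergence free, the averaged operator has the divergence form
  \<open>\<partial>\<^sub>i (A\<^sub>i\<^sub>j \<partial>\<^sub>j u)\<close> with \<open>A = \<integral> B\<^sub>h \<otimes> B\<^sub>h dx\<^sub>3\<close>, and the assumption on the
  direction of \<open>B\<^sub>h\<close> makes \<open>A\<close> uniformly elliptic by compactness. With \<open>b = \<integral> B \<cdot> \<nabla> B\<^sub>h dx\<^sub>3\<close>, the
  term \<open>u \<cdot> \<nabla> b\<close> contributes \<open>- \<integral> b \<cdot> (u \<cdot> \<nabla> u)\<close> to the energy identity, which Poincare's inequality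
  absorbs when \<open>sup \<bar>b\<bar>\<close> is below a quarter of the ellipticity constant. This gives uniqueness.

  For existence, solve Galerkin systems on trigonometric polynomials (with amplitudes orthogonal to
  the frequencies in the divergence-free case). These spaces are invariant under differentiation, so
  the energy estimate can be differentiated and bounds the Galerkin solutions in every Sobolev norm.
  The Arzela-Ascoli theorem and interpolation yield a smooth limit, which solves the equation weakly
  against all trigonometric monomials and hence pointwise; the pressure comes from a Poisson equation.
\<close>

section \<open>Smooth functions on the torus\<close>

text \<open>The smallness assumption controls \<open>b\<close> but not its derivatives, so
  \<open>u \<cdot> \<nabla> b\<close> may enter an estimate only after integration by parts. This is
  possible because \<open>u\<close> is divergence free, and it is why coercivity of the horizontal
  system is claimed on divergence-free fields only. The threshold can be traced: ellipticity yields
  \<open>\<mu> / 2\<close> times the square of \<open>grad_l2 u\<close>, the term with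
  \<open>b\<close> costs \<open>2 * S\<close> times the same square through the Poincare constant 2,
  and the difference is positive exactly when \<open>S < \<mu> / 4\<close>.

  All functions stay smooth: Sobolev norms are finite sums of L2 norms of smooth functions, and the
  limit of the approximations is taken in the uniform sense. Hence the approximations themselves
  need bounds of every order. Writing the data as a divergence part \<open>g\<close> plus a
  remainder \<open>h\<close> makes this possible, since equations with such data reproduce
  themselves under differentiation. The zero frequency is left out of the trial spaces, which builds
  in zero mean; testing with constants is made up for by the zero mean of the data.\<close>

abbreviation D where "D \<equiv> partial_deriv"

lemma partial_deriv_eqI:
  "(f has_derivative f') (at x) \<Longrightarrow> D i f x = f' (axis i 1)"
  by (simp add: partial_deriv_def frechet_derivative_at [symmetric])

lemma has_derivative_partials:
  assumes "f differentiable (at x)"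
  shows "(f has_derivative (\<lambda>h. \<Sum>i\<in>UNIV. h $ i *\<^sub>R D i f x)) (at x)"
proof -
  let ?f' = "frechet_derivative f (at x)"
  have d: "(f has_derivative ?f') (at x)"
    using assms frechet_derivative_works by blast
  then interpret bounded_linear ?f'
    by (rule has_derivative_bounded_linear)
  have "?f' h = (\<Sum>i\<in>UNIV. h $ i *\<^sub>R D i f x)" for h
  proof -
    have "h = (\<Sum>i\<in>UNIV. h $ i *\<^sub>R axis i 1)"
      using basis_expansion[of h] by (simp add: scalar_mult_eq_scaleR)
    then have "?f' h = ?f' (\<Sum>i\<in>UNIV. h $ i *\<^sub>R axis i 1)"
      by simp
    then show ?thesis
      by (simp add: sum scaleR partial_deriv_def)
  qed
  then show ?thesis
    using d by presburger
qed

lemma C_k_Suc_imp: "C_k (Suc k) f \<Longrightarrow> C_k k f"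
proof (induction k arbitrary: f)
  case 0
  then show ?case
    by (auto intro!: continuous_at_imp_continuous_on differentiable_imp_continuous_within)
qed auto

text \<open>Smoothness split off from periodicity: the chain rule for linear maps such as
  \<open>horiz\<close> and differentiation under the vertical integral are local and come before
  periodicity.\<close>

definition smooth :: "(real ^ 'n \<Rightarrow> 'b::real_normed_vector) \<Rightarrow> bool" where
  "smooth f \<longleftrightarrow> (\<forall>k. C_k k f)"

lemma smooth_differentiable: "smooth f \<Longrightarrow> f differentiable (at x)"
  unfolding smooth_def using C_k.simps(2) by blast

lemma smooth_partial_deriv: "smooth f \<Longrightarrow> smooth (D i f)"
  unfolding smooth_def using C_k.simps(2) by blast

lemma smooth_continuous_on: "smooth f \<Longrightarrow> continuous_on S f"
  unfolding smooth_def by (metis C_k.simps(1) continuous_on_subset top_greatest)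

lemmas smooth_has_derivative = has_derivative_partials[OF smooth_differentiable]

lemma partial_deriv_const [simp]: "D i (\<lambda>x. c) = (\<lambda>x. 0)"
  by (rule ext) (rule partial_deriv_eqI, rule has_derivative_const)

lemma C_k_const: "C_k k (\<lambda>x. c)"
  by (induction k arbitrary: c) auto

lemma smooth_const: "smooth (\<lambda>x. c)"
  by (simp add: smooth_def C_k_const)

lemma partial_deriv_add:
  assumes "f differentiable (at x)" "g differentiable (at x)"
  shows "D i (\<lambda>x. f x + g x) x = D i f x + D i g x"
  by (rule trans, rule partial_deriv_eqI, rule has_derivative_add
      [OF assms[unfolded frechet_derivative_works]])
    (simp add: partial_deriv_def)

lemma C_k_add: "C_k k f \<Longrightarrow> C_k k g \<Longrightarrow> C_k k (\<lambda>x. f x + g x)"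
proof (induction k arbitrary: f g)
  case (Suc k)
  then have "D i (\<lambda>x. f x + g x) = (\<lambda>x. D i f x + D i g x)" for i
    by (auto simp: partial_deriv_add)
  then show ?case
    using Suc by auto
qed (auto intro: continuous_on_add)

lemma smooth_add: "smooth f \<Longrightarrow> smooth g \<Longrightarrow> smooth (\<lambda>x. f x + g x)"
  by (simp add: smooth_def C_k_add)

context bounded_linear
begin

lemma partial_deriv_compose:
  assumes "g differentiable (at x)"
  shows "D i (\<lambda>x. f (g x)) x = f (D i g x)"
  by (rule trans, rule partial_deriv_eqI, rule has_derivative
      [OF assms[unfolded frechet_derivative_works]])
    (simp add: partial_deriv_def)

lemma C_k_compose: "C_k k g \<Longrightarrow> C_k k (\<lambda>x. f (g x))"
proof (induction k arbitrary: g)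
  case 0
  then show ?case by (auto intro: continuous_on)
next
  case (Suc k)
  then have "D i (\<lambda>x. f (g x)) = (\<lambda>x. f (D i g x))" for i
    by (auto simp: partial_deriv_compose)
  moreover have "(\<lambda>x. f (g x)) differentiable (at x)" for x
    using Suc.prems has_derivative unfolding differentiable_def C_k.simps by blast
  ultimately show ?case
    using Suc by auto
qed

lemma smooth_compose: "smooth g \<Longrightarrow> smooth (\<lambda>x. f (g x))"
  by (simp add: smooth_def C_k_compose)

end

context bounded_bilinear
begin

lemma partial_deriv_prod:
  assumes "f differentiable (at x)" "g differentiable (at x)"
  shows "D i (\<lambda>x. prod (f x) (g x)) x = prod (f x) (D i g x) + prod (D i f x) (g x)"
  by (rule trans, rule partial_deriv_eqI, rule FDERIV
      [OF assms[unfolded frechet_derivative_works]])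
    (simp add: partial_deriv_def)

lemma C_k_prod: "C_k k f \<Longrightarrow> C_k k g \<Longrightarrow> C_k k (\<lambda>x. prod (f x) (g x))"
proof (induction k arbitrary: f g)
  case 0
  then show ?case by (auto intro: continuous_on)
next
  case (Suc k)
  then have "D i (\<lambda>x. prod (f x) (g x)) =
      (\<lambda>x. prod (f x) (D i g x) + prod (D i f x) (g x))" for i
    by (auto simp: partial_deriv_prod)
  moreover have "(\<lambda>x. prod (f x) (g x)) differentiable (at x)" for x
    using Suc.prems FDERIV unfolding differentiable_def C_k.simps by blast
  ultimately show ?case
    using Suc C_k_Suc_imp[OF Suc.prems(1)] C_k_Suc_imp[OF Suc.prems(2)] 
    by (auto intro!: C_k_add)
qed

lemma smooth_prod: "smooth f \<Longrightarrow> smooth g \<Longrightarrow> smooth (\<lambda>x. prod (f x) (g x))"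
  by (simp add: smooth_def C_k_prod)

end

lemma smooth_sum:
  "(\<And>a. a \<in> A \<Longrightarrow> smooth (f a)) \<Longrightarrow> smooth (\<lambda>x. \<Sum>a\<in>A. f a x)"
  by (induction A rule: infinite_finite_induct) (auto intro: smooth_add smooth_const)

lemma partial_deriv_sum:
  assumes "\<And>a. a \<in> A \<Longrightarrow> f a differentiable (at x)"
  shows "D i (\<lambda>x. \<Sum>a\<in>A. f a x) x = (\<Sum>a\<in>A. D i (f a) x)"
  by (rule trans, rule partial_deriv_eqI, rule has_derivative_sum,
      rule assms[unfolded frechet_derivative_works], assumption)
    (simp add: partial_deriv_def)

lemma partial_deriv_linear_reparam:
  fixes L :: "real ^ 'm \<Rightarrow> real ^ 'n"
  assumes "bounded_linear L" "f differentiable (at (L x))"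
  shows "D i (\<lambda>x. f (L x)) x = (\<Sum>j\<in>UNIV. L (axis i 1) $ j *\<^sub>R D j f (L x))"
  using has_derivative_compose[OF bounded_linear_imp_has_derivative[OF assms(1)]
      has_derivative_partials[OF assms(2)]]
  by (rule partial_deriv_eqI)

text \<open>By the chain rule the partials are constant combinations of the functions
  \<open>D j f\<close> composed with \<open>L\<close>, so the induction runs over all smooth
  \<open>f\<close> at once.\<close>

lemma smooth_linear_reparam:
  fixes L :: "real ^ 'm \<Rightarrow> real ^ 'n"
  assumes L: "bounded_linear L" and f: "smooth f"
  shows "smooth (\<lambda>x. f (L x))"
proof -
  have C_k_sum: "C_k k (\<lambda>x. \<Sum>a\<in>A. c a *\<^sub>R g a x)"
    if "\<And>a. C_k k (g a)" for k A c and g :: "'n \<Rightarrow> real ^ 'm \<Rightarrow> 'a"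
    by (induction A rule: infinite_finite_induct)
      (auto intro!: C_k_add C_k_const bounded_linear.C_k_compose[OF bounded_linear_scaleR_right] that)
  have "C_k k (\<lambda>x. f (L x))" for k
    using f
  proof (induction k arbitrary: f)
    case 0
    then show ?case
      using continuous_on_compose2[OF smooth_continuous_on linear_continuous_on[OF L]] by auto
  next
    case (Suc k)
    have "D i (\<lambda>x. f (L x)) = (\<lambda>x. \<Sum>j\<in>UNIV. L (axis i 1) $ j *\<^sub>R D j f (L x))" for i
      using partial_deriv_linear_reparam[OF L smooth_differentiable[OF Suc.prems]] by auto
    moreover have "(\<lambda>x. f (L x)) differentiable (at x)" for x
      using has_derivative_compose[OF bounded_linear_imp_has_derivative[OF L]
          smooth_has_derivative[OF Suc.prems]] by (auto simp: differentiable_def)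
    ultimately show ?case
      using C_k_sum[OF Suc.IH[OF smooth_partial_deriv[OF Suc.prems]]] by auto
  qed
  then show ?thesis
    by (simp add: smooth_def)
qed

lemma torus_smooth_iff: "torus_smooth f \<longleftrightarrow> torus_periodic f \<and> smooth f"
  by (simp add: torus_smooth_def smooth_def)

lemma torus_smooth_smooth: "torus_smooth f \<Longrightarrow> smooth f"
  by (simp add: torus_smooth_iff)

lemma torus_periodicD: "torus_periodic f \<Longrightarrow> f (x + axis i 1) = f x"
  by (simp add: torus_periodic_def)

text \<open>Periodicity passes to the derivative by differentiating the shifted function, which
  equals \<open>f\<close>.\<close>

lemma torus_smooth_pd:
  assumes "torus_smooth f"
  shows "torus_smooth (D i f)"
proof -
  have "D i f (x + axis j 1) = D i f x" for x j
  proof -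
    have f: "(\<lambda>x. f (x + axis j 1)) = f"
      using assms by (auto simp: torus_smooth_def torus_periodic_def)
    have "((\<lambda>x. x + axis j 1) has_derivative (\<lambda>h. h)) (at x)"
      by (auto intro!: derivative_eq_intros)
    then have "((\<lambda>x. f (x + axis j 1)) has_derivative
        (\<lambda>h. \<Sum>i\<in>UNIV. h $ i *\<^sub>R D i f (x + axis j 1))) (at x)"
      by (rule has_derivative_compose[OF _ smooth_has_derivative[OF torus_smooth_smooth[OF assms]]])
    then have "D i (\<lambda>x. f (x + axis j 1)) x = (\<Sum>k\<in>UNIV. (axis i 1 :: real^_) $ k *\<^sub>R D k f (x + axis j 1))"
      by (rule partial_deriv_eqI)
    also have "\<dots> = D i f (x + axis j 1)"
      by (simp add: axis_def if_distrib[of "\<lambda>c. c *\<^sub>R _"] cong: if_cong)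
    finally show ?thesis
      by (simp add: f)
  qed
  then show ?thesis
    using assms smooth_partial_deriv by (auto simp: torus_smooth_iff torus_periodic_def)
qed

lemma torus_smooth_const: "torus_smooth (\<lambda>x. c)"
  by (simp add: torus_smooth_iff smooth_const torus_periodic_def)

lemma torus_smooth_add: "torus_smooth f \<Longrightarrow> torus_smooth g \<Longrightarrow> torus_smooth (\<lambda>x. f x + g x)"
  by (simp add: torus_smooth_iff smooth_add torus_periodic_def)

lemma torus_smooth_sum:
  "(\<And>a. a \<in> A \<Longrightarrow> torus_smooth (f a)) \<Longrightarrow> torus_smooth (\<lambda>x. \<Sum>a\<in>A. f a x)"
  by (simp add: torus_smooth_iff smooth_sum torus_periodic_def)

lemma (in bounded_linear) torus_smooth_compose:
  "torus_smooth g \<Longrightarrow> torus_smooth (\<lambda>x. f (g x))"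
  by (simp add: torus_smooth_iff smooth_compose torus_periodic_def)

lemma (in bounded_bilinear) torus_smooth_prod:
  "torus_smooth f \<Longrightarrow> torus_smooth g \<Longrightarrow> torus_smooth (\<lambda>x. prod (f x) (g x))"
  by (simp add: torus_smooth_iff smooth_prod torus_periodic_def)

lemmas torus_smooth_scaleR_const = bounded_linear.torus_smooth_compose[OF bounded_linear_scaleR_right]
lemmas torus_smooth_scaleR = bounded_bilinear.torus_smooth_prod[OF bounded_bilinear_scaleR]
lemmas torus_smooth_mult = bounded_bilinear.torus_smooth_prod[OF bounded_bilinear_mult]
lemmas torus_smooth_inner = bounded_bilinear.torus_smooth_prod[OF bounded_bilinear_inner]
lemmas torus_smooth_blinfun = bounded_bilinear.torus_smooth_prod[OF bounded_bilinear_blinfun_apply]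
lemmas torus_smooth_nth = bounded_linear.torus_smooth_compose[OF bounded_linear_vec_nth]

lemma torus_smooth_minus: "torus_smooth f \<Longrightarrow> torus_smooth (\<lambda>x. - f x)"
  using torus_smooth_scaleR_const[of f "-1"] by simp

lemma torus_smooth_diff: "torus_smooth f \<Longrightarrow> torus_smooth g \<Longrightarrow> torus_smooth (\<lambda>x. f x - g x)"
  using torus_smooth_add[OF _ torus_smooth_minus, of f g] by simp

lemmas torus_smooth_intros = torus_smooth_const torus_smooth_add torus_smooth_sum torus_smooth_minus
  torus_smooth_diff torus_smooth_scaleR torus_smooth_mult torus_smooth_inner torus_smooth_blinfun
  torus_smooth_nth torus_smooth_pd

lemmas torus_smooth_differentiable = smooth_differentiable[OF torus_smooth_smooth]
lemmas torus_smooth_cont = smooth_continuous_on[OF torus_smooth_smooth]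

lemma pd_add: "torus_smooth f \<Longrightarrow> torus_smooth g \<Longrightarrow>
    D i (\<lambda>x. f x + g x) = (\<lambda>x. D i f x + D i g x)"
  by (auto simp: partial_deriv_add torus_smooth_differentiable)

lemma pd_sum: "(\<And>a. a \<in> A \<Longrightarrow> torus_smooth (f a)) \<Longrightarrow>
    D i (\<lambda>x. \<Sum>a\<in>A. f a x) = (\<lambda>x. \<Sum>a\<in>A. D i (f a) x)"
  by (auto simp: partial_deriv_sum torus_smooth_differentiable)

lemma (in bounded_linear) pd_compose: "torus_smooth g \<Longrightarrow>
    D i (\<lambda>x. f (g x)) = (\<lambda>x. f (D i g x))"
  by (auto simp: partial_deriv_compose torus_smooth_differentiable)

lemma (in bounded_bilinear) pd_prod: "torus_smooth f \<Longrightarrow> torus_smooth g \<Longrightarrow>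
    D i (\<lambda>x. prod (f x) (g x)) = (\<lambda>x. prod (f x) (D i g x) + prod (D i f x) (g x))"
  by (auto simp: partial_deriv_prod torus_smooth_differentiable)

lemmas pd_scaleR_const = bounded_linear.pd_compose[OF bounded_linear_scaleR_right]
lemmas pd_nth = bounded_linear.pd_compose[OF bounded_linear_vec_nth]
lemmas pd_scaleR = bounded_bilinear.pd_prod[OF bounded_bilinear_scaleR]
lemmas pd_inner = bounded_bilinear.pd_prod[OF bounded_bilinear_inner]
lemmas pd_blinfun = bounded_bilinear.pd_prod[OF bounded_bilinear_blinfun_apply]

lemma pd_minus: "torus_smooth f \<Longrightarrow> D i (\<lambda>x. - f x) = (\<lambda>x. - D i f x)"
  using pd_scaleR_const[of f i "-1"] by simp

lemma pd_diff: "torus_smooth f \<Longrightarrow> torus_smooth g \<Longrightarrow>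
    D i (\<lambda>x. f x - g x) = (\<lambda>x. D i f x - D i g x)"
  using pd_add[OF _ torus_smooth_minus, of f g i] by (simp add: pd_minus)

section \<open>Integration over the two-dimensional torus\<close>

lemma torus_periodic_int:
  assumes "torus_periodic f"
  shows "f (x + of_int m *\<^sub>R axis i 1) = f x"
proof (induction m rule: int_induct[of _ 0])
  case (step1 m)
  then show ?case
    using torus_periodicD[OF assms, of "x + of_int m *\<^sub>R axis i 1" i]
    by (simp add: algebra_simps)
next
  case (step2 m)
  then show ?case
    using torus_periodicD[OF assms, of "x + of_int (m - 1) *\<^sub>R axis i 1" i]
    by (simp add: algebra_simps)
qed simp

text \<open>A point and its fractional parts differ by an integer combination of the axes. This
  reduces pointwise claims to the compact unit cube.\<close>

lemma torus_periodic_frac: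
  fixes x :: "real ^ 'n"
  assumes "torus_periodic f"
  shows "f (\<chi> i. frac (x $ i)) = f x"
proof -
  have "f (y + (\<Sum>i\<in>A. of_int (m i) *\<^sub>R axis i 1)) = f y" for A y and m :: "'n \<Rightarrow> int"
  proof (induction A rule: infinite_finite_induct)
    case (insert i A)
    then show ?case
      using torus_periodic_int[OF assms, of "y + (\<Sum>i\<in>A. of_int (m i) *\<^sub>R axis i 1)" "m i" i]
      by (simp add: algebra_simps)
  qed auto
  moreover have "x = (\<chi> i. frac (x $ i)) + (\<Sum>i\<in>UNIV. of_int \<lfloor>x $ i\<rfloor> *\<^sub>R axis i 1)"
    by (simp add: vec_eq_iff frac_def axis_def if_distrib[of "\<lambda>c. _ * c"] cong: if_cong)
  ultimately show ?thesis
    by metis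
qed

lemma torus_periodic_cube:
  fixes f :: "real ^ 'n \<Rightarrow> 'b"
  assumes "torus_periodic f"
  obtains y where "y \<in> cbox 0 1" "f x = f y"
proof
  show "(\<chi> i. frac (x $ i)) \<in> cbox 0 1"
    by (auto simp: mem_box_cart frac_lt_1 less_imp_le)
  show "f x = f (\<chi> i. frac (x $ i))"
    using torus_periodic_frac[OF assms, of x] by simp
qed

lemma torus_continuous_bounded:
  assumes "torus_periodic f" "continuous_on UNIV f"
  obtains K where "K > 0" "\<And>x. norm (f x) \<le> K"
proof -
  have "compact (f ` cbox 0 1)"
    using assms by (intro compact_continuous_image) (auto intro: continuous_on_subset)
  then obtain K where "K > 0" "\<forall>y \<in> f ` cbox 0 1. norm y \<le> K"
    using compact_imp_bounded bounded_pos by blast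
  then show ?thesis
    using that torus_periodic_cube[OF assms(1)] by (metis image_eqI)
qed

lemma torus_smooth_bounded:
  assumes "torus_smooth f"
  obtains K where "K > 0" "\<And>x. norm (f x) \<le> K"
  using torus_continuous_bounded assms torus_smooth_cont torus_smooth_iff by metis

abbreviation tint :: "(real ^ 2 \<Rightarrow> 'b::real_normed_vector) \<Rightarrow> 'b" where
  "tint f \<equiv> integral (cbox 0 1) f"

text \<open>Points are built from the axes so that a coordinate line is literally of the form
  \<open>x + t *\<^sub>R axis i 1\<close> used for derivatives along lines.\<close>

abbreviation pt :: "real \<Rightarrow> real \<Rightarrow> real ^ 2" where
  "pt s t \<equiv> s *\<^sub>R axis 1 1 + t *\<^sub>R axis 2 1"

lemma pt_nth: "pt s t $ 1 = s" "pt s t $ 2 = t"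
  by (auto simp: axis_def)

lemma pt_eta: "pt (x $ 1) (x $ 2) = x"
  by (simp add: vec_eq_iff forall_2 pt_nth del: vector_add_component vector_scaleR_component)

lemma continuous_on_pt:
  fixes f :: "real ^ 2 \<Rightarrow> 'b::real_normed_vector"
  assumes "continuous_on UNIV f" "continuous_on S g" "continuous_on S h"
  shows "continuous_on S (\<lambda>x. f (pt (g x) (h x)))"
  by (rule continuous_on_compose2[OF assms(1)]) (auto intro!: continuous_intros assms)

text \<open>A change of variables that only relabels coordinates between different types: boxes
  correspond to boxes of equal content. It brings Fubini's theorem for product types to
  vectors.\<close>

lemma integral_cbox_reparam:
  fixes g :: "'a::euclidean_space \<Rightarrow> 'c::euclidean_space" and f :: "'c \<Rightarrow> 'b::euclidean_space"
  assumes hg: "\<And>p. h (g p) = p" and gh: "\<And>x. g (h x) = x"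
    and g: "continuous_on UNIV g" and f: "continuous_on UNIV f"
    and mem: "\<And>u v p. g p \<in> cbox (g u) (g v) \<longleftrightarrow> p \<in> cbox u v"
    and r: "\<And>u v. cbox u v \<noteq> {} \<Longrightarrow> cbox (g u) (g v) \<noteq> {} \<Longrightarrow>
      measure lborel (cbox (g u) (g v)) = measure lborel (cbox u v)"
  shows "integral (cbox (g u) (g v)) f = integral (cbox u v) (\<lambda>p. f (g p))"
proof -
  have img: "g ` cbox u v = cbox (g u) (g v)" for u v
  proof (intro set_eqI iffI)
    fix x assume "x \<in> cbox (g u) (g v)"
    then have "h x \<in> cbox u v"
      using mem[of "h x" u v] by (simp add: gh)
    then show "x \<in> g ` cbox u v"
      using gh by (metis imageI)
  qed (use mem in auto)
  have h: "h ` cbox u v = cbox (h u) (h v)" for u v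
    using img[of "h u" "h v"] hg gh by (metis (no_types, lifting) image_cong image_ident image_image)
  have "((\<lambda>x. f (g x)) has_integral (1 / 1) *\<^sub>R integral (cbox (g u) (g v)) f) (h ` cbox (g u) (g v))"
  proof (rule has_integral_twiddle)
    show "continuous (at x) g" for x
      using g by (simp add: continuous_on_eq_continuous_within)
    show "(f has_integral integral (cbox (g u) (g v)) f) (cbox (g u) (g v))"
      using f by (intro integrable_integral integrable_continuous) (auto intro: continuous_on_subset)
    show "\<exists>w z. g ` cbox u v = cbox w z" "\<exists>w z. h ` cbox a b = cbox w z" for u v a b
      using img h by blast+
    show "measure lborel (g ` cbox u v) = 1 * measure lborel (cbox u v)" for u v
    proof (cases "cbox u v = {}")
      case False
      then show ?thesis
        using r[of u v] img[of u v] by auto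
    qed simp
  qed (use hg gh in auto)
  then show ?thesis
    by (simp add: h hg integral_unique)
qed

lemma prod_UNIV_2: "prod f (UNIV :: 2 set) = f 1 * f 2"
  unfolding UNIV_2 by simp

lemma prod_UNIV_3: "prod f (UNIV :: 3 set) = f 1 * f 2 * f 3"
  unfolding UNIV_3 by (simp add: ac_simps)

lemma tint_iterated:
  fixes f :: "real ^ 2 \<Rightarrow> 'b::euclidean_space"
  assumes f: "continuous_on UNIV f"
  shows "tint f = integral {0..1} (\<lambda>s. integral {0..1} (\<lambda>t. f (pt s t)))"
proof -
  let ?g = "\<lambda>p. pt (fst p) (snd p)"
  have "integral (cbox (?g (0, 0)) (?g (1, 1))) f = integral (cbox (0, 0) (1, 1)) (\<lambda>p. f (?g p))"
  proof (rule integral_cbox_reparam[where h = "\<lambda>x. (x $ 1, x $ 2)"])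
    show "continuous_on UNIV ?g"
      by (intro continuous_intros)
    show "?g p \<in> cbox (?g u) (?g v) \<longleftrightarrow> p \<in> cbox u v" for u v p
      by (cases u; cases v; cases p) (simp add: mem_box_cart forall_2 axis_def)
    show "measure lborel (cbox (?g u) (?g v)) = measure lborel (cbox u v)"
      if "cbox u v \<noteq> {}" "cbox (?g u) (?g v) \<noteq> {}" for u v
    proof -
      obtain a b c d where uv: "u = (a, c)" "v = (b, d)"
        by (cases u; cases v)
      have "a \<le> b" "c \<le> d"
        using that(1) by (auto simp: uv cbox_Pair_eq)
      moreover have "measure lborel (cbox (?g u) (?g v)) = (b - a) * (d - c)"
        unfolding content_cbox_cart[OF that(2)]
        unfolding prod_UNIV_2 pt_nth uv fst_conv snd_conv ..
      ultimately show ?thesis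
        by (simp add: uv content_Pair)
    qed
  qed (simp_all only: fst_conv snd_conv pt_nth pt_eta prod.collapse f)
  moreover have "?g (0, 0) = 0" "?g (1, 1) = 1"
    by (simp_all add: vec_eq_iff forall_2 axis_def)
  ultimately have "tint f = integral (cbox (0, 0) (1, 1)) (\<lambda>p. f (?g p))"
    by simp
  also have "\<dots> = integral (cbox 0 1) (\<lambda>s. integral (cbox 0 1) (\<lambda>t. f (?g (s, t))))"
    by (rule integral_prod_continuous) (intro continuous_on_pt[OF f] continuous_on_fst continuous_on_snd continuous_on_id)
  finally show ?thesis
    by simp
qed

lemma tint_iterated_swap:
  fixes f :: "real ^ 2 \<Rightarrow> 'b::euclidean_space"
  assumes f: "continuous_on UNIV f"
  shows "tint f = integral {0..1} (\<lambda>t. integral {0..1} (\<lambda>s. f (pt s t)))"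
  unfolding tint_iterated[OF f]
  using integral_swap_continuous[of 0 0 1 1 "\<lambda>s t. f (pt s t)"]
  by (simp add: continuous_on_pt f continuous_intros split_beta)

lemma has_vector_derivative_line:
  assumes "smooth f"
  shows "((\<lambda>t. f (x + t *\<^sub>R axis i 1)) has_vector_derivative D i f (x + t *\<^sub>R axis i 1)) (at t within S)"
proof -
  have "((\<lambda>t. x + t *\<^sub>R axis i 1) has_derivative (\<lambda>h. h *\<^sub>R axis i 1)) (at t)"
    by (auto intro!: derivative_eq_intros)
  from has_derivative_compose[OF this smooth_has_derivative[OF assms]]
  have "((\<lambda>t. f (x + t *\<^sub>R axis i 1)) has_derivative (\<lambda>h. h *\<^sub>R D i f (x + t *\<^sub>R axis i 1))) (at t)"
    by (simp add: axis_def if_distrib[of "\<lambda>c. _ * c"] if_distrib[of "\<lambda>c. c *\<^sub>R _"] cong: if_cong)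
  then show ?thesis
    by (simp add: has_vector_derivative_def has_derivative_at_withinI)
qed

lemma integral_partial_line:
  fixes f :: "real ^ 'n \<Rightarrow> 'b::banach"
  assumes "torus_smooth f"
  shows "integral {0..1} (\<lambda>t. D i f (x + t *\<^sub>R axis i 1)) = 0"
proof -
  have "((\<lambda>t. D i f (x + t *\<^sub>R axis i 1)) has_integral
      f (x + 1 *\<^sub>R axis i 1) - f (x + 0 *\<^sub>R axis i 1)) {0..1}"
    by (rule fundamental_theorem_of_calculus)
      (auto intro: has_vector_derivative_line torus_smooth_smooth assms)
  moreover have "f (x + axis i 1) = f x"
    using assms by (simp add: torus_smooth_iff torus_periodicD)
  ultimately show ?thesis
    by (simp add: integral_unique)
qed

text \<open>The order of integration is chosen so that the inner integral runs along axis
  \<open>i\<close>, where the fundamental theorem and periodicity make it vanish.\<close>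

lemma tint_partial_deriv:
  fixes f :: "real ^ 2 \<Rightarrow> 'b::euclidean_space"
  assumes "torus_smooth f"
  shows "tint (D i f) = 0"
proof (cases "i = 1")
  case True
  have "integral {0..1} (\<lambda>s. D 1 f (pt s t)) = 0" for t
    using integral_partial_line[OF assms, of 1 "t *\<^sub>R axis 2 1"] by (simp add: add.commute)
  then show ?thesis
    using True tint_iterated_swap[of "D i f"] assms
    by (simp add: torus_smooth_cont torus_smooth_pd)
next
  case False
  then have "i = 2"
    using exhaust_2 by blast
  moreover have "integral {0..1} (\<lambda>t. D 2 f (pt s t)) = 0" for s
    using integral_partial_line[OF assms, of 2 "s *\<^sub>R axis 1 1"] by simp
  ultimately show ?thesis
    using tint_iterated[of "D i f"] assms
    by (simp add: torus_smooth_cont torus_smooth_pd)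
qed

lemma tint_integrable: "continuous_on UNIV f \<Longrightarrow> f integrable_on cbox 0 (1 :: real ^ 2)"
  for f :: "real ^ 2 \<Rightarrow> 'b::banach"
  by (rule integrable_continuous) (auto intro: continuous_on_subset)

lemma content_unit [simp]: "measure lborel (cbox 0 (1 :: real ^ 2)) = 1"
  by (simp add: content_cbox_cart interval_ne_empty_cart)

lemma tint_const [simp]: "tint (\<lambda>x. c) = c"
  by (simp add: content_unit)

lemma tint_le:
  fixes f g :: "real ^ 2 \<Rightarrow> real"
  assumes "continuous_on UNIV f" "continuous_on UNIV g" "\<And>x. f x \<le> g x"
  shows "tint f \<le> tint g"
  by (rule integral_le) (auto intro: tint_integrable assms)

lemma tint_add:
  fixes f g :: "real ^ 2 \<Rightarrow> 'b::euclidean_space"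
  shows "torus_smooth f \<Longrightarrow> torus_smooth g \<Longrightarrow> tint (\<lambda>x. f x + g x) = tint f + tint g"
  by (intro integral_add tint_integrable torus_smooth_cont)

lemma tint_diff:
  fixes f g :: "real ^ 2 \<Rightarrow> 'b::euclidean_space"
  shows "torus_smooth f \<Longrightarrow> torus_smooth g \<Longrightarrow> tint (\<lambda>x. f x - g x) = tint f - tint g"
  by (intro integral_diff tint_integrable torus_smooth_cont)

lemma tint_sum:
  fixes f :: "'a \<Rightarrow> real ^ 2 \<Rightarrow> 'b::euclidean_space"
  assumes "finite A" "\<And>a. a \<in> A \<Longrightarrow> torus_smooth (f a)"
  shows "tint (\<lambda>x. \<Sum>a\<in>A. f a x) = (\<Sum>a\<in>A. tint (f a))"
  using assms by (intro integral_sum tint_integrable torus_smooth_cont)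

lemma tint_by_parts:
  fixes f g :: "real ^ 2 \<Rightarrow> 'b::euclidean_space"
  assumes "torus_smooth f" "torus_smooth g"
  shows "tint (\<lambda>x. f x \<bullet> D i g x) = - tint (\<lambda>x. D i f x \<bullet> g x)"
proof -
  have "tint (\<lambda>x. f x \<bullet> D i g x + D i f x \<bullet> g x) = 0"
    using tint_partial_deriv[of "\<lambda>x. f x \<bullet> g x" i] pd_inner[OF assms] assms
    by (simp add: torus_smooth_inner)
  then show ?thesis
    using tint_add[of "\<lambda>x. f x \<bullet> D i g x" "\<lambda>x. D i f x \<bullet> g x"] assms
    by (simp add: torus_smooth_intros)
qed

lemma tint_eq_0_imp:
  fixes f :: "real ^ 2 \<Rightarrow> real"
  assumes "continuous_on UNIV f" "\<And>x. f x \<ge> 0" "tint f = 0" "torus_periodic f"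
  shows "f x = 0"
proof -
  have "box 0 (1 :: real ^ 2) \<noteq> {}"
    by (simp add: interval_ne_empty_cart)
  then have "\<forall>x \<in> cbox 0 1. f x = 0"
    using integral_cbox_eq_0_iff[of 0 1 f] assms by (auto intro: continuous_on_subset)
  then show ?thesis
    using torus_periodic_cube[OF assms(4), of x] by metis
qed

section \<open>The L2 norm and the Cauchy-Schwarz inequality\<close>

definition l2 :: "(real ^ 2 \<Rightarrow> 'b::euclidean_space) \<Rightarrow> real" where
  "l2 u = sqrt (tint (\<lambda>x. u x \<bullet> u x))"

text \<open>The radicand is nonnegative for every \<open>u\<close>: the integral of a nonintegrable
  function is 0 by convention.\<close>

lemma l2_square: "(l2 u)\<^sup>2 = tint (\<lambda>x. u x \<bullet> u x)"
proof -
  have "tint (\<lambda>x. u x \<bullet> u x) \<ge> 0"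
    by (cases "(\<lambda>x. u x \<bullet> u x) integrable_on cbox 0 1")
      (auto intro: integral_nonneg simp: not_integrable_integral)
  then show ?thesis
    by (simp add: l2_def)
qed

lemma l2_nonneg [simp]: "l2 u \<ge> 0"
  unfolding l2_def real_sqrt_ge_0_iff
  by (metis l2_square zero_le_power2)

text \<open>Discriminant argument: the squared norm of \<open>u + t *\<^sub>R v\<close> is a
  nonnegative quadratic polynomial in \<open>t\<close>.\<close>

lemma tint_Cauchy_Schwarz:
  fixes u v :: "real ^ 2 \<Rightarrow> 'b::euclidean_space"
  assumes u: "continuous_on UNIV u" and v: "continuous_on UNIV v"
  shows "\<bar>tint (\<lambda>x. u x \<bullet> v x)\<bar> \<le> l2 u * l2 v"
proof -
  note [continuous_intros] = u v
  let ?b = "tint (\<lambda>x. u x \<bullet> v x)"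
  have quad: "0 \<le> (l2 u)\<^sup>2 + 2 * t * ?b + t\<^sup>2 * (l2 v)\<^sup>2" for t
  proof -
    have "0 \<le> tint (\<lambda>x. (u x + t *\<^sub>R v x) \<bullet> (u x + t *\<^sub>R v x))"
      by (intro integral_nonneg tint_integrable continuous_intros) auto
    also have "\<dots> = tint (\<lambda>x. u x \<bullet> u x + 2 * t * (u x \<bullet> v x) + t\<^sup>2 * (v x \<bullet> v x))"
      by (simp add: inner_add inner_commute algebra_simps power2_eq_square)
    also have "\<dots> = (l2 u)\<^sup>2 + 2 * t * ?b + t\<^sup>2 * (l2 v)\<^sup>2"
      unfolding l2_square
      by (subst integral_add; (intro tint_integrable continuous_intros)?)
        (subst integral_add; (intro tint_integrable continuous_intros)?; simp)
    finally show ?thesis .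
  qed
  have "?b\<^sup>2 \<le> (l2 u)\<^sup>2 * (l2 v)\<^sup>2"
  proof (cases "l2 v = 0")
    case True
    have "?b = 0"
    proof (rule ccontr)
      assume "?b \<noteq> 0"
      \<comment> \<open>For \<open>l2 v = 0\<close> the polynomial is affine in \<open>t\<close>,
        and this \<open>t\<close> gives it the value -1.\<close>
      then show False
        using quad[of "- ((l2 u)\<^sup>2 + 1) / (2 * ?b)"] True by (simp add: field_simps)
    qed
    then show ?thesis by simp
  next
    case False
    \<comment> \<open>The \<open>t\<close> inserted here is the minimizer of the polynomial.\<close>
    then have "2 * (- ?b / (l2 v)\<^sup>2) * ?b + (- ?b / (l2 v)\<^sup>2)\<^sup>2 * (l2 v)\<^sup>2 = - (?b\<^sup>2 / (l2 v)\<^sup>2)"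
      by (simp add: field_simps power2_eq_square)
    then have "?b\<^sup>2 / (l2 v)\<^sup>2 \<le> (l2 u)\<^sup>2"
      using quad[of "- ?b / (l2 v)\<^sup>2"] by linarith
    then show ?thesis
      using False by (simp add: pos_divide_le_eq)
  qed
  then have "\<bar>?b\<bar>\<^sup>2 \<le> (l2 u * l2 v)\<^sup>2"
    by (simp add: power_mult_distrib)
  then show ?thesis
    by (rule power2_le_imp_le) simp
qed

lemma l2_triangle:
  fixes u v :: "real ^ 2 \<Rightarrow> 'b::euclidean_space"
  assumes u: "continuous_on UNIV u" and v: "continuous_on UNIV v"
  shows "l2 (\<lambda>x. u x + v x) \<le> l2 u + l2 v"
proof (rule power2_le_imp_le)
  note [continuous_intros] = u v
  have "(l2 (\<lambda>x. u x + v x))\<^sup>2 = tint (\<lambda>x. u x \<bullet> u x + 2 * (u x \<bullet> v x) + v x \<bullet> v x)"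
    unfolding l2_square by (simp add: inner_add inner_commute algebra_simps)
  also have "\<dots> = (l2 u)\<^sup>2 + 2 * tint (\<lambda>x. u x \<bullet> v x) + (l2 v)\<^sup>2"
    unfolding l2_square
    by (subst integral_add; (intro tint_integrable continuous_intros)?)
      (subst integral_add; (intro tint_integrable continuous_intros)?; simp)
  also have "\<dots> \<le> (l2 u + l2 v)\<^sup>2"
    using tint_Cauchy_Schwarz[OF u v] by (simp add: power2_sum)
  finally show "(l2 (\<lambda>x. u x + v x))\<^sup>2 \<le> (l2 u + l2 v)\<^sup>2" .
qed (simp add: add_nonneg_nonneg)

lemma l2_bound:
  assumes "continuous_on UNIV u" "continuous_on UNIV v" "\<And>x. norm (u x) \<le> c * norm (v x)" "c \<ge> 0"
  shows "l2 u \<le> c * l2 v"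
proof (rule power2_le_imp_le)
  have "(l2 u)\<^sup>2 \<le> tint (\<lambda>x. c\<^sup>2 * (v x \<bullet> v x))"
    unfolding l2_square
  proof (rule tint_le)
    show "u x \<bullet> u x \<le> c\<^sup>2 * (v x \<bullet> v x)" for x
      using power_mono[OF assms(3)[of x], of 2]
      by (simp add: power_mult_distrib power2_norm_eq_inner)
  qed (intro continuous_intros assms)+
  then show "(l2 u)\<^sup>2 \<le> (c * l2 v)\<^sup>2"
    by (simp add: l2_square power_mult_distrib)
qed (simp add: assms)

lemma l2_norm: "l2 (\<lambda>x. norm (u x)) = l2 u"
  by (simp add: l2_def dot_square_norm flip: power2_eq_square)

lemma l2_const_one: "l2 (\<lambda>x. 1 :: real) = 1"
  by (simp add: l2_def)

lemma tint_norm_le_l2: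
  assumes "continuous_on UNIV u"
  shows "tint (\<lambda>x. norm (u x)) \<le> l2 u"
  using tint_Cauchy_Schwarz[of "\<lambda>x. norm (u x)" "\<lambda>x. 1"] assms
  by (simp add: continuous_intros l2_norm l2_const_one)

section \<open>Estimates on the unit interval\<close>

text \<open>The variance of \<open>h\<close> is nonnegative.\<close>

lemma integral_unit_square_le:
  fixes h :: "real \<Rightarrow> real"
  assumes "continuous_on {0..1} h"
  shows "(integral {0..1} h)\<^sup>2 \<le> integral {0..1} (\<lambda>t. (h t)\<^sup>2)"
proof -
  note [continuous_intros] = assms
  let ?m = "integral {0..1} h"
  have "0 \<le> integral {0..1} (\<lambda>t. (h t - ?m)\<^sup>2)"
    by (intro integral_nonneg integrable_continuous_interval continuous_intros) auto
  also have "\<dots> = integral {0..1} (\<lambda>t. (h t)\<^sup>2 + (- 2 * ?m) * h t + ?m\<^sup>2)"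
    by (simp add: power2_eq_square algebra_simps)
  also have "\<dots> = integral {0..1} (\<lambda>t. (h t)\<^sup>2) - ?m\<^sup>2"
    by (subst integral_add; (intro integrable_continuous_interval continuous_intros)?)
      (subst integral_add; (intro integrable_continuous_interval continuous_intros)?;
        simp add: power2_eq_square)
  finally show ?thesis by simp
qed

lemma norm_diff_le_integral_unit:
  fixes f :: "real \<Rightarrow> 'b::banach"
  assumes "\<And>t. t \<in> {0..1} \<Longrightarrow> (f has_vector_derivative f' t) (at t within {0..1})"
    and "continuous_on {0..1} f'" and "s \<in> {0..1}" "t \<in> {0..1}"
  shows "norm (f s - f t) \<le> integral {0..1} (\<lambda>t. norm (f' t))"
proof -
  have *: "norm (f b - f a) \<le> integral {0..1} (\<lambda>t. norm (f' t))"
    if "0 \<le> a" "a \<le> b" "b \<le> 1" for a b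
  proof -
    have cont: "continuous_on {a..b} f'"
      using assms(2) by (rule continuous_on_subset) (use that in auto)
    have "(f' has_integral f b - f a) {a..b}"
      by (rule fundamental_theorem_of_calculus[OF that(2)],
          rule has_vector_derivative_within_subset[OF assms(1)]) (use that in auto)
    then have "f b - f a = integral {a..b} f'"
      by (simp add: integral_unique)
    also have "norm \<dots> \<le> integral {a..b} (\<lambda>t. norm (f' t))"
      by (intro integral_norm_bound_integral integrable_continuous_interval continuous_intros cont) auto
    also have "\<dots> \<le> integral {0..1} (\<lambda>t. norm (f' t))"
      using that by (intro integral_subset_le integrable_continuous_interval continuous_intros cont assms(2)) auto
    finally show ?thesis .
  qed
  show ?thesis
    using *[of s t] *[of t s] assms(3,4) by (cases "s \<le> t") (auto simp: norm_minus_commute)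
qed

text \<open>One-dimensional Sobolev embedding: the bound of \<open>f s\<close> by \<open>f t\<close>
  plus the total variation is averaged over \<open>t\<close>.\<close>

lemma norm_le_integral_unit:
  fixes f :: "real \<Rightarrow> 'b::euclidean_space"
  assumes f: "\<And>t. t \<in> {0..1} \<Longrightarrow> (f has_vector_derivative f' t) (at t within {0..1})"
    and f': "continuous_on {0..1} f'" and "s \<in> {0..1}"
  shows "norm (f s) \<le> integral {0..1} (\<lambda>t. norm (f t) + norm (f' t))"
proof -
  have cont: "continuous_on {0..1} f"
    using f has_vector_derivative_continuous continuous_on_eq_continuous_within by blast
  let ?I = "integral {0..1} (\<lambda>t. norm (f' t))"
  have "norm (f s) \<le> norm (f t) + ?I" if "t \<in> {0..1}" for t
    using norm_diff_le_integral_unit[OF f f' assms(3) that] norm_triangle_sub[of "f s" "f t"] by auto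
  then have "integral {0..1::real} (\<lambda>t. norm (f s)) \<le> integral {0..1} (\<lambda>t. norm (f t) + ?I)"
    by (intro integral_le integrable_continuous_interval continuous_intros cont)
  also have "\<dots> = integral {0..1} (\<lambda>t. norm (f t) + norm (f' t))"
    by (simp add: integral_add integrable_continuous_interval continuous_intros cont f')
  finally show ?thesis by simp
qed

section \<open>Sup bounds and Poincare's inequality in two variables\<close>

lemma has_vector_derivative_pt:
  assumes "smooth f"
  shows "((\<lambda>s. f (pt s t)) has_vector_derivative D 1 f (pt s t)) (at s within S)"
    and "((\<lambda>t. f (pt s t)) has_vector_derivative D 2 f (pt s t)) (at t within S)"
  using has_vector_derivative_line[OF assms, of "t *\<^sub>R axis 2 1" 1 s S]
    has_vector_derivative_line[OF assms, of "s *\<^sub>R axis 1 1" 2 t S] by (simp_all add: add.commute)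

lemma cube_pt:
  fixes x :: "real ^ 2"
  assumes "x \<in> cbox 0 1"
  obtains s t where "s \<in> {0..1}" "t \<in> {0..1}" "x = pt s t"
  using that[OF _ _ pt_eta[of x, symmetric]] assms
  by (simp add: mem_box_cart forall_2)

lemma continuous_on_integral_unit:
  fixes f :: "'a::topological_space \<Rightarrow> real \<Rightarrow> 'b::banach"
  assumes "continuous_on (S \<times> {0..1}) (\<lambda>p. f (fst p) (snd p))"
  shows "continuous_on S (\<lambda>x. integral {0..1} (\<lambda>t. f x t))"
  using integral_continuous_on_param[of S 0 1 f] assms by (simp add: split_beta)

text \<open>The one-dimensional bound is used in the first variable for \<open>u\<close>, and in the
  second for \<open>u\<close> and \<open>D 1 u\<close>, so only the mixed second derivative enters.
  On a domain of volume one, L1 norms are at most L2 norms.\<close>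

theorem sup_le_l2_derivs:
  fixes u :: "real ^ 2 \<Rightarrow> 'b::euclidean_space"
  assumes u: "torus_smooth u"
  shows "norm (u x) \<le> l2 u + l2 (D 2 u) + (l2 (D 1 u) + l2 (D 2 (D 1 u)))"
proof -
  \<comment> \<open>\<open>?J f s\<close> dominates \<open>f\<close> on the whole line with first
    coordinate \<open>s\<close> and is independent of \<open>t\<close>, so it can be integrated in
    \<open>s\<close>.\<close>
  let ?J = "\<lambda>f s. integral {0..1} (\<lambda>t. norm (f (pt s t)) + norm (D 2 f (pt s t)))"
  have c: "continuous_on UNIV f" if "torus_smooth f" for f :: "real ^ 2 \<Rightarrow> 'b"
    using that by (rule torus_smooth_cont)
  have c2: "continuous_on UNIV (D i f)" if "torus_smooth f" for f :: "real ^ 2 \<Rightarrow> 'b" and i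
    using that by (intro c torus_smooth_pd)
  have line: "norm (f (pt s t)) \<le> ?J f s"
    if f: "torus_smooth f" and "t \<in> {0..1}" for f :: "real ^ 2 \<Rightarrow> 'b" and s t
    by (rule norm_le_integral_unit, rule has_vector_derivative_pt[OF torus_smooth_smooth[OF f]])
      (intro continuous_on_pt[OF c2[OF f]] continuous_intros that)+
  have J_cont: "continuous_on {0..1} (?J f)" if f: "torus_smooth f" for f :: "real ^ 2 \<Rightarrow> 'b"
    by (intro continuous_on_integral_unit continuous_on_add continuous_on_norm continuous_on_pt[OF c[OF f]] continuous_on_pt[OF c2[OF f]]
        continuous_intros)
  have J_int: "integral {0..1} (?J f) \<le> l2 f + l2 (D 2 f)" if f: "torus_smooth f" for f :: "real ^ 2 \<Rightarrow> 'b"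
  proof -
    have "integral {0..1} (?J f) = tint (\<lambda>x. norm (f x) + norm (D 2 f x))"
      by (rule tint_iterated[symmetric]) (intro continuous_intros c c2 f)
    also have "\<dots> = tint (\<lambda>x. norm (f x)) + tint (\<lambda>x. norm (D 2 f x))"
      by (intro integral_add tint_integrable continuous_intros c c2 f)
    also have "\<dots> \<le> l2 f + l2 (D 2 f)"
      by (intro add_mono tint_norm_le_l2 c c2 f)
    finally show ?thesis .
  qed
  obtain y where y: "y \<in> cbox 0 1" "u x = u y"
    using torus_periodic_cube u by (metis torus_smooth_iff)
  obtain s t where st: "s \<in> {0..1}" "t \<in> {0..1}" "y = pt s t"
    using cube_pt[OF y(1)] .
  have u1: "torus_smooth (D 1 u)"
    by (rule torus_smooth_pd[OF u])
  have "norm (u y) \<le> integral {0..1} (\<lambda>s. norm (u (pt s t)) + norm (D 1 u (pt s t)))"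
    unfolding st(3)
    by (rule norm_le_integral_unit, rule has_vector_derivative_pt[OF torus_smooth_smooth[OF u]])
      (intro continuous_on_pt[OF c2[OF u]] continuous_intros st)+
  also have "\<dots> \<le> integral {0..1} (\<lambda>s. ?J u s + ?J (D 1 u) s)"
  proof (rule integral_le)
    show "norm (u (pt s t)) + norm (D 1 u (pt s t)) \<le> ?J u s + ?J (D 1 u) s" for s
      by (intro add_mono line u u1 st)
    show "(\<lambda>s. norm (u (pt s t)) + norm (D 1 u (pt s t))) integrable_on {0..1}"
      by (intro integrable_continuous_interval continuous_on_add continuous_on_norm continuous_on_pt[OF c[OF u]]
          continuous_on_pt[OF c2[OF u]] continuous_intros)
  qed (intro integrable_continuous_interval continuous_on_add J_cont u u1)
  also have "\<dots> = integral {0..1} (?J u) + integral {0..1} (?J (D 1 u))"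
    by (intro integral_add integrable_continuous_interval J_cont u u1)
  also have "\<dots> \<le> l2 u + l2 (D 2 u) + (l2 (D 1 u) + l2 (D 2 (D 1 u)))"
    by (intro add_mono J_int u u1)
  finally show ?thesis
    by (simp add: y)
qed

abbreviation grad_l2 :: "(real ^ 2 \<Rightarrow> 'b::euclidean_space) \<Rightarrow> real" where
  "grad_l2 u \<equiv> l2 (D 1 u) + l2 (D 2 u)"

text \<open>Since the mean is zero, \<open>u\<close> at a point is the average of its differences to
  all points of the square. Each difference is estimated along a path with one corner.\<close>

theorem Poincare:
  fixes u :: "real ^ 2 \<Rightarrow> 'b::euclidean_space"
  assumes u: "torus_smooth u" and mean: "tint u = 0"
  shows "l2 u \<le> 2 * (grad_l2 u)"
proof -
  note smooth = u torus_smooth_pd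
  have cont: "continuous_on UNIV u" "continuous_on UNIV (D 1 u)" "continuous_on UNIV (D 2 u)"
    using u by (auto intro: torus_smooth_cont smooth)
  note [continuous_intros] = cont cont[THEN continuous_on_pt]
  \<comment> \<open>\<open>a t\<close> bounds the leg at constant second coordinate
    \<open>t\<close>; \<open>c\<close> arises from the other leg, at first coordinate
    \<open>q\<close>, after averaging over \<open>q\<close>.\<close>
  define a where "a t = integral {0..1} (\<lambda>s. norm (D 1 u (pt s t)))" for t
  define c where "c = tint (\<lambda>x. norm (D 2 u x))"
  have c_eq: "c = integral {0..1} (\<lambda>s. integral {0..1} (\<lambda>t. norm (D 2 u (pt s t))))"
    unfolding c_def by (rule tint_iterated) (intro continuous_intros)
  have d1_eq: "(l2 (D 1 u))\<^sup>2 =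
      integral {0..1} (\<lambda>t. integral {0..1} (\<lambda>s. D 1 u (pt s t) \<bullet> D 1 u (pt s t)))"
    unfolding l2_square by (rule tint_iterated_swap) (intro continuous_intros)
  have a_cont [continuous_intros]: "continuous_on {0..1} a"
    unfolding a_def by (auto intro!: continuous_intros continuous_on_integral_unit)
  have le: "norm (u (pt s t)) \<le> a t + c" if "s \<in> {0..1}" "t \<in> {0..1}" for s t
  proof -
    have eq: "u (pt s t) = integral {0..1} (\<lambda>q. integral {0..1} (\<lambda>r. u (pt s t) - u (pt q r)))"
    proof -
      have "integral {0..1} (\<lambda>q. integral {0..1} (\<lambda>r. u (pt s t) - u (pt q r))) = tint (\<lambda>x. u (pt s t) - u x)"
        by (simp add: tint_iterated continuous_intros)
      also have "\<dots> = u (pt s t) - tint u"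
        by (subst integral_diff; (intro tint_integrable continuous_intros)?) simp
      finally show ?thesis by (simp add: mean)
    qed
    have d: "norm (u (pt s t) - u (pt q r)) \<le> a t + integral {0..1} (\<lambda>t. norm (D 2 u (pt q t)))"
      if "q \<in> {0..1}" "r \<in> {0..1}" for q r
    proof -
      \<comment> \<open>The path turns at the corner \<open>pt q t\<close>.\<close>
      have "norm (u (pt s t) - u (pt q r)) \<le> norm (u (pt s t) - u (pt q t)) + norm (u (pt q t) - u (pt q r))"
        using norm_triangle_ineq[of "u (pt s t) - u (pt q t)" "u (pt q t) - u (pt q r)"] by simp
      also have "norm (u (pt s t) - u (pt q t)) \<le> a t"
        unfolding a_def using that \<open>s \<in> _\<close> u
        by (intro norm_diff_le_integral_unit has_vector_derivative_pt)
          (auto intro!: torus_smooth_smooth continuous_intros)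
      also have "norm (u (pt q t) - u (pt q r)) \<le> integral {0..1} (\<lambda>t. norm (D 2 u (pt q t)))"
        using that \<open>t \<in> _\<close> u
        by (intro norm_diff_le_integral_unit has_vector_derivative_pt)
          (auto intro!: torus_smooth_smooth continuous_intros)
      finally show ?thesis by simp
    qed
    have d2: "norm (integral {0..1} (\<lambda>r. u (pt s t) - u (pt q r)))
        \<le> a t + integral {0..1} (\<lambda>t. norm (D 2 u (pt q t)))" if "q \<in> {0..1}" for q
    proof -
      have "norm (integral {0..1} (\<lambda>r. u (pt s t) - u (pt q r)))
        \<le> integral {0..1::real} (\<lambda>r. a t + integral {0..1} (\<lambda>t. norm (D 2 u (pt q t))))"
        using d that by (intro integral_norm_bound_integral integrable_continuous_interval continuous_intros) auto
      then show ?thesis by simp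
    qed
    have "norm (u (pt s t)) \<le> integral {0..1} (\<lambda>q. a t + integral {0..1} (\<lambda>t. norm (D 2 u (pt q t))))"
      apply (subst eq)
      using d2 by (intro integral_norm_bound_integral integrable_continuous_interval continuous_intros continuous_on_integral_unit)
        (auto intro!: continuous_intros continuous_on_integral_unit)
    also have "\<dots> = a t + c"
      by (subst integral_add)
       (auto intro!: integrable_continuous_interval continuous_intros continuous_on_integral_unit
         simp: c_eq)
    finally show ?thesis .
  qed
  have "(l2 u)\<^sup>2 = integral {0..1} (\<lambda>t. integral {0..1} (\<lambda>s. u (pt s t) \<bullet> u (pt s t)))"
    by (simp add: l2_square tint_iterated_swap continuous_intros)
  also have "\<dots> \<le> integral {0..1} (\<lambda>t. 2 * integral {0..1} (\<lambda>s. D 1 u (pt s t) \<bullet> D 1 u (pt s t)) + 2 * c\<^sup>2)"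
  proof (intro integral_le integrable_continuous_interval)
    fix t :: real assume t: "t \<in> {0..1}"
    have "integral {0..1} (\<lambda>s. u (pt s t) \<bullet> u (pt s t)) \<le> integral {0..1::real} (\<lambda>s. (a t + c)\<^sup>2)"
    proof (intro integral_le integrable_continuous_interval)
      fix s :: real assume "s \<in> {0..1}"
      then show "u (pt s t) \<bullet> u (pt s t) \<le> (a t + c)\<^sup>2"
        using power_mono[OF le[OF _ t, of s], of 2] by (simp add: power2_norm_eq_inner)
    qed (auto intro!: continuous_intros)
    also have "\<dots> = (a t + c)\<^sup>2"
      by simp
    also have "\<dots> \<le> 2 * (a t)\<^sup>2 + 2 * c\<^sup>2"
      using sum_squares_bound[of "a t" c] by (simp add: power2_sum)
    also have "(a t)\<^sup>2 \<le> integral {0..1} (\<lambda>s. (norm (D 1 u (pt s t)))\<^sup>2)"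
      unfolding a_def by (intro integral_unit_square_le continuous_intros)
    finally show "integral {0..1} (\<lambda>s. u (pt s t) \<bullet> u (pt s t)) \<le>
        2 * integral {0..1} (\<lambda>s. D 1 u (pt s t) \<bullet> D 1 u (pt s t)) + 2 * c\<^sup>2"
      by (simp add: power2_norm_eq_inner)
  qed (auto intro!: continuous_intros continuous_on_integral_unit)
  also have "\<dots> = 2 * (l2 (D 1 u))\<^sup>2 + 2 * c\<^sup>2"
    by (subst integral_add)
     (auto intro!: integrable_continuous_interval continuous_intros continuous_on_integral_unit
         simp: d1_eq)
  also have "\<dots> \<le> 2 * (l2 (D 1 u))\<^sup>2 + 2 * (l2 (D 2 u))\<^sup>2"
  proof -
    have "0 \<le> c" "c \<le> l2 (D 2 u)"
      unfolding c_def by (auto intro!: tint_norm_le_l2 integral_nonneg tint_integrable continuous_intros)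
    then show ?thesis
      by (simp add: power_mono)
  qed
  \<comment> \<open>A generous bound of the sum of squares by the square of the sum; the constant 2
    obtained here enters the smallness threshold.\<close>
  also have "\<dots> \<le> (2 * (grad_l2 u))\<^sup>2"
    by (simp add: power2_eq_square algebra_simps)
  finally show ?thesis
    by (rule power2_le_imp_le) (simp add: add_nonneg_nonneg)
qed


section \<open>Sobolev norms of smooth functions\<close>

text \<open>An H^k norm: the sum of the L2 norms over all ordered sequences of at most
  \<open>k\<close> partial derivatives. The recursion peels off the innermost derivative, as
  \<open>C_k\<close> does.\<close>

primrec sob :: "nat \<Rightarrow> (real ^ 2 \<Rightarrow> 'b::euclidean_space) \<Rightarrow> real" where
  "sob 0 u = l2 u"
| "sob (Suc k) u = l2 u + (\<Sum>i\<in>UNIV. sob k (D i u))"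

lemma sob_nonneg [simp]: "sob k u \<ge> 0"
  by (induction k arbitrary: u) (auto intro!: add_nonneg_nonneg sum_nonneg)

lemma l2_le_sob: "l2 u \<le> sob k u"
  by (cases k) (auto intro: sum_nonneg)

lemma sob_Suc_le: "sob k u \<le> sob (Suc k) u"
proof (induction k arbitrary: u)
  case 0
  then show ?case by (auto intro: sum_nonneg)
next
  case (Suc k)
  have "(\<Sum>i\<in>UNIV. sob k (D i u)) \<le> (\<Sum>i\<in>UNIV. sob (Suc k) (D i u))"
    by (intro sum_mono Suc)
  then show ?case
    by (subst (1 2) sob.simps(2)) (rule add_left_mono)
qed

lemma sob_partial_deriv_le: "sob k (D i u) \<le> sob (Suc k) u"
proof -
  have "sob k (D i u) \<le> (\<Sum>i\<in>UNIV. sob k (D i u))"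
    by (rule member_le_sum) auto
  then show ?thesis
    using l2_nonneg[of u] unfolding sob.simps by linarith
qed

lemma sob_triangle:
  "torus_smooth u \<Longrightarrow> torus_smooth v \<Longrightarrow> sob k (\<lambda>x. u x + v x) \<le> sob k u + sob k v"
proof (induction k arbitrary: u v)
  case 0
  then show ?case
    by (simp add: l2_triangle torus_smooth_cont)
next
  case (Suc k)
  have "(\<Sum>i\<in>UNIV. sob k (\<lambda>x. D i u x + D i v x)) \<le>
      (\<Sum>i\<in>UNIV. sob k (D i u) + sob k (D i v))"
    by (intro sum_mono Suc.IH torus_smooth_pd Suc.prems)
  moreover have "l2 (\<lambda>x. u x + v x) \<le> l2 u + l2 v"
    using Suc.prems by (simp add: l2_triangle torus_smooth_cont)
  ultimately show ?case
    using Suc.prems by (simp add: pd_add sum.distrib)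
qed

lemma sob_minus: "torus_smooth u \<Longrightarrow> sob k (\<lambda>x. - u x) = sob k u"
proof (induction k arbitrary: u)
  case 0
  then show ?case by (simp add: l2_def)
next
  case (Suc k)
  then show ?case
    by (simp add: pd_minus torus_smooth_pd l2_def)
qed

lemma sob_diff_le:
  "torus_smooth u \<Longrightarrow> torus_smooth v \<Longrightarrow> sob k (\<lambda>x. u x - v x) \<le> sob k u + sob k v"
  using sob_triangle[of u "\<lambda>x. - v x" k] by (simp add: sob_minus torus_smooth_minus)

lemma sob_sum_le:
  fixes f :: "'a \<Rightarrow> real ^ 2 \<Rightarrow> 'b::euclidean_space"
  assumes "finite A" "\<And>a. a \<in> A \<Longrightarrow> torus_smooth (f a)"
  shows "sob k (\<lambda>x. \<Sum>a\<in>A. f a x) \<le> (\<Sum>a\<in>A. sob k (f a))"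
  using assms
proof (induction A rule: finite_induct)
  case empty
  have "sob k (\<lambda>x. 0 :: 'b) = 0"
    by (induction k) (auto simp: l2_def)
  then show ?case by simp
next
  case (insert a A)
  have "sob k (\<lambda>x. f a x + (\<Sum>a\<in>A. f a x)) \<le> sob k (f a) + sob k (\<lambda>x. \<Sum>a\<in>A. f a x)"
    using insert by (intro sob_triangle torus_smooth_sum) auto
  then show ?case
    using insert by fastforce
qed

text \<open>The constant depends on the multiplier \<open>a\<close> and on \<open>k\<close>, not on
  \<open>u\<close>. Leibniz' rule also produces the multiplier \<open>D i a\<close>, so the
  induction runs over all \<open>a\<close>.\<close>

lemma sob_prod_le:
  fixes prod :: "'a::real_normed_vector \<Rightarrow> 'b::euclidean_space \<Rightarrow> 'c::euclidean_space"
  assumes "bounded_bilinear prod" and "torus_smooth a"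
  shows "\<exists>C\<ge>0. \<forall>u. torus_smooth u \<longrightarrow> sob k (\<lambda>x. prod (a x) (u x)) \<le> C * sob k u"
  using assms(2)
proof (induction k arbitrary: a)
  case (0 a)
  obtain K where K: "K > 0" "\<And>x. norm (a x) \<le> K"
    using torus_smooth_bounded[OF 0] by blast
  obtain B where B: "B > 0" "\<And>a b. norm (prod a b) \<le> norm a * norm b * B"
    using bounded_bilinear.pos_bounded[OF assms(1)] by blast
  have "l2 (\<lambda>x. prod (a x) (u x)) \<le> (K * B) * l2 u" if u: "torus_smooth u" for u
  proof (rule l2_bound)
    show "norm (prod (a x) (u x)) \<le> (K * B) * norm (u x)" for x
    proof -
      have "norm (prod (a x) (u x)) \<le> norm (a x) * norm (u x) * B"
        by (rule B)
      also have "\<dots> \<le> K * norm (u x) * B"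
        using K B by (intro mult_right_mono) auto
      finally show ?thesis by (simp add: mult.commute mult.left_commute)
    qed
  qed (use K B 0 u in \<open>auto intro!: torus_smooth_cont bounded_bilinear.torus_smooth_prod[OF assms(1)]\<close>)
  then show ?case
    using K B by (intro exI[of _ "K * B"]) auto
next
  case (Suc k a)
  obtain C where C: "C \<ge> 0" "\<And>u. torus_smooth u \<Longrightarrow> sob k (\<lambda>x. prod (a x) (u x)) \<le> C * sob k u"
    using Suc.IH[OF Suc.prems] by blast
  have "\<exists>C\<ge>0. \<forall>u. torus_smooth u \<longrightarrow> sob k (\<lambda>x. prod (D i a x) (u x)) \<le> C * sob k u" for i
    by (intro Suc.IH torus_smooth_pd Suc.prems)
  then obtain L where L: "\<And>i. L i \<ge> 0"
    "\<And>i u. torus_smooth u \<Longrightarrow> sob k (\<lambda>x. prod (D i a x) (u x)) \<le> L i * sob k u"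
    by metis
  define E where "E = C + (\<Sum>i\<in>UNIV. C + L i)"
  have "sob (Suc k) (\<lambda>x. prod (a x) (u x)) \<le> E * sob (Suc k) u" if u: "torus_smooth u" for u
  proof -
    have "l2 (\<lambda>x. prod (a x) (u x)) \<le> C * sob (Suc k) u"
      using order_trans[OF l2_le_sob C(2)[OF u]] mult_left_mono[OF sob_Suc_le C(1)] by (rule order_trans)
    moreover have "sob k (D i (\<lambda>x. prod (a x) (u x))) \<le> (C + L i) * sob (Suc k) u" for i
    proof -
      have "sob k (D i (\<lambda>x. prod (a x) (u x))) \<le>
          sob k (\<lambda>x. prod (a x) (D i u x)) + sob k (\<lambda>x. prod (D i a x) (u x))"
        unfolding bounded_bilinear.pd_prod[OF assms(1) Suc.prems u]
        by (intro sob_triangle bounded_bilinear.torus_smooth_prod[OF assms(1)] torus_smooth_pd Suc.prems u)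
      also have "\<dots> \<le> C * sob k (D i u) + L i * sob k u"
        by (intro add_mono C L u torus_smooth_pd)
      also have "\<dots> \<le> C * sob (Suc k) u + L i * sob (Suc k) u"
        by (intro add_mono mult_left_mono C L sob_Suc_le sob_partial_deriv_le)
      finally show ?thesis by (simp add: distrib_right)
    qed
    then have "(\<Sum>i\<in>UNIV. sob k (D i (\<lambda>x. prod (a x) (u x)))) \<le> (\<Sum>i\<in>UNIV. (C + L i) * sob (Suc k) u)"
      by (rule sum_mono)
    ultimately show ?thesis
      unfolding E_def sob.simps(2)[of k "\<lambda>x. prod (a x) (u x)"] distrib_right sum_distrib_right
      by (rule add_mono)
  qed
  moreover have "E \<ge> 0"
    unfolding E_def using C L by (intro add_nonneg_nonneg sum_nonneg) auto
  ultimately show ?case by blast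
qed

lemma sup_le_sob:
  assumes "torus_smooth u"
  shows "norm (u x) \<le> sob 2 u"
proof -
  have "sob 2 u = l2 u + ((l2 (D 1 u) + (grad_l2 (D 1 u))) +
      (l2 (D 2 u) + (grad_l2 (D 2 u))))"
    by (simp add: numeral_2_eq_2 UNIV_2)
  then show ?thesis
    using sup_le_l2_derivs[OF assms, of x] l2_nonneg[of "D 1 (D 1 u)"]
      l2_nonneg[of "D 1 (D 2 u)"] l2_nonneg[of "D 2 (D 2 u)"] by linarith
qed

text \<open>Landau's inequality: uniform convergence of functions with bounded second derivatives carries
  over to their first derivatives.\<close>

lemma partial_deriv_interpolation:
  fixes w :: "real ^ 2 \<Rightarrow> 'b::euclidean_space"
  assumes w: "torus_smooth w" and 0: "\<And>x. norm (w x) \<le> M0" and 2: "\<And>x. norm (D i (D i w) x) \<le> M2"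
    and h: "h > 0"
  shows "norm (D i w x) \<le> 2 * M0 / h + 3 * h * M2"
proof -
  define e :: "real ^ 2" where "e = axis i 1"
  note line = has_vector_derivative_line[OF torus_smooth_smooth, of _ _ i, folded e_def]
  have M2: "M2 \<ge> 0"
    using 2[of 0] norm_ge_zero order_trans by blast
  \<comment> \<open>The linearization bound compares second derivatives with the one at the base
    point, at cost \<open>2 * M2\<close>; adding back the linear term gives the factor 3.\<close>
  have d1: "norm (D i w (x + s *\<^sub>R e) - D i w (x + 0 *\<^sub>R e)) \<le> 3 * h * M2" if "s \<in> {0..h}" for s
  proof -
    have "norm (D i w (x + s *\<^sub>R e) - D i w (x + 0 *\<^sub>R e) - (s - 0) *\<^sub>R D i (D i w) (x + 0 *\<^sub>R e))
        \<le> norm (s - 0) * (2 * M2)"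
    proof (rule vector_differentiable_bound_linearization[where S = UNIV])
      show "norm (D i (D i w) (x + t *\<^sub>R e) - D i (D i w) (x + 0 *\<^sub>R e)) \<le> 2 * M2" for t
        using norm_triangle_ineq4 2 by (smt (verit))
    qed (auto intro!: line torus_smooth_pd w)
    moreover have "norm ((s - 0) *\<^sub>R D i (D i w) (x + 0 *\<^sub>R e)) \<le> norm (s - 0) * M2"
      using 2 by (auto intro: mult_left_mono)
    ultimately have "norm (D i w (x + s *\<^sub>R e) - D i w (x + 0 *\<^sub>R e)) \<le> norm (s - 0) * (3 * M2)"
      using norm_triangle_sub[of "D i w (x + s *\<^sub>R e) - D i w (x + 0 *\<^sub>R e)"
          "(s - 0) *\<^sub>R D i (D i w) (x + 0 *\<^sub>R e)"] by (simp add: algebra_simps)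
    also have "\<dots> \<le> h * (3 * M2)"
      using that M2 by (intro mult_right_mono) auto
    finally show ?thesis by simp
  qed
  have "norm (w (x + h *\<^sub>R e) - w (x + 0 *\<^sub>R e) - (h - 0) *\<^sub>R D i w (x + 0 *\<^sub>R e)) \<le> norm (h - 0) * (3 * h * M2)"
    by (rule vector_differentiable_bound_linearization[where S = "{0..h}"])
      (use h in \<open>auto intro!: line w d1 simp: closed_segment_eq_real_ivl simp del: scaleR_zero_left\<close>)
  then have "norm (h *\<^sub>R D i w x) \<le> h * (3 * h * M2) + norm (w (x + h *\<^sub>R e) - w x)"
    using h norm_triangle_sub[of "h *\<^sub>R D i w x" "w (x + h *\<^sub>R e) - w x"]
    by (simp add: norm_minus_commute)
  also have "norm (w (x + h *\<^sub>R e) - w x) \<le> 2 * M0"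
    using norm_triangle_ineq4[of "w (x + h *\<^sub>R e)" "w x"] 0[of x] 0[of "x + h *\<^sub>R e"] by linarith
  finally show ?thesis
    using h by (simp add: field_simps)
qed

section \<open>Compactness\<close>

lemma torus_partials_bounded:
  assumes "torus_smooth u"
  shows "norm (D i u x) \<le> sob 3 u" "norm (D j (D i u) x) \<le> sob 4 u"
proof -
  show "norm (D i u x) \<le> sob 3 u"
    using sup_le_sob[of "D i u" x] sob_partial_deriv_le[of 2 i u] assms
    by (simp add: torus_smooth_pd numeral_3_eq_3 numeral_2_eq_2)
  show "norm (D j (D i u) x) \<le> sob 4 u"
    using sup_le_sob[of "D j (D i u)" x] sob_partial_deriv_le[of 2 j "D i u"]
      sob_partial_deriv_le[of 3 i u] assms
    by (simp add: torus_smooth_pd numeral_eq_Suc)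
qed

text \<open>Interpolation for the differences of \<open>v m\<close> and \<open>v n\<close>: their
  sup norms become small while their second derivatives stay below \<open>2 * C\<close>.\<close>

lemma uniformly_Cauchy_partial_deriv:
  fixes v :: "nat \<Rightarrow> real ^ 2 \<Rightarrow> 'b::euclidean_space"
  assumes v: "\<And>n. torus_smooth (v n)" and C: "\<And>n. sob 4 (v n) \<le> C"
    and Cau: "uniformly_Cauchy_on UNIV v"
  shows "uniformly_Cauchy_on UNIV (\<lambda>n. D i (v n))"
  unfolding uniformly_Cauchy_on_def
proof (intro allI impI)
  fix e :: real assume e: "e > 0"
  have C0: "C \<ge> 0"
    using C[of 0] sob_nonneg order_trans by blast
  then have C1: "C + 1 > 0"
    by simp
  \<comment> \<open>The second-derivative term \<open>3 * h * (2 * C)\<close> is then at most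
    \<open>e / 4\<close>; the \<open>+ 1\<close> covers \<open>C = 0\<close>.\<close>
  define h where "h = e / 24 / (C + 1)"
  have "h > 0" "h * (C + 1) = e / 24"
    using e C1 nonzero_eq_divide_eq[of "C + 1" h "e / 24"] by (simp_all add: h_def)
  then have h: "h > 0" "3 * h * (2 * C) < e / 2"
    using e by (auto simp: algebra_simps)
  \<comment> \<open>Makes the other term \<open>2 * d / h\<close> equal to
    \<open>e / 4\<close>.\<close>
  define d where "d = h * e / 8"
  have d: "d > 0" "2 * d / h < e / 2"
    using e h by (auto simp: d_def)
  obtain M where M: "\<And>x m n. m \<ge> M \<Longrightarrow> n \<ge> M \<Longrightarrow> norm (v m x - v n x) < d"
    using Cau d by (force simp: uniformly_Cauchy_on_def dist_norm)
  have "dist (D i (v m) x) (D i (v n) x) < e" if "m \<ge> M" "n \<ge> M" for x m n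
  proof -
    have "norm (D i (\<lambda>x. v m x - v n x) x) \<le> 2 * d / h + 3 * h * (2 * C)"
    proof (rule partial_deriv_interpolation)
      show "norm (D i (D i (\<lambda>x. v m x - v n x)) y) \<le> 2 * C" for y
        using torus_partials_bounded(2)[OF v, of i i m y] torus_partials_bounded(2)[OF v, of i i n y]
          C[of m] C[of n] norm_triangle_ineq4[of "D i (D i (v m)) y" "D i (D i (v n)) y"]
        by (simp add: pd_diff v torus_smooth_pd)
    qed (use M that h v in \<open>auto intro: less_imp_le torus_smooth_diff\<close>)
    then show ?thesis
      using h d by (simp add: pd_diff v dist_norm)
  qed
  then show "\<exists>M. \<forall>x\<in>UNIV. \<forall>m\<ge>M. \<forall>n\<ge>M. dist (D i (v m) x) (D i (v n) x) < e"
    by blast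
qed

lemma limit_partial_deriv:
  fixes v :: "nat \<Rightarrow> real ^ 2 \<Rightarrow> 'b::euclidean_space"
  assumes v: "\<And>n. torus_smooth (v n)" and C: "\<And>n. sob 4 (v n) \<le> C"
    and lim: "uniform_limit UNIV v u sequentially"
  shows "u differentiable (at x)" "uniform_limit UNIV (\<lambda>n. D i (v n)) (D i u) sequentially"
proof -
  have "uniformly_Cauchy_on UNIV v"
    using lim uniformly_convergent_on_def uniformly_convergent_Cauchy by blast
  then have "uniformly_convergent_on UNIV (\<lambda>n. D i (v n))" for i
    by (rule Cauchy_uniformly_convergent[OF uniformly_Cauchy_partial_deriv[OF v C]])
  then obtain g where g: "\<And>i. uniform_limit UNIV (\<lambda>n. D i (v n)) (g i) sequentially"
    unfolding uniformly_convergent_on_def by metis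
  have ptw: "(\<lambda>n. v n x) \<longlonglongrightarrow> u x" for x
    using tendsto_uniform_limitI[OF lim] by simp
  have "\<exists>w. \<forall>x\<in>UNIV. (\<lambda>n. v n x) \<longlonglongrightarrow> w x \<and>
      (w has_derivative (\<lambda>h. \<Sum>i\<in>UNIV. h $ i *\<^sub>R g i x)) (at x within UNIV)"
  proof (rule has_derivative_sequence)
    show "(v n has_derivative (\<lambda>h. \<Sum>i\<in>UNIV. h $ i *\<^sub>R D i (v n) x)) (at x within UNIV)" for n x
      by (simp add: smooth_has_derivative torus_smooth_smooth v)
    fix e :: real assume "e > 0"
    \<comment> \<open>Half of \<open>e\<close> for each of the two coordinate directions.\<close>
    then have "\<forall>\<^sub>F n in sequentially. \<forall>x\<in>UNIV. dist (D i (v n) x) (g i x) < e / 2" for i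
      using g[of i] half_gt_zero unfolding uniform_limit_iff by blast
    then have "\<forall>\<^sub>F n in sequentially. \<forall>i. \<forall>x\<in>UNIV. dist (D i (v n) x) (g i x) < e / 2"
      by (rule eventually_all_finite)
    then show "\<forall>\<^sub>F n in sequentially. \<forall>x\<in>UNIV. \<forall>h. norm ((\<Sum>i\<in>UNIV. h $ i *\<^sub>R D i (v n) x) -
        (\<Sum>i\<in>UNIV. h $ i *\<^sub>R g i x)) \<le> e * norm h"
    proof (rule eventually_mono, intro ballI allI)
      fix n x and h :: "real ^ 2"
      assume *: "\<forall>i. \<forall>x\<in>UNIV. dist (D i (v n) x) (g i x) < e / 2"
      have "norm ((\<Sum>i\<in>UNIV. h $ i *\<^sub>R D i (v n) x) - (\<Sum>i\<in>UNIV. h $ i *\<^sub>R g i x)) =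
          norm (\<Sum>i\<in>UNIV. h $ i *\<^sub>R (D i (v n) x - g i x))"
        by (simp add: sum_subtractf scaleR_diff_right)
      also have "\<dots> \<le> (\<Sum>i\<in>(UNIV :: 2 set). norm h * (e / 2))"
      proof (intro sum_norm_le)
        show "norm (h $ i *\<^sub>R (D i (v n) x - g i x)) \<le> norm h * (e / 2)" for i
          unfolding norm_scaleR real_norm_def
          using * component_le_norm_cart[of h i] by (intro mult_mono) (auto simp: dist_norm less_imp_le)
      qed
      finally show "norm ((\<Sum>i\<in>UNIV. h $ i *\<^sub>R D i (v n) x) - (\<Sum>i\<in>UNIV. h $ i *\<^sub>R g i x)) \<le> e * norm h"
        by (simp add: mult.commute)
    qed
  qed (use ptw in auto)
  then obtain w where w: "\<And>x. (\<lambda>n. v n x) \<longlonglongrightarrow> w x"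
    "\<And>x. (w has_derivative (\<lambda>h. \<Sum>i\<in>UNIV. h $ i *\<^sub>R g i x)) (at x)"
    by auto
  have "w = u"
    using LIMSEQ_unique[OF w(1) ptw] by blast
  then have der: "(u has_derivative (\<lambda>h. \<Sum>i\<in>UNIV. h $ i *\<^sub>R g i x)) (at x)" for x
    using w(2) by blast
  have "D i u = g i" for i
    using partial_deriv_eqI[OF der, of i]
    by (auto simp: axis_def if_distrib[of "\<lambda>c. c *\<^sub>R _"] cong: if_cong)
  then show "uniform_limit UNIV (\<lambda>n. D i (v n)) (D i u) sequentially"
    using g by metis
  show "u differentiable (at x)"
    using der differentiable_def by blast
qed

text \<open>Bounds of every order are inherited by the derivatives, so the hypotheses hold again for
  \<open>D i (v n)\<close> and \<open>D i u\<close>; this drives the induction on the order of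
  differentiability.\<close>

lemma limit_smooth:
  fixes v :: "nat \<Rightarrow> real ^ 2 \<Rightarrow> 'b::euclidean_space"
  assumes v: "\<And>n. torus_smooth (v n)" and C: "\<And>k. \<exists>C. \<forall>n. sob k (v n) \<le> C"
    and lim: "uniform_limit UNIV v u sequentially"
  shows "torus_smooth u"
proof -
  have "C_k k u" for k
    using assms
  proof (induction k arbitrary: u v)
    case 0
    have "continuous_on UNIV u"
      by (rule uniform_limit_theorem[OF always_eventually 0(3)])
        (use 0(1) torus_smooth_cont in auto)
    then show ?case by simp
  next
    case (Suc k)
    obtain C where "\<And>n. sob 4 (v n) \<le> C"
      using Suc.prems(2) by blast
    note * = limit_partial_deriv[OF Suc.prems(1) this Suc.prems(3)]
    have "C_k k (D i u)" for i
    proof (rule Suc.IH)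
      show "\<exists>C. \<forall>n. sob m (D i (v n)) \<le> C" for m
      proof -
        obtain C where "\<And>n. sob (Suc m) (v n) \<le> C"
          using Suc.prems(2) by blast
        then show ?thesis
          by (intro exI[of _ C] allI order_trans[OF sob_partial_deriv_le])
      qed
      show "torus_smooth (D i (v n))" for n
        by (rule torus_smooth_pd[OF Suc.prems(1)])
      show "uniform_limit UNIV (\<lambda>n. D i (v n)) (D i u) sequentially"
        by (rule *)
    qed
    then show ?case
      using * by simp
  qed
  moreover have "torus_periodic u"
    unfolding torus_periodic_def
  proof (intro allI)
    fix x i
    have "(\<lambda>n. v n (x + axis i 1)) \<longlonglongrightarrow> u (x + axis i 1)"
      using tendsto_uniform_limitI[OF lim] by simp
    moreover have "(\<lambda>n. v n (x + axis i 1)) = (\<lambda>n. v n x)"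
      using v by (simp add: torus_smooth_iff torus_periodicD)
    moreover have "(\<lambda>n. v n x) \<longlonglongrightarrow> u x"
      using tendsto_uniform_limitI[OF lim] by simp
    ultimately show "u (x + axis i 1) = u x"
      using LIMSEQ_unique by metis
  qed
  ultimately show ?thesis
    by (simp add: torus_smooth_def)
qed

lemma lipschitz_torus_smooth:
  assumes "torus_smooth u"
  shows "norm (u x - u y) \<le> 2 * sob 3 u * norm (x - y)"
proof (rule differentiable_bound[of UNIV])
  show "(u has_derivative (\<lambda>h. \<Sum>i\<in>UNIV. h $ i *\<^sub>R D i u x)) (at x within UNIV)" for x
    by (simp add: smooth_has_derivative torus_smooth_smooth assms)
  show "onorm (\<lambda>h. \<Sum>i\<in>UNIV. h $ i *\<^sub>R D i u x) \<le> 2 * sob 3 u" for x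
  proof (rule onorm_le)
    fix h :: "real ^ 2"
    have "norm (\<Sum>i\<in>UNIV. h $ i *\<^sub>R D i u x) \<le> (\<Sum>i\<in>(UNIV :: 2 set). norm h * sob 3 u)"
      by (intro sum_norm_le) (simp add: mult_mono component_le_norm_cart torus_partials_bounded(1)[OF assms])
    then show "norm (\<Sum>i\<in>UNIV. h $ i *\<^sub>R D i u x) \<le> 2 * sob 3 u * norm h"
      by (simp add: mult.commute mult.left_commute)
  qed
qed auto

text \<open>The subsequence is extracted for the functions alone; by interpolation its derivatives
  converge along with it.\<close>

theorem sob_bounded_convergent_subsequence:
  fixes v :: "nat \<Rightarrow> real ^ 2 \<Rightarrow> 'b::euclidean_space"
  assumes v: "\<And>n. torus_smooth (v n)" and bd: "\<And>k. \<exists>C. \<forall>n. sob k (v n) \<le> C"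
  obtains r u where "strict_mono (r :: nat \<Rightarrow> nat)" "torus_smooth u"
    "uniform_limit UNIV (\<lambda>n. v (r n)) u sequentially"
    "\<And>i. uniform_limit UNIV (\<lambda>n. D i (v (r n))) (D i u) sequentially"
proof -
  obtain C2 where C2: "\<And>n. sob 2 (v n) \<le> C2" using bd by blast
  obtain C3 where C3: "\<And>n. sob 3 (v n) \<le> C3" using bd by blast
  obtain C4 where C4: "\<And>n. sob 4 (v n) \<le> C4" using bd by blast
  have C3': "C3 \<ge> 0"
    using C3[of 0] sob_nonneg order_trans by blast
  obtain g r where r: "strict_mono (r :: nat \<Rightarrow> nat)" and
    g: "\<And>e. 0 < e \<Longrightarrow> \<exists>N. \<forall>n x. n \<ge> N \<and> x \<in> cbox 0 1 \<longrightarrow> norm (v (r n) x - g x) < e"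
  proof (rule Arzela_Ascoli[of "cbox 0 (1 :: real ^ 2)" v C2])
    show "norm (v n x) \<le> C2" for n x
      by (rule order_trans[OF sup_le_sob[OF v] C2])
    fix x :: "real ^ 2" and e :: real assume "e > 0"
    have L: "norm (v n x - v n y) \<le> 2 * C3 * norm (x - y)" for n y
      by (rule order_trans[OF lipschitz_torus_smooth[OF v]]) (simp add: mult_right_mono C3)
    have "2 * C3 * norm (x - y) < e" if "norm (x - y) < e / (2 * C3 + 1)" for y
    proof -
      have "2 * C3 * norm (x - y) \<le> (2 * C3 + 1) * norm (x - y)"
        by (intro mult_right_mono) auto
      also have "\<dots> < e"
        using that C3' by (simp add: field_simps add_nonneg_pos)
      finally show ?thesis .
    qed
    then show "\<exists>d>0. \<forall>n y. y \<in> cbox 0 1 \<and> norm (x - y) < d \<longrightarrow> norm (v n x - v n y) < e"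
      using le_less_trans[OF L] \<open>e > 0\<close> C3' by (intro exI[of _ "e / (2 * C3 + 1)"]) simp
  qed auto
  have "uniformly_Cauchy_on UNIV (\<lambda>n. v (r n))"
    unfolding uniformly_Cauchy_on_def
  proof (intro allI impI)
    fix e :: real assume "e > 0"
    then obtain N where N: "\<And>n x. n \<ge> N \<Longrightarrow> x \<in> cbox 0 1 \<Longrightarrow> norm (v (r n) x - g x) < e / 2"
      using g[OF half_gt_zero] by blast
    have "dist (v (r m) x) (v (r n) x) < e" if "m \<ge> N" "n \<ge> N" for x m n
    proof -
      \<comment> \<open>Pairing the two functions makes a single point of the cube represent
        \<open>x\<close> for both.\<close>
      have "torus_periodic (\<lambda>x. (v (r m) x, v (r n) x))"
        using v by (simp add: torus_smooth_iff torus_periodic_def)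
      then obtain y where y: "y \<in> cbox 0 1" "(v (r m) x, v (r n) x) = (v (r m) y, v (r n) y)"
        by (rule torus_periodic_cube)
      have "dist (v (r m) y) (v (r n) y) < e"
        by (rule dist_triangle_half_l[of _ "g y"]) (use N[OF that(1) y(1)] N[OF that(2) y(1)] in \<open>simp_all add: dist_norm\<close>)
      then show ?thesis using y(2) by simp
    qed
    then show "\<exists>M. \<forall>x\<in>UNIV. \<forall>m\<ge>M. \<forall>n\<ge>M. dist (v (r m) x) (v (r n) x) < e"
      by blast
  qed
  then obtain u where u: "uniform_limit UNIV (\<lambda>n. v (r n)) u sequentially"
    using Cauchy_uniformly_convergent uniformly_convergent_on_def by blast
  show ?thesis
  proof (rule that[OF r _ u])
    show "torus_smooth u"
    proof (rule limit_smooth[OF v _ u])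
      show "\<exists>C. \<forall>n. sob k (v (r n)) \<le> C" for k
        using bd[of k] by blast
    qed
    show "uniform_limit UNIV (\<lambda>n. D i (v (r n))) (D i u) sequentially" for i
      by (rule limit_partial_deriv(2)[OF v C4 u])
  qed
qed

section \<open>Positive semidefinite linear systems\<close>

text \<open>The unknowns are eliminated one at a time by passing to the Schur complement. Allowing a
  degenerate form dispenses with the linear independence of the Galerkin basis.\<close>

lemma semidefinite_linear_solve:
  fixes G :: "'j \<Rightarrow> 'j \<Rightarrow> real" and f :: "'j \<Rightarrow> real"
  assumes "finite J"
    and "\<And>c. (\<Sum>i\<in>J. c i * (\<Sum>j\<in>J. G i j * c j)) \<ge> 0"
    and "\<And>c. (\<Sum>i\<in>J. c i * (\<Sum>j\<in>J. G i j * c j)) = 0 \<Longrightarrow>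
      (\<forall>i\<in>J. (\<Sum>j\<in>J. G i j * c j) = 0 \<and> (\<Sum>j\<in>J. c j * G j i) = 0) \<and> (\<Sum>j\<in>J. c j * f j) = 0"
  shows "\<exists>c. \<forall>i\<in>J. (\<Sum>j\<in>J. G i j * c j) = f i"
  using assms
proof (induction J arbitrary: G f rule: finite_induct)
  case (insert p J)
  have ext: "(\<Sum>j\<in>J. F ((c(p := a)) j) j) = (\<Sum>j\<in>J. F (c j) j)" for F :: "real \<Rightarrow> 'j \<Rightarrow> real" and c a
    using insert.hyps by (intro sum.cong) auto
  show ?case
  proof (cases "G p p = 0")
    case True
    \<comment> \<open>The form vanishes on the unit vector of \<open>p\<close>, so the hypothesis
      kills row and column \<open>p\<close> and the entry \<open>f p\<close>: the unknown drops out
      of the system.\<close>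
    define \<delta> where "\<delta> = (\<lambda>j. if j = p then 1 else 0 :: real)"
    have \<delta>: "(\<Sum>j\<in>insert p J. F j * \<delta> j) = F p" "(\<Sum>j\<in>insert p J. \<delta> j * F j) = F p" for F
      using insert.hyps by (auto simp: \<delta>_def if_distrib[of "\<lambda>c. _ * c"] if_distrib[of "\<lambda>c. c * _"] cong: if_cong)
    have z: "G i p = 0" "G p i = 0" "f p = 0" if "i \<in> insert p J" for i
      using insert.prems(2)[of \<delta>] that unfolding \<delta> by (auto simp: True)
    have "\<exists>c. \<forall>i\<in>J. (\<Sum>j\<in>J. G i j * c j) = f i"
    proof (rule insert.IH)
      fix c :: "'j \<Rightarrow> real"
      let ?c = "c(p := 0)"
      have row: "(\<Sum>j\<in>insert p J. G i j * ?c j) = (\<Sum>j\<in>J. G i j * c j)" for i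
        using insert.hyps ext[of "\<lambda>x j. G i j * x" c 0] by simp
      have col: "(\<Sum>j\<in>insert p J. ?c j * h j) = (\<Sum>j\<in>J. c j * h j)" for h
        using insert.hyps ext[of "\<lambda>x j. x * h j" c 0] by simp
      show "(\<Sum>i\<in>J. c i * (\<Sum>j\<in>J. G i j * c j)) \<ge> 0"
        using insert.prems(1)[of ?c] unfolding row col .
      show "(\<forall>i\<in>J. (\<Sum>j\<in>J. G i j * c j) = 0 \<and> (\<Sum>j\<in>J. c j * G j i) = 0) \<and> (\<Sum>j\<in>J. c j * f j) = 0"
        if "(\<Sum>i\<in>J. c i * (\<Sum>j\<in>J. G i j * c j)) = 0"
        using insert.prems(2)[of ?c] that unfolding row col by blast
    qed
    then obtain c where "\<forall>i\<in>J. (\<Sum>j\<in>J. G i j * c j) = f i"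
      by blast
    then have "\<forall>i\<in>insert p J. (\<Sum>j\<in>insert p J. G i j * c j) = f i"
      using insert.hyps z z(3)[of p] by simp
    then show ?thesis by blast
  next
    case False
    define g where "g = G p p"
    \<comment> \<open>The Schur complement of the pivot, and the right-hand side after eliminating
      unknown \<open>p\<close>.\<close>
    define G' where "G' i j = G i j - G i p * G p j / g" for i j
    define f' where "f' i = f i - G i p * f p / g" for i
    have g: "g \<noteq> 0"
      using False by (simp add: g_def)
    have G'_row: "(\<Sum>j\<in>J. G' i j * c j) = (\<Sum>j\<in>J. G i j * c j) - G i p * (\<Sum>j\<in>J. G p j * c j) / g" for i c
      by (simp add: G'_def left_diff_distrib sum_subtractf sum_distrib_left sum_divide_distrib mult.assoc)
    have G'_col: "(\<Sum>j\<in>J. c j * G' j i) = (\<Sum>j\<in>J. c j * G j i) - (\<Sum>j\<in>J. c j * G j p) * G p i / g" for i c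
      by (simp add: G'_def right_diff_distrib sum_subtractf sum_distrib_right sum_divide_distrib mult.assoc)
    have "\<exists>c. \<forall>i\<in>J. (\<Sum>j\<in>J. G' i j * c j) = f' i"
    proof (rule insert.IH)
      fix c :: "'j \<Rightarrow> real"
      \<comment> \<open>This value annihilates row \<open>p\<close>, so the extended vector has
        under \<open>G\<close> the quadratic value that \<open>c\<close> has under
        \<open>G'\<close>.\<close>
      define a where "a = - (\<Sum>j\<in>J. G p j * c j) / g"
      let ?c = "c(p := a)"
      have row0: "(\<Sum>j\<in>insert p J. G i j * ?c j) = (\<Sum>j\<in>J. G' i j * c j)" for i
        using insert.hyps ext[of "\<lambda>x j. G i j * x" c a] by (simp add: G'_row a_def)
      have rowp: "(\<Sum>j\<in>J. G' p j * c j) = 0"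
        using g by (simp add: G'_row) (simp add: g_def)
      have col: "(\<Sum>j\<in>insert p J. ?c j * h j) = a * h p + (\<Sum>j\<in>J. c j * h j)" for h
        using insert.hyps ext[of "\<lambda>x j. x * h j" c a] by simp
      have Q: "(\<Sum>i\<in>insert p J. ?c i * (\<Sum>j\<in>insert p J. G i j * ?c j)) = (\<Sum>i\<in>J. c i * (\<Sum>j\<in>J. G' i j * c j))"
        unfolding row0 unfolding col rowp by simp
      show "(\<Sum>i\<in>J. c i * (\<Sum>j\<in>J. G' i j * c j)) \<ge> 0"
        using insert.prems(1)[of ?c] unfolding Q .
      assume "(\<Sum>i\<in>J. c i * (\<Sum>j\<in>J. G' i j * c j)) = 0"
      then have *: "\<And>i. i \<in> insert p J \<Longrightarrow> (\<Sum>j\<in>J. G' i j * c j) = 0"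
        "\<And>i. i \<in> insert p J \<Longrightarrow> a * G p i + (\<Sum>j\<in>J. c j * G j i) = 0" "a * f p + (\<Sum>j\<in>J. c j * f j) = 0"
        using insert.prems(2)[of ?c] unfolding Q unfolding row0 unfolding col by blast+
      have a: "(\<Sum>j\<in>J. c j * G j p) = - a * g"
        using *(2)[of p] by (simp add: g_def)
      have "(\<Sum>j\<in>J. c j * f' j) = (\<Sum>j\<in>J. c j * f j) - (\<Sum>j\<in>J. c j * G j p) * f p / g"
        by (simp add: f'_def right_diff_distrib sum_subtractf sum_distrib_right sum_divide_distrib mult.assoc)
      also have "\<dots> = 0"
        unfolding a using *(3) g by simp
      finally have "(\<Sum>j\<in>J. c j * f' j) = 0" .
      moreover have "(\<Sum>j\<in>J. c j * G' j i) = 0" if "i \<in> J" for i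
        unfolding G'_col a using *(2)[of i] that g by simp
      ultimately show "(\<forall>i\<in>J. (\<Sum>j\<in>J. G' i j * c j) = 0 \<and> (\<Sum>j\<in>J. c j * G' j i) = 0) \<and> (\<Sum>j\<in>J. c j * f' j) = 0"
        using *(1) by blast
    qed
    then obtain c where c: "\<And>i. i \<in> J \<Longrightarrow> (\<Sum>j\<in>J. G' i j * c j) = f' i"
      by blast
    \<comment> \<open>Back substitution from row \<open>p\<close>.\<close>
    define a where "a = (f p - (\<Sum>j\<in>J. G p j * c j)) / g"
    have row: "(\<Sum>j\<in>insert p J. G i j * (c(p := a)) j) = G i p * a + (\<Sum>j\<in>J. G i j * c j)" for i
      using insert.hyps ext[of "\<lambda>x j. G i j * x" c a] by simp
    have "(\<Sum>j\<in>insert p J. G i j * (c(p := a)) j) = f i" if "i \<in> insert p J" for i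
    proof (cases "i = p")
      case True
      then show ?thesis
        unfolding row using g by (simp add: a_def) (simp add: g_def)
    next
      case False
      then have "(\<Sum>j\<in>J. G i j * c j) = f' i + G i p * (\<Sum>j\<in>J. G p j * c j) / g"
        using c[of i] that by (simp add: G'_row)
      then show ?thesis
        unfolding row by (simp add: a_def f'_def diff_divide_distrib right_diff_distrib)
    qed
    then show ?thesis by blast
  qed
qed simp

section \<open>Trigonometric monomials\<close>

definition phase :: "int \<times> int \<Rightarrow> real ^ 2 \<Rightarrow> real" where
  "phase k x = 2 * pi * (of_int (fst k) * x $ 1 + of_int (snd k) * x $ 2)"

definition freq :: "int \<times> int \<Rightarrow> 2 \<Rightarrow> real" where
  "freq k i = 2 * pi * of_int (if i = 1 then fst k else snd k)"

lemma phase_shift: "phase k (x + axis i 1) = phase k x + 2 * pi * of_int (if i = 1 then fst k else snd k)"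
  using exhaust_2[of i] by (auto simp: phase_def axis_def algebra_simps)

lemma phase_add: "phase (k + l) x = phase k x + phase l x"
  by (simp add: phase_def algebra_simps)

lemma phase_diff: "phase (k - l) x = phase k x - phase l x"
  by (simp add: phase_def algebra_simps)

lemma has_derivative_phase: "(phase k has_derivative (\<lambda>h. \<Sum>i\<in>UNIV. freq k i * h $ i)) (at x)"
proof -
  have "phase k = (\<lambda>x. \<Sum>i\<in>UNIV. freq k i * x $ i)"
    by (auto simp: phase_def freq_def UNIV_2 algebra_simps)
  moreover have "((\<lambda>x. \<Sum>i\<in>UNIV. freq k i * x $ i) has_derivative (\<lambda>h. \<Sum>i\<in>UNIV. freq k i * h $ i)) (at x)"
    by (intro has_derivative_sum has_derivative_mult_right bounded_linear_imp_has_derivative bounded_linear_vec_nth)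
  ultimately show ?thesis by simp
qed

text \<open>The flag is true for the cosine and false for the sine, so differentiation negates
  it.\<close>

definition trig :: "bool \<Rightarrow> int \<times> int \<Rightarrow> real ^ 2 \<Rightarrow> real" where
  "trig b k x = (if b then cos (phase k x) else sin (phase k x))"

lemma has_derivative_trig:
  "(trig b k has_derivative (\<lambda>h. (\<Sum>i\<in>UNIV. freq k i * h $ i) * ((if b then - 1 else 1) * trig (\<not> b) k x))) (at x)"
  using DERIV_cos[THEN DERIV_compose_FDERIV, OF has_derivative_phase, of k x]
    DERIV_sin[THEN DERIV_compose_FDERIV, OF has_derivative_phase, of k x]
  by (cases b) (simp_all add: trig_def [abs_def])

lemma partial_deriv_trig: "D i (trig b k) = (\<lambda>x. (if b then - freq k i else freq k i) * trig (\<not> b) k x)"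
proof
  fix x
  have "(\<Sum>j\<in>UNIV. freq k j * (axis i 1 :: real ^ 2) $ j) = freq k i"
    by (simp add: axis_def if_distrib[of "\<lambda>c. _ * c"] cong: if_cong)
  then show "D i (trig b k) x = (if b then - freq k i else freq k i) * trig (\<not> b) k x"
    using partial_deriv_eqI[OF has_derivative_trig[of b k x], of i] by (cases b) simp_all
qed

lemma torus_smooth_trig: "torus_smooth (trig b k)"
proof -
  \<comment> \<open>The scalar factor makes the family closed under differentiation.\<close>
  have "C_k n (\<lambda>x. c * trig b k x)" for n c
  proof (induction n arbitrary: b c)
    case 0
    have "continuous_on UNIV (trig b k)"
      by (intro continuous_at_imp_continuous_on ballI has_derivative_continuous[OF has_derivative_trig])
    then show ?case by (auto intro: continuous_intros)
  next
    case (Suc n)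
    have d: "trig b k differentiable (at x)" for x
      unfolding differentiable_def by (rule exI, rule has_derivative_trig)
    have "D i (\<lambda>x. c * trig b k x) = (\<lambda>x. (c * (if b then - freq k i else freq k i)) * trig (\<not> b) k x)" for i
      using bounded_linear.partial_deriv_compose[OF bounded_linear_mult_right d, of i c]
      by (auto simp: partial_deriv_trig)
    then show ?case
      using Suc.IH by (simp add: d differentiable_mult)
  qed
  from this[of _ 1] have "smooth (trig b k)"
    by (simp add: smooth_def)
  moreover have "torus_periodic (trig b k)"
    unfolding torus_periodic_def trig_def phase_shift sin_add cos_add cos_int_2pin sin_int_2pin
    by simp
  ultimately show ?thesis
    by (simp add: torus_smooth_iff)
qed

section \<open>Completeness of the trigonometric monomials\<close>

text \<open>Product-to-sum formulas. Their existence, whatever the coefficients, shows that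
  multiplication by a monomial preserves orthogonality to all monomials.\<close>

lemma trig_mult_trig:
  "\<exists>b'' s t. \<forall>x. trig b l x * trig b' k x = s * trig b'' (k + l) x + t * trig b'' (k - l) x"
proof -
  consider "b = b'" "b" | "b = b'" "\<not> b" | "b" "\<not> b'" | "\<not> b" "b'"
    by blast
  then show ?thesis
  proof cases
    case 1
    then show ?thesis
      by (intro exI[of _ True] exI[of _ "1/2"])
        (simp add: trig_def phase_add phase_diff cos_add cos_diff mult.commute add_divide_distrib diff_divide_distrib)
  next
    case 2
    then show ?thesis
      by (intro exI[of _ True] exI[of _ "-1/2"] exI[of _ "1/2"])
        (simp add: trig_def phase_add phase_diff cos_add cos_diff mult.commute add_divide_distrib diff_divide_distrib)
  next
    case 3
    then show ?thesis
      by (intro exI[of _ False] exI[of _ "1/2"] exI[of _ "1/2"])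
        (simp add: trig_def phase_add phase_diff sin_add sin_diff mult.commute add_divide_distrib diff_divide_distrib)
  next
    case 4
    then show ?thesis
      by (intro exI[of _ False] exI[of _ "1/2"] exI[of _ "-1/2"])
        (simp add: trig_def phase_add phase_diff sin_add sin_diff mult.commute add_divide_distrib diff_divide_distrib)
  qed
qed

lemma continuous_on_trig: "continuous_on S (trig b k)"
  by (rule torus_smooth_cont[OF torus_smooth_trig])

text \<open>The orthogonality passes to all powers of the trigonometric kernel \<open>q\<close>, which concentrate at \<open>a\<close>.\<close>

lemma trig_orthogonal_imp_nonpos:
  fixes g :: "real ^ 2 \<Rightarrow> real"
  assumes g: "continuous_on UNIV g" "torus_periodic g"
    and orth: "\<And>b k. tint (\<lambda>x. g x * trig b k x) = 0" and a: "a \<in> cbox 0 1"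
  shows "g a \<le> 0"
proof (rule ccontr)
  \<comment> \<open>\<open>\<kappa> l\<close> has values between 0 and 1 and equals 1 exactly where
    phase \<open>l\<close> agrees with its value at \<open>a\<close> modulo \<open>2 * pi\<close>.
    So \<open>q\<close> equals 1 exactly at the integer translates of \<open>a\<close>.\<close>
  define \<kappa> where "\<kappa> l x = (1 + cos (phase l x - phase l a)) / 2" for l x
  define q where "q x = \<kappa> (1, 0) x * \<kappa> (0, 1) x" for x
  \<comment> \<open>Multipliers that keep \<open>g\<close> orthogonal to all monomials. They form a
    linear space closed under multiplication by monomials, hence by \<open>q\<close>.\<close>
  define P where "P \<phi> \<longleftrightarrow> continuous_on UNIV \<phi> \<and> (\<forall>b k. tint (\<lambda>x. g x * \<phi> x * trig b k x) = 0)"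
    for \<phi> :: "real ^ 2 \<Rightarrow> real"
  note cont = continuous_intros g(1) continuous_on_trig
  have P_D: "tint (\<lambda>x. g x * \<phi> x * trig b k x) = 0" if "P \<phi>" for \<phi> b k
    using that unfolding P_def by blast
  have P_add: "P (\<lambda>x. \<phi> x + \<psi> x)" if "P \<phi>" "P \<psi>" for \<phi> \<psi>
  proof -
    have c: "continuous_on UNIV \<phi>" "continuous_on UNIV \<psi>"
      using that by (auto simp: P_def)
    have "tint (\<lambda>x. g x * (\<phi> x + \<psi> x) * trig b k x) = 0" for b k
    proof -
      have "tint (\<lambda>x. g x * (\<phi> x + \<psi> x) * trig b k x) =
          tint (\<lambda>x. g x * \<phi> x * trig b k x + g x * \<psi> x * trig b k x)"
        by (simp add: algebra_simps)
      also have "\<dots> = tint (\<lambda>x. g x * \<phi> x * trig b k x) + tint (\<lambda>x. g x * \<psi> x * trig b k x)"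
        by (intro integral_add tint_integrable cont c)
      finally show ?thesis
        using that by (simp add: P_D)
    qed
    then show ?thesis
      using c by (simp add: P_def continuous_on_add)
  qed
  have P_scale: "P (\<lambda>x. c * \<phi> x)" if "P \<phi>" for \<phi> c
  proof -
    have "tint (\<lambda>x. g x * (c * \<phi> x) * trig b k x) = c * tint (\<lambda>x. g x * \<phi> x * trig b k x)" for b k
      by (simp add: mult.assoc mult.left_commute flip: integral_mult_right)
    then show ?thesis
      using that by (auto simp: P_def intro: continuous_intros)
  qed
  have P_trig: "P (\<lambda>x. \<phi> x * trig b l x)" if P: "P \<phi>" for \<phi> b l
  proof -
    have c: "continuous_on UNIV \<phi>"
      using that by (auto simp: P_def)
    have "tint (\<lambda>x. g x * (\<phi> x * trig b l x) * trig b' k x) = 0" for b' k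
    proof -
      obtain b'' s t where *: "\<And>x. trig b l x * trig b' k x = s * trig b'' (k + l) x + t * trig b'' (k - l) x"
        using trig_mult_trig by blast
      have "tint (\<lambda>x. g x * (\<phi> x * trig b l x) * trig b' k x) =
          tint (\<lambda>x. s * (g x * \<phi> x * trig b'' (k + l) x) + t * (g x * \<phi> x * trig b'' (k - l) x))"
        by (simp add: mult.assoc *) (simp add: algebra_simps)
      also have "\<dots> = s * tint (\<lambda>x. g x * \<phi> x * trig b'' (k + l) x) + t * tint (\<lambda>x. g x * \<phi> x * trig b'' (k - l) x)"
        by (subst integral_add) (auto intro!: tint_integrable cont c)
      also have "\<dots> = 0"
        using P by (simp add: P_D)
      finally show ?thesis .
    qed
    then show ?thesis
      using c by (simp add: P_def continuous_on_mult continuous_on_trig)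
  qed
  have P_kappa: "P (\<lambda>x. \<phi> x * \<kappa> l x)" if "P \<phi>" for \<phi> l
  proof -
    have "\<phi> x * \<kappa> l x = 1/2 * \<phi> x + ((cos (phase l a) / 2) * (\<phi> x * trig True l x) +
        (sin (phase l a) / 2) * (\<phi> x * trig False l x))" for x
      by (simp add: \<kappa>_def trig_def cos_diff field_simps)
    then show ?thesis
      using that by (simp only:) (intro P_add P_scale P_trig)
  qed
  have P_q: "P (\<lambda>x. q x ^ n)" for n
  proof (induction n)
    case 0
    then show ?case
      using orth by (simp add: P_def)
  next
    case (Suc n)
    from P_kappa[OF P_kappa[OF Suc]] show ?case
      by (simp add: q_def mult_ac)
  qed
  have int_q: "tint (\<lambda>x. g x * q x ^ n) = 0" for n
    using P_D[OF P_q[of n], of True "(0, 0)"]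
    by (simp add: trig_def phase_def)
  have q_cont: "continuous_on S q" for S
    unfolding q_def \<kappa>_def phase_def by (intro continuous_intros) auto
  have k01: "0 \<le> \<kappa> l x" "\<kappa> l x \<le> 1" for l x
  proof -
    have "- 1 \<le> cos (phase l x - phase l a)"
      by (rule cos_ge_minus_one)
    then have "0 \<le> 1 + cos (phase l x - phase l a)"
      by linarith
    then show "0 \<le> \<kappa> l x"
      by (simp add: \<kappa>_def)
  qed (simp add: \<kappa>_def)
  then have q01: "0 \<le> q x" "q x \<le> 1" for x
    by (auto simp: q_def mult_le_one)
  \<comment> \<open>For \<open>a\<close> on the boundary the cube contains several peaks;
    periodicity gives \<open>g\<close> the same value at all of them.\<close>
  have q1: "g x = g a" if "q x = 1" for x
  proof -
    have "\<kappa> (1, 0) x = 1" "\<kappa> (0, 1) x = 1"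
      using that k01 unfolding q_def
      by (metis mult.right_neutral mult_left_le order_antisym, metis mult.left_neutral mult_right_le_one_le order_antisym)
    then have "cos (phase (1, 0) x - phase (1, 0) a) = 1" "cos (phase (0, 1) x - phase (0, 1) a) = 1"
      by (auto simp: \<kappa>_def)
    then obtain m n :: int where "phase (1, 0) x - phase (1, 0) a = of_int m * 2 * pi"
      "phase (0, 1) x - phase (0, 1) a = of_int n * 2 * pi"
      using cos_one_2pi_int by metis
    then have "2 * pi * (x $ 1 - a $ 1) = 2 * pi * of_int m" "2 * pi * (x $ 2 - a $ 2) = 2 * pi * of_int n"
      by (simp_all add: phase_def algebra_simps)
    then have "x $ 1 - a $ 1 = of_int m" "x $ 2 - a $ 2 = of_int n"
      by simp_all
    then have "x = a + of_int m *\<^sub>R axis 1 1 + of_int n *\<^sub>R axis 2 1"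
      by (simp add: vec_eq_iff forall_2 axis_def)
    then show ?thesis
      using torus_periodic_int[OF g(2)] by simp
  qed
  assume "\<not> g a \<le> 0"
  define m where "m = g a / 2"
  have m: "m > 0" "g a > m"
    using \<open>\<not> g a \<le> 0\<close> by (auto simp: m_def)
  \<comment> \<open>This compact set contains no peak because \<open>g a > m\<close>, so
    \<open>q\<close> stays below some \<open>r < 1\<close> on it.\<close>
  define S where "S = {x \<in> cbox 0 1. g x \<le> m}"
  have S: "compact S"
  proof -
    have "S = cbox 0 1 \<inter> {x. g x \<le> m}"
      by (auto simp: S_def)
    moreover have "closed {x. g x \<le> m}"
      using g(1) by (intro closed_Collect_le continuous_intros)
    ultimately show ?thesis by (simp add: compact_Int_closed)
  qed
  obtain r where r: "0 < r" "r < 1" "\<And>x. x \<in> S \<Longrightarrow> q x \<le> r"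
  proof (cases "S = {}")
    case True
    then show ?thesis using that[of "1/2"] by simp
  next
    case False
    then obtain y where y: "y \<in> S" "\<forall>x \<in> S. q x \<le> q y"
      using continuous_attains_sup[OF S _ q_cont] by blast
    have "q y \<noteq> 1"
      using q1[of y] y(1) m(2) by (auto simp: S_def)
    then have "q y < 1"
      using q01[of y] by simp
    then show ?thesis
      using that[of "max (1/2) (q y)"] y(2) by fastforce
  qed
  \<comment> \<open>A level strictly between \<open>r\<close> and 1: where \<open>q\<close> exceeds
    it, \<open>g\<close> is above \<open>m\<close> and the contribution is of order
    \<open>s ^ n\<close>, while \<open>S\<close> contributes at most order
    \<open>r ^ n\<close>.\<close>
  define s where "s = (1 + r) / 2"
  have s: "r < s" "s < 1" "0 < s"
    using r by (auto simp: s_def)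
  \<comment> \<open>A continuous substitute for the indicator of the set where \<open>q\<close>
    exceeds \<open>s\<close>.\<close>
  define \<psi> where "\<psi> x = max 0 (q x - s)" for x
  have \<psi>_cont: "continuous_on T \<psi>" for T
    unfolding \<psi>_def by (intro continuous_intros q_cont)
  define I where "I = tint \<psi>"
  have "I \<ge> 0"
    unfolding I_def by (intro integral_nonneg tint_integrable \<psi>_cont) (auto simp: \<psi>_def)
  moreover have "I \<noteq> 0"
  proof
    assume "I = 0"
    moreover have "box 0 (1 :: real ^ 2) \<noteq> {}"
      by (simp add: interval_ne_empty_cart)
    ultimately have "\<forall>x \<in> cbox 0 1. \<psi> x = 0"
      unfolding I_def using integral_cbox_eq_0_iff[OF \<psi>_cont] by (simp add: \<psi>_def)
    then have "\<psi> a = 0"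
      using a by blast
    then show False
      using s by (simp add: \<psi>_def q_def \<kappa>_def)
  qed
  ultimately have I: "I > 0"
    by simp
  obtain G where G: "G > 0" "\<And>x. norm (g x) \<le> G"
    using torus_continuous_bounded[OF g(2,1)] by blast
  have bound: "m * s ^ n * \<psi> x - G * r ^ n \<le> g x * q x ^ n" if "x \<in> cbox 0 1" for x n
  proof (cases "g x \<le> m")
    case True
    then have qr: "q x \<le> r"
      using that r(3) by (simp add: S_def)
    have "- G * r ^ n \<le> - G * q x ^ n"
      using G qr q01 by (simp add: power_mono)
    also have "\<dots> \<le> g x * q x ^ n"
      using G(2)[of x] q01[of x] by (intro mult_right_mono) auto
    finally show ?thesis
      using qr s by (simp add: \<psi>_def)
  next
    case False
    have "s ^ n * \<psi> x \<le> q x ^ n"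
    proof (cases "q x \<ge> s")
      case True
      have "s ^ n * \<psi> x \<le> q x ^ n * 1"
        using True s q01[of x] by (intro mult_mono power_mono) (auto simp: \<psi>_def)
      then show ?thesis by simp
    qed (use q01 in \<open>simp add: \<psi>_def\<close>)
    then have "m * (s ^ n * \<psi> x) \<le> g x * q x ^ n"
      using False m q01[of x] s by (intro mult_mono) (auto simp: \<psi>_def)
    moreover have "G * r ^ n \<ge> 0"
      using G r by simp
    ultimately show ?thesis by simp
  qed
  have le: "m * s ^ n * I \<le> G * r ^ n" for n
  proof -
    have "tint (\<lambda>x. m * s ^ n * \<psi> x - G * r ^ n) \<le> tint (\<lambda>x. g x * q x ^ n)"
      using bound by (intro integral_le tint_integrable cont q_cont \<psi>_cont) auto
    moreover have "tint (\<lambda>x. m * s ^ n * \<psi> x - G * r ^ n) = m * s ^ n * I - G * r ^ n"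
      unfolding I_def by (subst integral_diff) (auto intro!: tint_integrable cont \<psi>_cont)
    ultimately show ?thesis
      by (simp add: int_q)
  qed
  obtain n where n: "(r / s) ^ n < m * I / G"
    using real_arch_pow_inv[of "m * I / G" "r / s"] m I G s by auto
  then have "G * r ^ n < m * s ^ n * I"
    using s G by (simp add: power_divide field_simps)
  then show False
    using le[of n] by simp
qed

theorem trig_orthogonal_imp_zero:
  fixes g :: "real ^ 2 \<Rightarrow> real"
  assumes g: "continuous_on UNIV g" "torus_periodic g"
    and orth: "\<And>b k. tint (\<lambda>x. g x * trig b k x) = 0"
  shows "g x = 0"
proof -
  obtain y where y: "y \<in> cbox 0 1" "g x = g y"
    using torus_periodic_cube[OF g(2)] by metis
  have "g y \<le> 0"
    by (rule trig_orthogonal_imp_nonpos[OF g orth y(1)])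
  moreover have "- g y \<le> 0"
    using orth g by (intro trig_orthogonal_imp_nonpos[of "\<lambda>x. - g x"] y(1))
      (auto intro: continuous_intros simp: torus_periodic_def)
  ultimately show ?thesis
    using y(2) by simp
qed

section \<open>Galerkin approximation\<close>

text \<open>Leaving out the zero frequency restricts to zero mean. Both \<open>k\<close> and
  \<open>- k\<close> occur, so the modes are linearly dependent.\<close>

definition modes :: "nat \<Rightarrow> (bool \<times> int \<times> int) set" where
  "modes N = UNIV \<times> ({- int N..int N} \<times> {- int N..int N} - {(0, 0)})"

text \<open>The amplitude depends on the frequency but not on the choice of sine or cosine, so
  differentiation does not change it. The constant 1 gives the scalar equation, \<open>kperp\<close>
  the divergence-free fields.\<close>

definition trig_vec :: "(int \<times> int \<Rightarrow> 'b::real_vector) \<Rightarrow> bool \<times> int \<times> int \<Rightarrow> real ^ 2 \<Rightarrow> 'b" where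
  "trig_vec w j x = trig (fst j) (snd j) x *\<^sub>R w (snd j)"

definition trig_span :: "(int \<times> int \<Rightarrow> 'b::real_vector) \<Rightarrow> nat \<Rightarrow> (real ^ 2 \<Rightarrow> 'b) set" where
  "trig_span w N = range (\<lambda>c x. \<Sum>j\<in>modes N. c j *\<^sub>R trig_vec w j x)"

lemma finite_modes [simp]: "finite (modes N)"
  by (simp add: modes_def)

lemma trig_spanE:
  assumes "u \<in> trig_span w N"
  obtains c where "u = (\<lambda>x. \<Sum>j\<in>modes N. c j *\<^sub>R trig_vec w j x)"
  using assms by (auto simp: trig_span_def)

lemma torus_smooth_trig_vec: "torus_smooth (trig_vec w j)"
  unfolding trig_vec_def [abs_def]
  by (intro torus_smooth_scaleR torus_smooth_trig torus_smooth_const)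

lemma torus_smooth_trig_span: "u \<in> trig_span w N \<Longrightarrow> torus_smooth u"
  by (erule trig_spanE, hypsubst, intro torus_smooth_sum torus_smooth_scaleR_const torus_smooth_trig_vec)

definition dfactor :: "2 \<Rightarrow> bool \<times> int \<times> int \<Rightarrow> real" where
  "dfactor i j = (if fst j then - freq (snd j) i else freq (snd j) i)"

definition dmode :: "bool \<times> int \<times> int \<Rightarrow> bool \<times> int \<times> int" where
  "dmode j = (\<not> fst j, snd j)"

lemma partial_deriv_trig_vec: "D i (trig_vec w j) = (\<lambda>x. dfactor i j *\<^sub>R trig_vec w (dmode j) x)"
proof -
  have "D i (\<lambda>x. trig (fst j) (snd j) x *\<^sub>R w (snd j)) =
      (\<lambda>x. trig (fst j) (snd j) x *\<^sub>R 0 + D i (trig (fst j) (snd j)) x *\<^sub>R w (snd j))"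
    using pd_scaleR[OF torus_smooth_trig torus_smooth_const, of i] by simp
  then show ?thesis
    by (simp add: trig_vec_def [abs_def] partial_deriv_trig dfactor_def dmode_def)
qed

lemma partial_deriv_trig_comb:
  "D i (\<lambda>x. \<Sum>j\<in>J. c j *\<^sub>R trig_vec w j x) = (\<lambda>x. \<Sum>j\<in>J. (c j * dfactor i j) *\<^sub>R trig_vec w (dmode j) x)"
  by (simp add: pd_sum pd_scaleR_const torus_smooth_scaleR_const torus_smooth_trig_vec partial_deriv_trig_vec)

lemma bij_betw_dmode: "bij_betw dmode (modes N) (modes N)"
  by (rule bij_betwI[of _ _ _ dmode]) (auto simp: dmode_def modes_def)

lemma dmode_dmode [simp]: "dmode (dmode j) = j"
  by (simp add: dmode_def)

text \<open>Up to scalar factors differentiation acts on the modes as the involution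
  \<open>dmode\<close>; reindexing by it exhibits the new coefficients.\<close>

lemma partial_deriv_trig_span:
  assumes "u \<in> trig_span w N"
  shows "D i u \<in> trig_span w N"
proof -
  obtain c where u: "u = (\<lambda>x. \<Sum>j\<in>modes N. c j *\<^sub>R trig_vec w j x)"
    using assms by (rule trig_spanE)
  have "D i u = (\<lambda>x. \<Sum>j\<in>modes N. (c (dmode j) * dfactor i (dmode j)) *\<^sub>R trig_vec w j x)"
    unfolding u partial_deriv_trig_comb
    by (subst sum.reindex_bij_betw[OF bij_betw_dmode, symmetric]) simp
  then show ?thesis
    by (auto simp: trig_span_def)
qed

lemma partial_deriv_commute_trig_span:
  assumes "u \<in> trig_span w N"
  shows "D i (D l u) = D l (D i u)"
proof -
  obtain c where u: "u = (\<lambda>x. \<Sum>j\<in>modes N. c j *\<^sub>R trig_vec w j x)"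
    using assms by (rule trig_spanE)
  have "D i (D l u) = (\<lambda>x. \<Sum>j\<in>modes N. (c j * dfactor l j * dfactor i (dmode j)) *\<^sub>R trig_vec w j x)" for i l
    unfolding u partial_deriv_trig_comb
    by (simp add: pd_sum pd_scaleR_const torus_smooth_scaleR_const torus_smooth_trig_vec partial_deriv_trig_vec)
  moreover have "dfactor l j * dfactor i (dmode j) = dfactor i j * dfactor l (dmode j)" for j
    by (simp add: dfactor_def dmode_def mult.commute)
  ultimately show ?thesis
    by (simp add: mult.assoc)
qed

lemma trig_vec_in_trig_span:
  assumes "j \<in> modes N"
  shows "trig_vec w j \<in> trig_span w N"
proof -
  have "trig_vec w j = (\<lambda>x. \<Sum>l\<in>modes N. (if l = j then 1 else 0) *\<^sub>R trig_vec w l x)"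
    using assms by (auto simp: if_distrib[of "\<lambda>c. c *\<^sub>R _"] cong: if_cong)
  then show ?thesis
    by (auto simp: trig_span_def)
qed

lemma trig_span_mono:
  assumes "N \<le> N'"
  shows "trig_span w N \<subseteq> trig_span w N'"
proof
  fix u
  assume "u \<in> trig_span w N"
  then obtain c where u: "u = (\<lambda>x. \<Sum>j\<in>modes N. c j *\<^sub>R trig_vec w j x)"
    by (rule trig_spanE)
  have "modes N \<subseteq> modes N'"
    using assms by (auto simp: modes_def)
  then have "u = (\<lambda>x. \<Sum>j\<in>modes N'. (if j \<in> modes N then c j else 0) *\<^sub>R trig_vec w j x)"
    unfolding u by (intro ext sum.mono_neutral_cong_left) auto
  then show "u \<in> trig_span w N'"
    by (auto simp: trig_span_def)
qed

text \<open>A mode of nonzero frequency is itself a derivative, along an axis where the frequency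
  does not vanish.\<close>

lemma tint_trig_vec:
  fixes w :: "int \<times> int \<Rightarrow> 'b::euclidean_space"
  assumes "j \<in> modes N"
  shows "tint (trig_vec w j) = 0"
proof -
  obtain i where i: "freq (snd j) i \<noteq> 0"
    using assms that[of 1] that[of 2] by (cases j) (auto simp: modes_def freq_def)
  then have d: "dfactor i (dmode j) \<noteq> 0"
    by (simp add: dfactor_def dmode_def)
  have "D i (\<lambda>x. (1 / dfactor i (dmode j)) *\<^sub>R trig_vec w (dmode j) x) = trig_vec w j"
    using d by (simp add: pd_scaleR_const torus_smooth_trig_vec partial_deriv_trig_vec)
  then show ?thesis
    using tint_partial_deriv[OF torus_smooth_scaleR_const[OF torus_smooth_trig_vec]] by metis
qed

lemma tint_trig_span:
  fixes w :: "int \<times> int \<Rightarrow> 'b::euclidean_space"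
  assumes "u \<in> trig_span w N"
  shows "tint u = 0"
proof -
  obtain c where u: "u = (\<lambda>x. \<Sum>j\<in>modes N. c j *\<^sub>R trig_vec w j x)"
    using assms by (rule trig_spanE)
  show ?thesis
    unfolding u by (subst tint_sum) (simp_all add: torus_smooth_scaleR_const torus_smooth_trig_vec tint_trig_vec)
qed

section \<open>Weak formulation\<close>

text \<open>After integration by parts this is the integral of
  \<open>(h - div g) \<bullet> \<phi>\<close>.\<close>

definition pairing :: "(2 \<Rightarrow> real ^ 2 \<Rightarrow> 'b::euclidean_space) \<Rightarrow> (real ^ 2 \<Rightarrow> 'b) \<Rightarrow> (real ^ 2 \<Rightarrow> 'b) \<Rightarrow> real" where
  "pairing g h \<phi> = (\<Sum>i\<in>UNIV. tint (\<lambda>x. g i x \<bullet> D i \<phi> x)) + tint (\<lambda>x. h x \<bullet> \<phi> x)"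

definition flux :: "(2 \<Rightarrow> 2 \<Rightarrow> real ^ 2 \<Rightarrow> real) \<Rightarrow> (real ^ 2 \<Rightarrow> 'b::euclidean_space) \<Rightarrow> 2 \<Rightarrow> real ^ 2 \<Rightarrow> 'b" where
  "flux A u i x = (\<Sum>j\<in>UNIV. A i j x *\<^sub>R D j u x)"

abbreviation div_flux :: "(2 \<Rightarrow> 2 \<Rightarrow> real ^ 2 \<Rightarrow> real) \<Rightarrow> (real ^ 2 \<Rightarrow> 'b::euclidean_space) \<Rightarrow> real ^ 2 \<Rightarrow> 'b" where
  "div_flux A u x \<equiv> (\<Sum>i\<in>UNIV. D i (flux A u i) x)"

text \<open>The weak form of \<open>- div (A \<nabla> u) + M u\<close>. The coefficient
  \<open>M\<close> takes values in bounded linear maps so that its application is a bounded bilinear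
  product, open to the same Leibniz and multiplier lemmas as the scalar coefficients.\<close>

definition form :: "(2 \<Rightarrow> 2 \<Rightarrow> real ^ 2 \<Rightarrow> real) \<Rightarrow> (real ^ 2 \<Rightarrow> 'b::euclidean_space \<Rightarrow>\<^sub>L 'b) \<Rightarrow>
    (real ^ 2 \<Rightarrow> 'b) \<Rightarrow> (real ^ 2 \<Rightarrow> 'b) \<Rightarrow> real" where
  "form A M u \<phi> = pairing (flux A u) (\<lambda>x. M x (u x)) \<phi>"

lemma pairing_add:
  assumes "\<And>i. torus_smooth (g i)" "\<And>i. torus_smooth (g' i)" "torus_smooth h" "torus_smooth h'" "torus_smooth \<phi>"
  shows "pairing (\<lambda>i x. g i x + g' i x) (\<lambda>x. h x + h' x) \<phi> = pairing g h \<phi> + pairing g' h' \<phi>"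
  using assms by (simp add: pairing_def inner_add_left tint_add torus_smooth_intros sum.distrib)

lemma pairing_scaleR:
  assumes "\<And>i. torus_smooth (g i)" "torus_smooth h" "torus_smooth \<phi>"
  shows "pairing (\<lambda>i x. c *\<^sub>R g i x) (\<lambda>x. c *\<^sub>R h x) \<phi> = c * pairing g h \<phi>"
  by (simp add: pairing_def sum_distrib_left distrib_left flip: integral_mult_right)

lemma pairing_diff:
  assumes "\<And>i. torus_smooth (g i)" "\<And>i. torus_smooth (g' i)" "torus_smooth h" "torus_smooth h'" "torus_smooth \<phi>"
  shows "pairing (\<lambda>i x. g i x - g' i x) (\<lambda>x. h x - h' x) \<phi> = pairing g h \<phi> - pairing g' h' \<phi>"
  using assms by (simp add: pairing_def inner_diff_left tint_diff torus_smooth_intros sum_subtractf)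

lemma pairing_sum:
  assumes "finite J" "\<And>i j. j \<in> J \<Longrightarrow> torus_smooth (g j i)" "\<And>j. j \<in> J \<Longrightarrow> torus_smooth (h j)" "torus_smooth \<phi>"
  shows "pairing (\<lambda>i x. \<Sum>j\<in>J. c j *\<^sub>R g j i x) (\<lambda>x. \<Sum>j\<in>J. c j *\<^sub>R h j x) \<phi> = (\<Sum>j\<in>J. c j * pairing (g j) (h j) \<phi>)"
  using assms
proof (induction J rule: finite_induct)
  case empty
  then show ?case by (simp add: pairing_def)
next
  case (insert j J)
  have "pairing (\<lambda>i x. c j *\<^sub>R g j i x + (\<Sum>j\<in>J. c j *\<^sub>R g j i x)) (\<lambda>x. c j *\<^sub>R h j x + (\<Sum>j\<in>J. c j *\<^sub>R h j x)) \<phi>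
      = c j * pairing (g j) (h j) \<phi> + (\<Sum>j\<in>J. c j * pairing (g j) (h j) \<phi>)"
    using insert
    by (subst pairing_add) (auto simp: pairing_scaleR intro!: torus_smooth_sum torus_smooth_scaleR_const)
  then show ?case
    using insert.hyps by simp
qed

lemma pairing_sum_right:
  assumes "finite J" "\<And>i. torus_smooth (g i)" "torus_smooth h" "\<And>j. j \<in> J \<Longrightarrow> torus_smooth (\<phi> j)"
  shows "pairing g h (\<lambda>x. \<Sum>j\<in>J. c j *\<^sub>R \<phi> j x) = (\<Sum>j\<in>J. c j * pairing g h (\<phi> j))"
  using assms
proof (induction J rule: finite_induct)
  case empty
  then show ?case by (simp add: pairing_def)
next
  case (insert j J)
  have "pairing g h (\<lambda>x. c j *\<^sub>R \<phi> j x + \<psi> x) = c j * pairing g h (\<phi> j) + pairing g h \<psi>"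
    if "torus_smooth \<psi>" for \<psi>
    using insert that
    by (simp add: pairing_def pd_add pd_scaleR_const torus_smooth_scaleR_const inner_add_right tint_add
        torus_smooth_intros sum.distrib distrib_left sum_distrib_left)
  from this[of "\<lambda>x. \<Sum>j\<in>J. c j *\<^sub>R \<phi> j x"] show ?case
    using insert by (simp add: torus_smooth_sum torus_smooth_scaleR_const)
qed

text \<open>Moves \<open>D l\<close> from the test function to the data. On trigonometric
  polynomials \<open>D l\<close> commutes with the derivative already acting on the test
  function.\<close>

lemma pairing_partial_deriv:
  assumes "\<And>i. torus_smooth (g i)" "torus_smooth h" "\<phi> \<in> trig_span w N"
  shows "pairing g h (D l \<phi>) = - pairing (\<lambda>i. D l (g i)) (D l h) \<phi>"
proof -
  have \<phi>: "torus_smooth \<phi>"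
    by (rule torus_smooth_trig_span[OF assms(3)])
  show ?thesis
    unfolding pairing_def partial_deriv_commute_trig_span[OF assms(3), of _ l]
    using assms(1,2) \<phi> by (simp add: tint_by_parts torus_smooth_pd sum_negf)
qed

lemma flux_eq: "flux A u i = (\<lambda>x. \<Sum>j\<in>UNIV. A i j x *\<^sub>R D j u x)"
  by (rule ext) (rule flux_def)

lemma torus_smooth_flux:
  "(\<And>i j. torus_smooth (A i j)) \<Longrightarrow> torus_smooth u \<Longrightarrow> torus_smooth (flux A u i)"
  unfolding flux_eq by (intro torus_smooth_sum torus_smooth_scaleR torus_smooth_pd)

lemma form_sum_left:
  assumes "\<And>i j. torus_smooth (A i j)" "torus_smooth M" "finite J"
    "\<And>j. j \<in> J \<Longrightarrow> torus_smooth (u j)" "torus_smooth \<phi>"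
  shows "form A M (\<lambda>x. \<Sum>j\<in>J. c j *\<^sub>R u j x) \<phi> = (\<Sum>j\<in>J. c j * form A M (u j) \<phi>)"
proof -
  have "flux A (\<lambda>x. \<Sum>j\<in>J. c j *\<^sub>R u j x) = (\<lambda>i x. \<Sum>j\<in>J. c j *\<^sub>R flux A (u j) i x)"
    using assms
    by (simp add: flux_def fun_eq_iff pd_sum pd_scaleR_const torus_smooth_scaleR_const scaleR_sum_right
        sum.swap[of _ J] mult.commute)
  moreover have "(\<lambda>x. blinfun_apply (M x) (\<Sum>j\<in>J. c j *\<^sub>R u j x)) = (\<lambda>x. \<Sum>j\<in>J. c j *\<^sub>R blinfun_apply (M x) (u j x))"
    by (simp add: blinfun.sum_right blinfun.scaleR_right)
  ultimately show ?thesis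
    using assms by (simp add: form_def pairing_sum torus_smooth_flux torus_smooth_blinfun)
qed

lemma form_sum_right:
  assumes "\<And>i j. torus_smooth (A i j)" "torus_smooth M" "finite J" "torus_smooth u"
    "\<And>j. j \<in> J \<Longrightarrow> torus_smooth (\<phi> j)"
  shows "form A M u (\<lambda>x. \<Sum>j\<in>J. c j *\<^sub>R \<phi> j x) = (\<Sum>j\<in>J. c j * form A M u (\<phi> j))"
  using assms by (simp add: form_def pairing_sum_right torus_smooth_flux torus_smooth_blinfun)

text \<open>Cauchy-Schwarz in each term; Poincare's inequality replaces \<open>l2 u\<close> by
  \<open>2 * grad_l2 u\<close>.\<close>

lemma pairing_le:
  assumes g: "\<And>i. torus_smooth (g i)" and h: "torus_smooth h" and u: "torus_smooth u" "tint u = 0"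
  shows "pairing g h u \<le> 2 * ((\<Sum>i\<in>UNIV. l2 (g i)) + l2 h) * (grad_l2 u)"
proof -
  let ?D = "grad_l2 u"
  note c = torus_smooth_cont
  have 1: "tint (\<lambda>x. g i x \<bullet> D i u x) \<le> l2 (g i) * (2 * ?D)" for i
  proof -
    have "tint (\<lambda>x. g i x \<bullet> D i u x) \<le> l2 (g i) * l2 (D i u)"
      using tint_Cauchy_Schwarz[OF c[OF g] c[OF torus_smooth_pd[OF u(1)]], of i i] by simp
    moreover have "l2 (D i u) \<le> 2 * ?D"
      using exhaust_2[of i] l2_nonneg[of "D 1 u"] l2_nonneg[of "D 2 u"] by (elim disjE; simp; linarith)
    ultimately show ?thesis
      using mult_left_mono[OF _ l2_nonneg] order_trans by blast
  qed
  have "tint (\<lambda>x. h x \<bullet> u x) \<le> l2 h * l2 u"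
    using tint_Cauchy_Schwarz[OF c[OF h] c[OF u(1)]] by simp
  also have "\<dots> \<le> l2 h * (2 * ?D)"
    by (intro mult_left_mono Poincare u) simp
  finally have "pairing g h u \<le> (\<Sum>i\<in>UNIV. l2 (g i) * (2 * ?D)) + l2 h * (2 * ?D)"
    unfolding pairing_def using 1 by (intro add_mono sum_mono)
  also have "\<dots> = ((\<Sum>i\<in>UNIV. l2 (g i)) + l2 h) * (2 * ?D)"
    by (simp only: sum_distrib_right distrib_right)
  finally show ?thesis
    by (simp only: mult_ac)
qed

lemma l2_eq_0_imp:
  assumes "torus_smooth u" "l2 u = 0"
  shows "u = (\<lambda>x. 0)"
proof
  fix x
  have "tint (\<lambda>x. u x \<bullet> u x) = 0"
    using assms(2) l2_square[of u] by simp
  then have "u x \<bullet> u x = 0"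
    using assms(1) by (intro tint_eq_0_imp[of "\<lambda>x. u x \<bullet> u x"])
      (use torus_smooth_inner[OF assms(1) assms(1)] torus_smooth_cont torus_smooth_iff in auto)
  then show "u x = 0"
    by simp
qed

section \<open>Galerkin solutions and their estimates\<close>

text \<open>Coercivity is asked for on the trial spaces only, with \<open>c\<close> independent of
  \<open>N\<close>; in the horizontal system it relies on zero mean and vanishing
  divergence.\<close>

locale elliptic_form =
  fixes A :: "2 \<Rightarrow> 2 \<Rightarrow> real ^ 2 \<Rightarrow> real" and M :: "real ^ 2 \<Rightarrow> 'b::euclidean_space \<Rightarrow>\<^sub>L 'b"
    and w :: "int \<times> int \<Rightarrow> 'b" and c :: real
  assumes A: "\<And>i j. torus_smooth (A i j)" and M: "torus_smooth M" and c: "c > 0"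
    and coercive: "\<And>N u. u \<in> trig_span w N \<Longrightarrow> c * (grad_l2 u)\<^sup>2 \<le> form A M u u"
begin

text \<open>Differentiating the equation keeps this shape: derivatives of \<open>A\<close>
  contribute to the divergence part \<open>g\<close>, those of \<open>M\<close> to
  \<open>h\<close>.\<close>

definition galerkin :: "nat \<Rightarrow> (real ^ 2 \<Rightarrow> 'b) \<Rightarrow> (2 \<Rightarrow> real ^ 2 \<Rightarrow> 'b) \<Rightarrow> (real ^ 2 \<Rightarrow> 'b) \<Rightarrow> bool" where
  "galerkin N u g h \<longleftrightarrow> u \<in> trig_span w N \<and> (\<forall>i. torus_smooth (g i)) \<and> torus_smooth h \<and>
    (\<forall>\<phi>\<in>trig_span w N. form A M u \<phi> = pairing g h \<phi>)"

lemma galerkinD: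
  assumes "galerkin N u g h"
  shows "u \<in> trig_span w N" "torus_smooth (g i)" "torus_smooth h"
    "\<phi> \<in> trig_span w N \<Longrightarrow> form A M u \<phi> = pairing g h \<phi>"
  using assms by (auto simp: galerkin_def)

text \<open>Testing with \<open>u\<close> itself bounds \<open>grad_l2 u\<close> by
  \<open>2 / c\<close> times the data. Poincare's inequality adds twice the gradient norm for
  \<open>l2 u\<close>, so the factor becomes \<open>6 / c\<close>.\<close>

lemma galerkin_estimate_0:
  assumes "galerkin N u g h"
  shows "sob 1 u \<le> 6 / c * ((\<Sum>i\<in>UNIV. l2 (g i)) + l2 h)"
proof -
  let ?D = "grad_l2 u" and ?S = "(\<Sum>i\<in>UNIV. l2 (g i)) + l2 h"
  note u = galerkinD(1)[OF assms] and g = galerkinD(2)[OF assms] and h = galerkinD(3)[OF assms]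
    and eq = galerkinD(4)[OF assms]
  note us = torus_smooth_trig_span[OF u] tint_trig_span[OF u]
  have S: "?S \<ge> 0"
    by (intro add_nonneg_nonneg sum_nonneg) auto
  have D: "?D \<ge> 0"
    by simp
  have "c * ?D\<^sup>2 \<le> 2 * ?S * ?D"
    by (rule order_trans[OF coercive[OF u]]) (unfold eq[OF u], rule pairing_le[OF g h us])
  then have "c * ?D * ?D \<le> 2 * ?S * ?D"
    by (simp only: power2_eq_square mult.assoc)
  then have "c * ?D \<le> 2 * ?S"
    using S c D by (cases "?D = 0") (auto simp: mult_le_cancel_right)
  then have D3: "3 * ?D \<le> 6 / c * ?S"
    using c by (simp add: field_simps)
  have "sob 1 u = l2 u + ?D"
    by (simp add: UNIV_2)
  also have "\<dots> \<le> 2 * ?D + ?D"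
    by (intro add_right_mono Poincare us)
  also have "\<dots> = 3 * ?D"
    by simp
  also note D3
  finally show ?thesis .
qed

text \<open>The trial space is invariant under differentiation, so differentiating the Galerkin equation
  gives one for the derivative, whose new data only involve first derivatives of \<open>u\<close>. Hence the energy
  estimate bootstraps to every order, uniformly in \<open>N\<close>.\<close>

lemma galerkin_partial_deriv:
  assumes "galerkin N u g h"
  shows "galerkin N (D l u) (\<lambda>i x. D l (g i) x - flux (\<lambda>i j. D l (A i j)) u i x)
    (\<lambda>x. D l h x - blinfun_apply (D l M x) (u x))" (is "galerkin N _ ?g ?h")
  unfolding galerkin_def
proof (intro conjI allI ballI)
  note u = galerkinD(1)[OF assms] and g = galerkinD(2)[OF assms] and h = galerkinD(3)[OF assms]
    and eq = galerkinD(4)[OF assms]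
  note us = torus_smooth_trig_span[OF u]
  show "D l u \<in> trig_span w N"
    by (rule partial_deriv_trig_span[OF u])
  show "torus_smooth (?g i)" "torus_smooth ?h" for i
    by (intro torus_smooth_diff torus_smooth_pd g h torus_smooth_flux torus_smooth_blinfun A M us)+
  fix \<phi> assume \<phi>: "\<phi> \<in> trig_span w N"
  note \<phi>s = torus_smooth_trig_span[OF \<phi>]
  note smooth = torus_smooth_flux torus_smooth_blinfun torus_smooth_pd A M us \<phi>s g h
  let ?L = "\<lambda>x. M x (u x)"
  \<comment> \<open>The second summand, where the coefficients are differentiated, contains only
    first derivatives of \<open>u\<close> and moves to the data.\<close>
  have flux: "D l (flux A u i) = (\<lambda>x. flux A (D l u) i x + flux (\<lambda>i j. D l (A i j)) u i x)" for i
    unfolding flux_eq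
    by (simp add: pd_sum pd_scaleR torus_smooth_scaleR smooth sum.distrib partial_deriv_commute_trig_span[OF u, of l])
  have low: "D l ?L = (\<lambda>x. blinfun_apply (M x) (D l u x) + blinfun_apply (D l M x) (u x))"
    by (simp add: pd_blinfun smooth)
  have "pairing (\<lambda>i. D l (flux A u i)) (D l ?L) \<phi> = - pairing (flux A u) ?L (D l \<phi>)"
    using pairing_partial_deriv[of "flux A u" ?L \<phi> w N l] by (simp add: smooth \<phi>)
  also have "\<dots> = - pairing g h (D l \<phi>)"
    using eq[OF partial_deriv_trig_span[OF \<phi>]] by (simp add: form_def)
  also have "\<dots> = pairing (\<lambda>i. D l (g i)) (D l h) \<phi>"
    using pairing_partial_deriv[of g h \<phi> w N l] by (simp add: smooth \<phi>)
  finally have "pairing (\<lambda>i. D l (g i)) (D l h) \<phi> = form A M (D l u) \<phi> +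
      pairing (flux (\<lambda>i j. D l (A i j)) u) (\<lambda>x. blinfun_apply (D l M x) (u x)) \<phi>"
    unfolding flux low form_def by (subst (asm) pairing_add) (simp_all add: smooth)
  then show "form A M (D l u) \<phi> = pairing ?g ?h \<phi>"
    by (subst pairing_diff) (simp_all add: smooth)
qed

text \<open>\<open>N\<close> and the data are quantified inside the existential: the constant is
  uniform in the approximation. The induction applies the old constant to the equation for
  \<open>D l u\<close>.\<close>

theorem galerkin_estimate:
  "\<exists>C\<ge>0. \<forall>N u g h. galerkin N u g h \<longrightarrow> sob (Suc k) u \<le> C * ((\<Sum>i\<in>UNIV. sob k (g i)) + sob k h)"
proof (induction k)
  case 0
  show ?case
    using galerkin_estimate_0 c by (intro exI[of _ "6 / c"]) (auto simp del: sob.simps(2) simp flip: One_nat_def)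
next
  case (Suc k)
  then obtain C where C0: "C \<ge> 0"
    and C: "\<And>N u g h. galerkin N u g h \<Longrightarrow> sob (Suc k) u \<le> C * ((\<Sum>i\<in>UNIV. sob k (g i)) + sob k h)"
    by metis
  have "\<exists>C\<ge>0. \<forall>u :: real ^ 2 \<Rightarrow> 'b. torus_smooth u \<longrightarrow> sob k (\<lambda>x. D l (A i j) x *\<^sub>R u x) \<le> C * sob k u" for l i j
    by (rule sob_prod_le[OF bounded_bilinear_scaleR]) (intro torus_smooth_pd A)
  then obtain K where K0: "\<And>l i j. K l i j \<ge> 0" and
    K: "\<And>l i j u :: real ^ 2 \<Rightarrow> 'b. torus_smooth u \<Longrightarrow> sob k (\<lambda>x. D l (A i j) x *\<^sub>R u x) \<le> K l i j * sob k u"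
    by metis
  have "\<exists>C\<ge>0. \<forall>u. torus_smooth u \<longrightarrow> sob k (\<lambda>x. blinfun_apply (D l M x) (u x)) \<le> C * sob k u" for l
    by (rule sob_prod_le[OF bounded_bilinear_blinfun_apply]) (intro torus_smooth_pd M)
  then obtain L where L0: "\<And>l. L l \<ge> 0" and
    L: "\<And>l u. torus_smooth u \<Longrightarrow> sob k (\<lambda>x. blinfun_apply (D l M x) (u x)) \<le> L l * sob k u"
    by metis
  \<comment> \<open>Multiplier constants of the terms in which \<open>D l\<close> falls on
    \<open>A\<close> or \<open>M\<close>.\<close>
  define B where "B l = (\<Sum>i\<in>UNIV. \<Sum>j\<in>UNIV. K l i j) + L l" for l
  have B0: "B l \<ge> 0" for l
    unfolding B_def by (intro add_nonneg_nonneg sum_nonneg K0 L0)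
  \<comment> \<open>The first \<open>C\<close> covers \<open>l2 u\<close>. The data of the equation
    for \<open>D l u\<close> are at most \<open>1 + B l * C\<close> times the original data, the
    terms with differentiated coefficients being controlled by the estimate already known for
    \<open>u\<close>.\<close>
  define C' where "C' = C + (\<Sum>l\<in>UNIV. C * (1 + B l * C))"
  have C': "C' \<ge> 0"
    unfolding C'_def using C0 B0 by (intro add_nonneg_nonneg sum_nonneg mult_nonneg_nonneg) auto
  have "sob (Suc (Suc k)) u \<le> C' * ((\<Sum>i\<in>UNIV. sob (Suc k) (g i)) + sob (Suc k) h)"
    if gal: "galerkin N u g h" for N u g h
  proof -
    let ?S = "\<lambda>k. (\<Sum>i\<in>UNIV. sob k (g i)) + sob k h"
    note g = galerkinD(2)[OF gal] and h = galerkinD(3)[OF gal]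
      and us = torus_smooth_trig_span[OF galerkinD(1)[OF gal]]
    have "?S k \<le> ?S (Suc k)"
      by (intro add_mono sum_mono sob_Suc_le)
    then have uk: "sob (Suc k) u \<le> C * ?S (Suc k)"
      using C[OF gal] mult_left_mono[OF _ C0] order_trans by blast
    have "sob (Suc k) (D l u) \<le> C * (1 + B l * C) * ?S (Suc k)" for l
    proof -
      let ?g = "\<lambda>i x. D l (g i) x - flux (\<lambda>i j. D l (A i j)) u i x"
      let ?h = "\<lambda>x. D l h x - blinfun_apply (D l M x) (u x)"
      have gi: "sob k (?g i) \<le> sob (Suc k) (g i) + (\<Sum>j\<in>UNIV. K l i j) * sob (Suc k) u" for i
      proof -
        have "sob k (?g i) \<le> sob k (D l (g i)) + sob k (flux (\<lambda>i j. D l (A i j)) u i)"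
          by (intro sob_diff_le torus_smooth_pd g torus_smooth_flux A us)
        also have "sob k (flux (\<lambda>i j. D l (A i j)) u i) \<le> (\<Sum>j\<in>UNIV. sob k (\<lambda>x. D l (A i j) x *\<^sub>R D j u x))"
          unfolding flux_eq by (intro sob_sum_le torus_smooth_scaleR torus_smooth_pd A us finite)
        also have "\<dots> \<le> (\<Sum>j\<in>UNIV. K l i j * sob (Suc k) u)"
          by (intro sum_mono order_trans[OF K] mult_left_mono sob_partial_deriv_le K0 torus_smooth_pd us)
        finally show ?thesis
          using sob_partial_deriv_le[of k l "g i"] by (simp add: sum_distrib_right del: sob.simps)
      qed
      have hi: "sob k ?h \<le> sob (Suc k) h + L l * sob (Suc k) u"
      proof -
        have "sob k ?h \<le> sob k (D l h) + sob k (\<lambda>x. blinfun_apply (D l M x) (u x))"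
          by (intro sob_diff_le torus_smooth_pd h torus_smooth_blinfun M us)
        also have "\<dots> \<le> sob (Suc k) h + L l * sob (Suc k) u"
          by (intro add_mono sob_partial_deriv_le order_trans[OF L] mult_left_mono sob_Suc_le L0 us)
        finally show ?thesis .
      qed
      have "(\<Sum>i\<in>UNIV. sob k (?g i)) + sob k ?h \<le>
          (\<Sum>i\<in>UNIV. sob (Suc k) (g i) + (\<Sum>j\<in>UNIV. K l i j) * sob (Suc k) u) + (sob (Suc k) h + L l * sob (Suc k) u)"
        by (intro add_mono sum_mono gi hi)
      also have "\<dots> = ?S (Suc k) + B l * sob (Suc k) u"
        by (simp only: sum.distrib B_def sum_distrib_right distrib_right add_ac)
      also have "\<dots> \<le> ?S (Suc k) + B l * (C * ?S (Suc k))"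
        by (intro add_left_mono mult_left_mono uk B0)
      finally have S: "(\<Sum>i\<in>UNIV. sob k (?g i)) + sob k ?h \<le> (1 + B l * C) * ?S (Suc k)"
        by (simp only: distrib_right mult_1 mult.assoc)
      have "sob (Suc k) (D l u) \<le> C * ((\<Sum>i\<in>UNIV. sob k (?g i)) + sob k ?h)"
        by (rule C[OF galerkin_partial_deriv[OF gal]])
      also have "\<dots> \<le> C * ((1 + B l * C) * ?S (Suc k))"
        by (intro mult_left_mono S C0)
      finally show ?thesis
        by (simp only: mult.assoc)
    qed
    then have "(\<Sum>l\<in>UNIV. sob (Suc k) (D l u)) \<le> (\<Sum>l\<in>UNIV. C * (1 + B l * C) * ?S (Suc k))"
      by (rule sum_mono)
    moreover have "l2 u \<le> C * ?S (Suc k)"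
      by (rule order_trans[OF l2_le_sob uk])
    ultimately have "l2 u + (\<Sum>l\<in>UNIV. sob (Suc k) (D l u)) \<le> C' * ?S (Suc k)"
      unfolding C'_def distrib_right[of C] sum_distrib_right by (rule add_mono[rotated])
    then show ?thesis
      by (subst sob.simps(2)[of "Suc k" u])
  qed
  then show ?case
    using C' by blast
qed

lemma galerkin_solution:
  assumes f: "torus_smooth f"
  shows "\<exists>u\<in>trig_span w N. \<forall>\<phi>\<in>trig_span w N. form A M u \<phi> = tint (\<lambda>x. f x \<bullet> \<phi> x)"
proof -
  let ?E = "trig_vec w" and ?J = "modes N"
  let ?u = "\<lambda>d x. \<Sum>j\<in>?J. d j *\<^sub>R ?E j x"
  have sum_left: "form A M (?u d) \<phi> = (\<Sum>j\<in>?J. d j * form A M (?E j) \<phi>)" if "torus_smooth \<phi>" for d \<phi>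
    using that by (simp add: form_sum_left A M torus_smooth_trig_vec)
  have sum_right: "form A M u (?u d) = (\<Sum>j\<in>?J. d j * form A M u (?E j))" if "torus_smooth u" for d u
    using that by (simp add: form_sum_right A M torus_smooth_trig_vec)
  have f_sum: "tint (\<lambda>x. f x \<bullet> ?u d x) = (\<Sum>j\<in>?J. d j * tint (\<lambda>x. f x \<bullet> ?E j x))" for d
    by (simp add: inner_sum_right tint_sum torus_smooth_inner torus_smooth_mult torus_smooth_const f torus_smooth_trig_vec)
  have span: "?u d \<in> trig_span w N" for d
    by (auto simp: trig_span_def)
  note us = torus_smooth_trig_span[OF span]
  have row: "(\<Sum>j\<in>?J. form A M (?E j) (?E i) * d j) = form A M (?u d) (?E i)" for i d
    by (simp add: sum_left torus_smooth_trig_vec mult.commute)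
  have quad: "(\<Sum>i\<in>?J. d i * (\<Sum>j\<in>?J. form A M (?E j) (?E i) * d j)) = form A M (?u d) (?u d)" for d
    unfolding row sum_right[OF us] ..
  have "\<exists>d. \<forall>i\<in>?J. (\<Sum>j\<in>?J. form A M (?E j) (?E i) * d j) = tint (\<lambda>x. f x \<bullet> ?E i x)"
  proof (rule semidefinite_linear_solve)
    fix d
    have co: "0 \<le> c * (grad_l2 (?u d))\<^sup>2"
      using c by simp
    then show "0 \<le> (\<Sum>i\<in>?J. d i * (\<Sum>j\<in>?J. form A M (?E j) (?E i) * d j))"
      unfolding quad using coercive[OF span] by (rule order_trans)
    \<comment> \<open>A null vector represents a function without gradient, which is zero by
      Poincare's inequality. Rows, columns and right-hand side therefore vanish on it even though
      the modes are dependent.\<close>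
    assume "(\<Sum>i\<in>?J. d i * (\<Sum>j\<in>?J. form A M (?E j) (?E i) * d j)) = 0"
    then have "c * (grad_l2 (?u d))\<^sup>2 \<le> 0"
      unfolding quad using coercive[OF span, of d] by linarith
    then have "grad_l2 (?u d) = 0"
      using c by (simp add: mult_le_0_iff)
    then have "l2 (?u d) = 0"
      using Poincare[OF us tint_trig_span[OF span], of d] order_antisym[OF _ l2_nonneg] by simp
    then have u0: "?u d = (\<lambda>x. 0)"
      by (rule l2_eq_0_imp[OF us])
    have "form A M (?u d) (?E i) = 0" "form A M (?E i) (?u d) = 0" for i
      unfolding u0 by (simp_all add: form_def pairing_def flux_def blinfun.zero_right)
    then have "(\<Sum>j\<in>?J. form A M (?E j) (?E i) * d j) = 0"
      "(\<Sum>j\<in>?J. d j * form A M (?E i) (?E j)) = 0" for i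
      unfolding row by (simp_all flip: sum_right[OF torus_smooth_trig_vec])
    moreover have "(\<Sum>j\<in>?J. d j * tint (\<lambda>x. f x \<bullet> ?E j x)) = 0"
      unfolding f_sum[symmetric] using fun_cong[OF u0] by simp
    ultimately show "(\<forall>i\<in>?J. (\<Sum>j\<in>?J. form A M (?E j) (?E i) * d j) = 0 \<and>
        (\<Sum>j\<in>?J. d j * form A M (?E i) (?E j)) = 0) \<and> (\<Sum>j\<in>?J. d j * tint (\<lambda>x. f x \<bullet> ?E j x)) = 0"
      by blast
  qed simp
  then obtain d where d: "\<And>i. i \<in> ?J \<Longrightarrow> form A M (?u d) (?E i) = tint (\<lambda>x. f x \<bullet> ?E i x)"
    unfolding row by blast
  have "form A M (?u d) \<phi> = tint (\<lambda>x. f x \<bullet> \<phi> x)" if "\<phi> \<in> trig_span w N" for \<phi>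
  proof -
    obtain a where \<phi>: "\<phi> = ?u a"
      using \<open>\<phi> \<in> trig_span w N\<close> by (rule trig_spanE)
    show ?thesis
      unfolding \<phi> sum_right[OF us] f_sum using d by (simp cong: sum.cong)
  qed
  then show ?thesis
    using span by blast
qed

end

section \<open>Passage to the limit\<close>

lemma uniform_limit_bilinear:
  fixes prod :: "'a::real_normed_vector \<Rightarrow> 'b::real_normed_vector \<Rightarrow> 'c::real_normed_vector"
  assumes "bounded_bilinear prod" and a: "torus_smooth a" and lim: "uniform_limit UNIV v u sequentially"
  shows "uniform_limit UNIV (\<lambda>n x. prod (a x) (v n x)) (\<lambda>x. prod (a x) (u x)) sequentially"
proof -
  interpret bounded_bilinear prod by fact
  obtain K where K: "K > 0" "\<And>x. norm (a x) \<le> K"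
    using torus_smooth_bounded[OF a] by blast
  obtain B where B: "B > 0" "\<And>a b. norm (prod a b) \<le> norm a * norm b * B"
    using pos_bounded by blast
  show ?thesis
    unfolding uniform_limit_iff
  proof (intro allI impI)
    fix e :: real assume "e > 0"
    then have "e / (K * B) > 0"
      using K B by simp
    then have "\<forall>\<^sub>F n in sequentially. \<forall>x\<in>UNIV. dist (v n x) (u x) < e / (K * B)"
      using lim unfolding uniform_limit_iff by blast
    then show "\<forall>\<^sub>F n in sequentially. \<forall>x\<in>UNIV. dist (prod (a x) (v n x)) (prod (a x) (u x)) < e"
    proof (rule eventually_mono, intro ballI)
      fix n x assume "\<forall>x\<in>UNIV. dist (v n x) (u x) < e / (K * B)"
      then have d: "norm (v n x - u x) < e / (K * B)"
        by (simp add: dist_norm)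
      have "dist (prod (a x) (v n x)) (prod (a x) (u x)) = norm (prod (a x) (v n x - u x))"
        by (simp add: dist_norm diff_right)
      also have "\<dots> \<le> norm (a x) * norm (v n x - u x) * B"
        by (rule B)
      also have "\<dots> \<le> K * norm (v n x - u x) * B"
        using K B by (intro mult_right_mono) auto
      also have "\<dots> < K * (e / (K * B)) * B"
        using d K B by (intro mult_strict_right_mono mult_strict_left_mono)
      also have "\<dots> = e"
        using K B by simp
      finally show "dist (prod (a x) (v n x)) (prod (a x) (u x)) < e" .
    qed
  qed
qed

lemma tint_tendsto:
  fixes v :: "nat \<Rightarrow> real ^ 2 \<Rightarrow> 'b::euclidean_space"
  assumes v: "\<And>n. torus_smooth (v n)" and u: "torus_smooth u" and lim: "uniform_limit UNIV v u sequentially"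
  shows "(\<lambda>n. tint (v n)) \<longlonglongrightarrow> tint u"
proof (rule tendstoI)
  fix e :: real assume e: "e > 0"
  have "\<forall>\<^sub>F n in sequentially. \<forall>x\<in>UNIV. dist (v n x) (u x) < e / 2"
    using lim half_gt_zero[OF e] unfolding uniform_limit_iff by blast
  then show "\<forall>\<^sub>F n in sequentially. dist (tint (v n)) (tint u) < e"
  proof (rule eventually_mono)
    fix n assume *: "\<forall>x\<in>UNIV. dist (v n x) (u x) < e / 2"
    have "dist (tint (v n)) (tint u) = norm (tint (\<lambda>x. v n x - u x))"
      by (simp add: tint_diff v u dist_norm)
    also have "\<dots> \<le> tint (\<lambda>x. e / 2)"
      using * by (intro integral_norm_bound_integral tint_integrable torus_smooth_cont
          torus_smooth_diff torus_smooth_const v u) (auto simp: dist_norm less_imp_le)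
    also have "\<dots> < e"
      unfolding tint_const using e by simp
    finally show "dist (tint (v n)) (tint u) < e" .
  qed
qed

lemma pairing_by_parts:
  assumes "\<And>i. torus_smooth (g i)" "torus_smooth h" "torus_smooth \<phi>"
  shows "pairing g h \<phi> = tint (\<lambda>x. (h x - (\<Sum>i\<in>UNIV. D i (g i) x)) \<bullet> \<phi> x)"
  using assms
  by (simp add: pairing_def tint_by_parts inner_diff_left inner_sum_left tint_diff tint_sum torus_smooth_intros
      sum_negf)

lemma form_eq:
  assumes "\<And>i j. torus_smooth (A i j)" "torus_smooth M" "torus_smooth u" "torus_smooth \<phi>"
  shows "form A M u \<phi> =
    tint (\<lambda>x. (blinfun_apply (M x) (u x) - div_flux A u x) \<bullet> \<phi> x)"
  unfolding form_def using assms by (simp add: pairing_by_parts torus_smooth_flux torus_smooth_blinfun)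

text \<open>The form contains first derivatives only, so uniform convergence of the functions and
  their first derivatives is enough.\<close>

lemma form_tendsto:
  assumes A: "\<And>i j. torus_smooth (A i j)" and M: "torus_smooth M"
    and v: "\<And>n. torus_smooth (v n)" and u: "torus_smooth u" and \<phi>: "torus_smooth \<phi>"
    and lim: "uniform_limit UNIV v u sequentially"
    and dlim: "\<And>i. uniform_limit UNIV (\<lambda>n. D i (v n)) (D i u) sequentially"
  shows "(\<lambda>n. form A M (v n) \<phi>) \<longlonglongrightarrow> form A M u \<phi>"
  unfolding form_def pairing_def
proof (intro tendsto_add tendsto_sum)
  note smooth = torus_smooth_pd[OF \<phi>] \<phi> torus_smooth_flux torus_smooth_blinfun A M u v
  have flux: "uniform_limit UNIV (\<lambda>n. flux A (v n) i) (flux A u i) sequentially" for i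
    unfolding flux_eq sum_2
    by (intro uniform_limit_add uniform_limit_bilinear[OF bounded_bilinear_scaleR A dlim])
  show "(\<lambda>n. tint (\<lambda>x. flux A (v n) i x \<bullet> D i \<phi> x)) \<longlonglongrightarrow> tint (\<lambda>x. flux A u i x \<bullet> D i \<phi> x)" for i
    using uniform_limit_bilinear[OF bounded_bilinear_inner torus_smooth_pd[OF \<phi>] flux, of i i]
    by (intro tint_tendsto torus_smooth_inner smooth) (simp add: inner_commute)
  show "(\<lambda>n. tint (\<lambda>x. blinfun_apply (M x) (v n x) \<bullet> \<phi> x)) \<longlonglongrightarrow> tint (\<lambda>x. blinfun_apply (M x) (u x) \<bullet> \<phi> x)"
    using uniform_limit_bilinear[OF bounded_bilinear_inner \<phi>
        uniform_limit_bilinear[OF bounded_bilinear_blinfun_apply M lim]]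
    by (intro tint_tendsto torus_smooth_inner smooth) (simp add: inner_commute)
qed

text \<open>The approximating sequence \<open>v\<close> is kept in the conclusion so that linear
  constraints on the trial space, such as vanishing divergence, can be passed on to
  \<open>u\<close>.\<close>

theorem (in elliptic_form) weak_solution:
  assumes f: "torus_smooth f"
  obtains u v where "torus_smooth u" "tint u = 0"
    "\<And>n :: nat. \<exists>N. v n \<in> trig_span w N" "\<And>i x. (\<lambda>n. D i (v n) x) \<longlonglongrightarrow> D i u x"
    "\<And>N \<phi>. \<phi> \<in> trig_span w N \<Longrightarrow> form A M u \<phi> = tint (\<lambda>x. f x \<bullet> \<phi> x)"
proof -
  have "\<forall>N. \<exists>u\<in>trig_span w N. \<forall>\<phi>\<in>trig_span w N. form A M u \<phi> = tint (\<lambda>x. f x \<bullet> \<phi> x)"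
    using galerkin_solution[OF f] by blast
  then obtain y where y: "\<And>N. y N \<in> trig_span w N"
    "\<And>N \<phi>. \<phi> \<in> trig_span w N \<Longrightarrow> form A M (y N) \<phi> = tint (\<lambda>x. f x \<bullet> \<phi> x)"
    by metis
  note ys = torus_smooth_trig_span[OF y(1)]
  have bd: "\<exists>C. \<forall>n. sob k (y n) \<le> C" for k
  proof -
    let ?z = "\<lambda>(i :: 2) (x :: real ^ 2). 0 :: 'b"
    obtain C where C: "\<And>N u g h. galerkin N u g h \<Longrightarrow>
        sob (Suc k) u \<le> C * ((\<Sum>i\<in>UNIV. sob k (g i)) + sob k h)"
      using galerkin_estimate[of k] by metis
    have "galerkin n (y n) ?z f" for n
      using y f by (simp add: galerkin_def torus_smooth_const pairing_def)
    then have "sob (Suc k) (y n) \<le> C * ((\<Sum>i\<in>UNIV. sob k (?z i)) + sob k f)" for n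
      by (rule C)
    note order_trans[OF sob_Suc_le this]
    then show ?thesis
      by blast
  qed
  obtain r u where r: "strict_mono (r :: nat \<Rightarrow> nat)" and u: "torus_smooth u"
    and lim: "uniform_limit UNIV (\<lambda>n. y (r n)) u sequentially"
    and dlim: "\<And>i. uniform_limit UNIV (\<lambda>n. D i (y (r n))) (D i u) sequentially"
    by (rule sob_bounded_convergent_subsequence[OF ys bd]) (rule that)
  show ?thesis
  proof (rule that[OF u])
    show "\<exists>N. y (r n) \<in> trig_span w N" for n
      using y(1) by blast
    show "(\<lambda>n. D i (y (r n)) x) \<longlonglongrightarrow> D i u x" for i x
      using tendsto_uniform_limitI[OF dlim] by simp
    have "(\<lambda>n. tint (y (r n))) \<longlonglongrightarrow> tint u"
      by (rule tint_tendsto[OF ys u lim])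
    then show "tint u = 0"
      by (simp add: tint_trig_span[OF y(1)] LIMSEQ_const_iff)
    fix N \<phi> assume \<phi>: "\<phi> \<in> trig_span w N"
    have "(\<lambda>n. form A M (y (r n)) \<phi>) \<longlonglongrightarrow> form A M u \<phi>"
      by (rule form_tendsto[OF A M ys u torus_smooth_trig_span[OF \<phi>] lim dlim])
    \<comment> \<open>The trial spaces increase, so a fixed test function is admissible from some
      index on.\<close>
    moreover have "\<forall>\<^sub>F n in sequentially. form A M (y (r n)) \<phi> = tint (\<lambda>x. f x \<bullet> \<phi> x)"
    proof (rule eventually_sequentiallyI)
      fix n assume "N \<le> n"
      then have "N \<le> r n"
        using seq_suble[OF r, of n] by simp
      then show "form A M (y (r n)) \<phi> = tint (\<lambda>x. f x \<bullet> \<phi> x)"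
        by (intro y(2) subsetD[OF trig_span_mono \<phi>])
    qed
    ultimately show "form A M u \<phi> = tint (\<lambda>x. f x \<bullet> \<phi> x)"
      by (rule LIMSEQ_unique[OF _ tendsto_eventually])
  qed
qed

section \<open>Ellipticity and the scalar equation\<close>

definition elliptic :: "(2 \<Rightarrow> 2 \<Rightarrow> real ^ 2 \<Rightarrow> real) \<Rightarrow> real \<Rightarrow> bool" where
  "elliptic A \<mu> \<longleftrightarrow> \<mu> > 0 \<and> (\<forall>i j. torus_smooth (A i j)) \<and>
    (\<forall>x (\<xi> :: real ^ 2). \<mu> * (norm \<xi>)\<^sup>2 \<le> (\<Sum>i\<in>UNIV. \<Sum>j\<in>UNIV. A i j x * \<xi> $ j * \<xi> $ i))"

lemma ellipticD:
  assumes "elliptic A \<mu>"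
  shows "\<mu> > 0" "torus_smooth (A i j)"
    "\<mu> * (norm \<xi>)\<^sup>2 \<le> (\<Sum>i\<in>UNIV. \<Sum>j\<in>UNIV. A i j x * \<xi> $ j * \<xi> $ i)"
  using assms by (auto simp: elliptic_def)

text \<open>Ellipticity is applied to the vector of the coordinates
  \<open>D i u x \<bullet> b\<close> for each basis vector \<open>b\<close>, and the results are
  summed.\<close>

lemma elliptic_flux_pointwise:
  fixes u :: "real ^ 2 \<Rightarrow> 'b::euclidean_space"
  assumes "elliptic A \<mu>"
  shows "\<mu> * (D 1 u x \<bullet> D 1 u x + D 2 u x \<bullet> D 2 u x) \<le> (\<Sum>i\<in>UNIV. flux A u i x \<bullet> D i u x)"
proof -
  have "\<mu> * ((D 1 u x \<bullet> b)\<^sup>2 + (D 2 u x \<bullet> b)\<^sup>2) \<le> (\<Sum>i\<in>UNIV. (flux A u i x \<bullet> b) * (D i u x \<bullet> b))" for b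
  proof -
    have "(norm (\<chi> i. D i u x \<bullet> b))\<^sup>2 = (D 1 u x \<bullet> b)\<^sup>2 + (D 2 u x \<bullet> b)\<^sup>2"
      unfolding power2_norm_eq_inner by (simp add: inner_vec_def sum_2 power2_eq_square)
    then show ?thesis
      using ellipticD(3)[OF assms, of "\<chi> i. D i u x \<bullet> b" x]
      by (simp add: flux_def inner_add_left distrib_right sum_2)
  qed
  then have "(\<Sum>b\<in>Basis. \<mu> * ((D 1 u x \<bullet> b)\<^sup>2 + (D 2 u x \<bullet> b)\<^sup>2)) \<le>
      (\<Sum>b\<in>Basis. \<Sum>i\<in>UNIV. (flux A u i x \<bullet> b) * (D i u x \<bullet> b))"
    by (rule sum_mono)
  also have "\<dots> = (\<Sum>i\<in>UNIV. flux A u i x \<bullet> D i u x)"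
    by (subst sum.swap, rule sum.cong[OF refl], rule euclidean_inner[symmetric])
  also have "(\<Sum>b\<in>Basis. \<mu> * ((D 1 u x \<bullet> b)\<^sup>2 + (D 2 u x \<bullet> b)\<^sup>2)) =
      \<mu> * (D 1 u x \<bullet> D 1 u x + D 2 u x \<bullet> D 2 u x)"
  proof -
    have "D i u x \<bullet> D i u x = (\<Sum>b\<in>Basis. (D i u x \<bullet> b)\<^sup>2)" for i
      unfolding power2_eq_square by (rule euclidean_inner)
    then show ?thesis
      by (simp add: sum.distrib distrib_left sum_distrib_left)
  qed
  finally show ?thesis .
qed

text \<open>The factor 1/2 is lost because \<open>grad_l2\<close> is a sum of two norms: the square
  of a sum is at most twice the sum of the squares.\<close>

lemma elliptic_form_ge:
  fixes u :: "real ^ 2 \<Rightarrow> 'b::euclidean_space"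
  assumes A: "elliptic A \<mu>" and u: "torus_smooth u" and M: "torus_smooth M"
  shows "\<mu> / 2 * (grad_l2 u)\<^sup>2 + tint (\<lambda>x. blinfun_apply (M x) (u x) \<bullet> u x) \<le> form A M u u"
proof -
  note smooth = torus_smooth_flux ellipticD(2)[OF A] u torus_smooth_pd torus_smooth_inner
    torus_smooth_sum torus_smooth_add torus_smooth_mult torus_smooth_const
  have "(grad_l2 u)\<^sup>2 \<le> 2 * ((l2 (D 1 u))\<^sup>2 + (l2 (D 2 u))\<^sup>2)"
    using sum_squares_bound[of "l2 (D 1 u)" "l2 (D 2 u)"] by (simp add: power2_sum)
  then have "\<mu> / 2 * (grad_l2 u)\<^sup>2 \<le> \<mu> * ((l2 (D 1 u))\<^sup>2 + (l2 (D 2 u))\<^sup>2)"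
    using ellipticD(1)[OF A] by simp
  also have "\<dots> = tint (\<lambda>x. \<mu> * (D 1 u x \<bullet> D 1 u x + D 2 u x \<bullet> D 2 u x))"
    by (simp add: l2_square tint_add smooth)
  also have "\<dots> \<le> tint (\<lambda>x. \<Sum>i\<in>UNIV. flux A u i x \<bullet> D i u x)"
    by (intro tint_le torus_smooth_cont elliptic_flux_pointwise A smooth finite)
  also have "\<dots> = (\<Sum>i\<in>UNIV. tint (\<lambda>x. flux A u i x \<bullet> D i u x))"
    by (simp add: tint_sum smooth)
  finally show ?thesis
    by (simp add: form_def pairing_def)
qed

lemma coercive_unique:
  assumes "torus_smooth u" "tint u = 0" "c > 0" "c * (grad_l2 u)\<^sup>2 \<le> 0"
  shows "u = (\<lambda>x. 0)"
proof -
  have "grad_l2 u = 0"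
    using assms(3,4) by (simp add: mult_le_0_iff)
  then have "l2 u = 0"
    using Poincare[OF assms(1,2)] order_antisym[OF _ l2_nonneg] by simp
  then show ?thesis
    by (rule l2_eq_0_imp[OF assms(1)])
qed

theorem scalar_unique:
  fixes u :: "real ^ 2 \<Rightarrow> real"
  assumes A: "elliptic A \<mu>" and u: "torus_smooth u" "tint u = 0"
    and eq: "\<And>x. div_flux A u x = 0"
  shows "u = (\<lambda>x. 0)"
proof (rule coercive_unique[OF u])
  have "form A (\<lambda>x. 0) u u = 0"
    by (subst form_eq) (simp_all add: ellipticD(2)[OF A] torus_smooth_const u eq)
  then show "\<mu> / 2 * (grad_l2 u)\<^sup>2 \<le> 0"
    using elliptic_form_ge[OF A u(1) torus_smooth_const, of 0] by simp
qed (simp add: ellipticD(1)[OF A])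

lemma mode_in_modes:
  assumes "k \<noteq> (0, 0)"
  obtains N where "(b, k) \<in> modes N"
proof
  show "(b, k) \<in> modes (nat (max \<bar>fst k\<bar> \<bar>snd k\<bar>))"
    using assms by (cases k) (auto simp: modes_def)
qed

text \<open>The weak equation makes the residual orthogonal to all nonconstant monomials.
  Orthogonality to constants follows from \<open>tint f = 0\<close> and the divergence form of the
  operator, and completeness concludes.\<close>

theorem scalar_solution:
  fixes f :: "real ^ 2 \<Rightarrow> real"
  assumes ell: "elliptic A \<mu>" and f: "torus_smooth f" "tint f = 0"
  obtains u where "torus_smooth u" "tint u = 0" "\<And>x. - div_flux A u x = f x"
proof -
  interpret elliptic_form A "\<lambda>x. 0 :: real \<Rightarrow>\<^sub>L real" "\<lambda>k. 1" "\<mu> / 2"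
  proof
    show "\<mu> / 2 * (grad_l2 u)\<^sup>2 \<le> form A (\<lambda>x. 0) u u"
      if "u \<in> trig_span (\<lambda>k. 1) N" for u :: "real ^ 2 \<Rightarrow> real" and N
      using elliptic_form_ge[OF ell torus_smooth_trig_span[OF that] torus_smooth_const, of 0] by simp
  qed (use ellipticD[OF ell] in \<open>auto intro: torus_smooth_const\<close>)
  obtain u v where u: "torus_smooth u" "tint u = 0"
    and "\<And>n :: nat. \<exists>N. v n \<in> trig_span (\<lambda>k. 1) N" "\<And>i x. (\<lambda>n. D i (v n) x) \<longlonglongrightarrow> D i u x"
    and w: "\<And>N \<phi>. \<phi> \<in> trig_span (\<lambda>k. 1) N \<Longrightarrow> form A (\<lambda>x. 0) u \<phi> = tint (\<lambda>x. f x \<bullet> \<phi> x)"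
    by (rule weak_solution[OF f(1)]) (rule that)
  define L where "L x = div_flux A u x" for x
  define g where "g x = - L x - f x" for x
  note flux_smooth = torus_smooth_flux[OF ellipticD(2)[OF ell] u(1)]
  have L: "torus_smooth L" "tint L = 0"
    unfolding L_def [abs_def]
    by (intro torus_smooth_sum torus_smooth_pd flux_smooth)
      (simp add: tint_sum torus_smooth_pd flux_smooth tint_partial_deriv)
  have g: "torus_smooth g"
    unfolding g_def [abs_def] by (intro torus_smooth_diff torus_smooth_minus L f)
  have "g x = 0" for x
  proof (rule trig_orthogonal_imp_zero)
    show "tint (\<lambda>x. g x * trig b k x) = 0" for b k
    proof (cases "k = (0, 0)")
      case True
      have "tint g = 0"
        unfolding g_def [abs_def] by (simp add: tint_diff torus_smooth_minus L f)
      moreover have "trig b k x = (if b then 1 else 0)" for x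
        unfolding True trig_def phase_def by simp
      ultimately show ?thesis
        by simp
    next
      case False
      then obtain N where N: "(b, k) \<in> modes N"
        by (rule mode_in_modes)
      have t: "trig_vec (\<lambda>k. 1) (b, k) = trig b k"
        by (simp add: trig_vec_def [abs_def])
      have "form A (\<lambda>x. 0) u (trig b k) = tint (\<lambda>x. f x * trig b k x)"
        using w[OF trig_vec_in_trig_span[OF N]] by (simp add: t)
      then have "tint (\<lambda>x. - L x * trig b k x) = tint (\<lambda>x. f x * trig b k x)"
        by (subst (asm) form_eq) (simp_all add: ellipticD(2)[OF ell] torus_smooth_const u torus_smooth_trig L_def)
      then show ?thesis
        unfolding g_def left_diff_distrib[of "- L _"]
        by (subst tint_diff) (intro torus_smooth_mult torus_smooth_minus torus_smooth_trig L f | simp)+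
    qed
  qed (use g torus_smooth_iff torus_smooth_cont in auto)
  then show ?thesis
    using that[OF u] unfolding g_def L_def by simp
qed

section \<open>Divergence-free fields and the Stokes-type system\<close>

lemma partial_deriv_partial_deriv_trig: "D i (D j (trig b k)) = (\<lambda>x. - freq k i * freq k j * trig b k x)"
  using bounded_linear.pd_compose[OF bounded_linear_mult_right torus_smooth_trig]
  by (simp add: partial_deriv_trig fun_eq_iff)

text \<open>Both mixed derivatives have the same integrals against trigonometric monomials.\<close>

theorem partial_deriv_commute:
  fixes u :: "real ^ 2 \<Rightarrow> real"
  assumes u: "torus_smooth u"
  shows "D i (D j u) = D j (D i u)"
proof -
  note smooth = u torus_smooth_trig torus_smooth_pd
  have "torus_smooth (\<lambda>x. D i (D j u) x - D j (D i u) x)"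
    by (intro torus_smooth_diff smooth)
  moreover have "tint (\<lambda>x. (D i (D j u) x - D j (D i u) x) * trig b k x) = 0" for b k
  proof -
    have *: "tint (\<lambda>x. D i (D j u) x * trig b k x) = tint (\<lambda>x. u x * D j (D i (trig b k)) x)" for i j
      using tint_by_parts[of "D j u" "trig b k" i] tint_by_parts[of u "D i (trig b k)" j]
      by (simp add: smooth)
    have "tint (\<lambda>x. (D i (D j u) x - D j (D i u) x) * trig b k x) =
        tint (\<lambda>x. D i (D j u) x * trig b k x) - tint (\<lambda>x. D j (D i u) x * trig b k x)"
      unfolding left_diff_distrib by (intro tint_diff torus_smooth_mult smooth)
    also have "\<dots> = 0"
      unfolding * by (simp add: partial_deriv_partial_deriv_trig mult_ac)
    finally show ?thesis .
  qed
  ultimately have "D i (D j u) x - D j (D i u) x = 0" for x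
    by (intro trig_orthogonal_imp_zero[of "\<lambda>x. D i (D j u) x - D j (D i u) x"])
      (auto simp: torus_smooth_iff intro: smooth_continuous_on)
  then show ?thesis
    by (intro ext) simp
qed

lemma divergence_eq: "torus_smooth u \<Longrightarrow> divergence u x = (\<Sum>i\<in>UNIV. D i u x $ i)"
  by (simp add: divergence_def pd_nth)

text \<open>Amplitudes orthogonal to the frequency make the trigonometric monomials divergence free.\<close>

definition kperp :: "int \<times> int \<Rightarrow> real ^ 2" where
  "kperp k = (\<chi> i. if i = 1 then - of_int (snd k) else of_int (fst k))"

lemma divergence_trig_span:
  assumes "u \<in> trig_span kperp N"
  shows "divergence u x = 0"
proof -
  obtain c where u: "u = (\<lambda>x. \<Sum>j\<in>modes N. c j *\<^sub>R trig_vec kperp j x)"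
    using assms by (rule trig_spanE)
  have z: "(\<Sum>i\<in>UNIV. c j * dfactor i j * (trig_vec kperp (dmode j) x $ i)) = 0" for j
    by (simp add: sum_2 dfactor_def dmode_def trig_vec_def kperp_def freq_def algebra_simps)
  have "divergence u x = (\<Sum>i\<in>UNIV. \<Sum>j\<in>modes N. c j * dfactor i j * (trig_vec kperp (dmode j) x $ i))"
    unfolding divergence_eq[OF torus_smooth_trig_span[OF assms]] unfolding u partial_deriv_trig_comb
    by simp
  also have "\<dots> = 0"
    by (subst sum.swap) (simp add: z)
  finally show ?thesis .
qed

lemma elliptic_identity: "elliptic (\<lambda>i j x. if i = j then 1 else 0) 1"
  by (simp add: elliptic_def torus_smooth_const power2_norm_eq_inner inner_vec_def sum_2)

lemma flux_identity: "flux (\<lambda>i j x. if i = j then 1 else 0) u i = D i u"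
  by (simp add: flux_eq if_distrib[of "\<lambda>c. c *\<^sub>R _"] cong: if_cong)

lemma gradient_nth: "gradient p x $ i = D i p x"
  by (simp add: gradient_def)

lemma tint_nth:
  fixes f :: "real ^ 2 \<Rightarrow> real ^ 'n"
  shows "torus_smooth f \<Longrightarrow> tint (\<lambda>x. f x $ i) = tint f $ i"
  using integral_linear[OF tint_integrable[OF torus_smooth_cont] bounded_linear_vec_nth, of f i]
  by (simp add: comp_def)

text \<open>The hypothesis says that \<open>G\<close> has no curl. With \<open>p\<close> solving \<open>\<Delta> p = div G\<close>, the components of
  \<open>\<nabla> p - G\<close> are harmonic with zero mean, hence vanish.\<close>

theorem potential_of_orthogonal:
  fixes G :: "real ^ 2 \<Rightarrow> real ^ 2"
  assumes G: "torus_smooth G" "tint G = 0"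
    and orth: "\<And>N \<phi>. \<phi> \<in> trig_span kperp N \<Longrightarrow> tint (\<lambda>x. G x \<bullet> \<phi> x) = 0"
  obtains p where "torus_smooth p" "\<And>x. gradient p x = G x"
proof -
  let ?G = "\<lambda>i x. G x $ i"
  have Gi: "torus_smooth (?G i)" for i
    by (intro torus_smooth_nth G)
  note smooth = Gi torus_smooth_pd torus_smooth_trig
  have curl: "D 1 (?G 2) x = D 2 (?G 1) x" for x
  proof -
    let ?C = "\<lambda>x. D 1 (?G 2) x - D 2 (?G 1) x"
    have C: "torus_smooth ?C"
      by (intro torus_smooth_diff smooth)
    have "tint (\<lambda>x. ?C x * trig b k x) = 0" for b k
    proof -
      have "tint (\<lambda>x. ?C x * trig b k x) =
          tint (\<lambda>x. D 1 (?G 2) x * trig b k x) - tint (\<lambda>x. D 2 (?G 1) x * trig b k x)"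
        unfolding left_diff_distrib by (intro tint_diff torus_smooth_mult smooth)
      also have "\<dots> = tint (\<lambda>x. ?G 1 x * D 2 (trig b k) x) - tint (\<lambda>x. ?G 2 x * D 1 (trig b k) x)"
        using tint_by_parts[of "?G 1" "trig b k" 2] tint_by_parts[of "?G 2" "trig b k" 1]
        by (simp add: smooth)
      also have "\<dots> = tint (\<lambda>x. ?G 1 x * D 2 (trig b k) x - ?G 2 x * D 1 (trig b k) x)"
        by (intro tint_diff[symmetric] torus_smooth_mult smooth)
      also have "\<dots> = 0"
      proof (cases "k = (0, 0)")
        case True
        then show ?thesis
          by (simp add: partial_deriv_trig freq_def)
      next
        case False
        then obtain N where N: "(\<not> b, k) \<in> modes N"
          by (rule mode_in_modes)
        \<comment> \<open>Up to sign and the factor \<open>2 * pi\<close>, the divergence-free mode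
          is the rotated gradient of a monomial.\<close>
        have "?G 1 x * D 2 (trig b k) x - ?G 2 x * D 1 (trig b k) x =
            (if b then 2 * pi else - 2 * pi) * (G x \<bullet> trig_vec kperp (\<not> b, k) x)" for x
          by (simp add: partial_deriv_trig freq_def trig_vec_def kperp_def inner_vec_def sum_2 algebra_simps)
        then show ?thesis
          using orth[OF trig_vec_in_trig_span[OF N]] by (simp del: if_distrib)
      qed
      finally show ?thesis .
    qed
    then have "?C x = 0"
      using C by (intro trig_orthogonal_imp_zero[of ?C]) (auto simp: torus_smooth_iff intro: smooth_continuous_on)
    then show ?thesis by simp
  qed
  let ?d = "\<lambda>x. - (\<Sum>i\<in>UNIV. D i (?G i) x)"
  have "torus_smooth ?d"
    by (intro torus_smooth_minus torus_smooth_sum smooth)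
  moreover have "tint ?d = 0"
    by (simp add: tint_sum smooth tint_partial_deriv)
  ultimately obtain p where p: "torus_smooth p" and
    lap: "\<And>x. - div_flux (\<lambda>i j x. if i = j then 1 else 0) p x = ?d x"
    using scalar_solution[OF elliptic_identity] by blast
  define W where "W i x = D i p x - ?G i x" for i x
  have W: "torus_smooth (W i)" for i
    unfolding W_def [abs_def] by (intro torus_smooth_diff smooth p)
  have dW: "D j (W i) = (\<lambda>x. D j (D i p) x - D j (?G i) x)" for i j
    unfolding W_def [abs_def] by (intro pd_diff smooth p)
  \<comment> \<open>Vanishing divergence and curl together turn each \<open>D 1 (D 1 (W i))\<close>
    into \<open>- D 2 (D 2 (W i))\<close>.\<close>
  have divW: "D 1 (W 1) = (\<lambda>x. - D 2 (W 2) x)"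
    using lap by (simp add: dW flux_identity sum_2 fun_eq_iff algebra_simps)
  have curlW: "D 1 (W 2) = D 2 (W 1)"
    unfolding dW using curl partial_deriv_commute[OF p, of 1 2] by simp
  have W0: "W i = (\<lambda>x. 0)" for i
  proof (rule scalar_unique[OF elliptic_identity W])
    show "tint (W i) = 0"
      unfolding W_def [abs_def]
      by (simp add: tint_diff smooth p tint_partial_deriv tint_nth G)
    have "D 1 (D 1 (W i)) x + D 2 (D 2 (W i)) x = 0" for x
    proof (cases "i = 1")
      case True
      have "D 1 (D 1 (W 1)) x = - D 1 (D 2 (W 2)) x"
        unfolding divW by (simp add: pd_minus smooth W)
      also have "\<dots> = - D 2 (D 2 (W 1)) x"
        unfolding partial_deriv_commute[OF W, of 1 2] curlW ..
      finally show ?thesis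
        using True by simp
    next
      case False
      then have "i = 2"
        using exhaust_2 by blast
      have "D 1 (D 1 (W 2)) x = D 2 (D 1 (W 1)) x"
        unfolding curlW partial_deriv_commute[OF W, of 1 2] ..
      also have "\<dots> = - D 2 (D 2 (W 2)) x"
        unfolding divW by (simp add: pd_minus smooth W)
      finally show ?thesis
        using \<open>i = 2\<close> by simp
    qed
    then show "(\<Sum>j\<in>UNIV. D j (flux (\<lambda>i j x. if i = j then 1 else 0) (W i) j) x) = 0" for x
      by (simp add: flux_identity sum_2)
  qed
  have "gradient p x = G x" for x
    using fun_cong[OF W0] by (simp add: vec_eq_iff gradient_nth W_def)
  then show ?thesis
    using that p by blast
qed

section \<open>The horizontal system\<close>

text \<open>The map taking \<open>h\<close> to \<open>h \<cdot> \<nabla> b\<close>. It presents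
  \<open>u \<cdot> \<nabla> b\<close> as a zero-order term with coefficient
  \<open>M\<close>.\<close>

definition grad_op :: "(real ^ 2 \<Rightarrow> 'b::euclidean_space) \<Rightarrow> real ^ 2 \<Rightarrow> (real ^ 2) \<Rightarrow>\<^sub>L 'b" where
  "grad_op b x = (\<Sum>j\<in>UNIV. blinfun_scaleR_left (D j b x) o\<^sub>L blinfun_inner_right (axis j 1))"

lemma grad_op_apply: "blinfun_apply (grad_op b x) h = (\<Sum>j\<in>UNIV. h $ j *\<^sub>R D j b x)"
  by (simp add: grad_op_def blinfun.sum_left inner_axis' )

lemma advect_eq_grad_op: "advect u b x = blinfun_apply (grad_op b x) (u x)"
  by (simp add: grad_op_apply advect_def)

lemma torus_smooth_grad_op: "torus_smooth b \<Longrightarrow> torus_smooth (grad_op b)"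
  unfolding grad_op_def [abs_def]
  by (intro torus_smooth_sum torus_smooth_pd torus_smooth_const
      bounded_bilinear.torus_smooth_prod[OF bounded_bilinear_blinfun_compose]
      bounded_linear.torus_smooth_compose[OF bounded_linear_blinfun_scaleR_left])

text \<open>Moving \<open>D j\<close> from \<open>b\<close> to the product of \<open>u x $ j\<close>
  and \<open>u x\<close> yields \<open>advect u u\<close> and a multiple of the divergence, which
  vanishes. Values of \<open>b\<close> remain, not its derivatives.\<close>

lemma advect_by_parts:
  fixes u b :: "real ^ 2 \<Rightarrow> real ^ 2"
  assumes u: "torus_smooth u" and b: "torus_smooth b" and div: "\<And>x. divergence u x = 0"
  shows "tint (\<lambda>x. advect u b x \<bullet> u x) = - tint (\<lambda>x. advect u u x \<bullet> b x)"
proof -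
  note smooth = u b torus_smooth_nth torus_smooth_scaleR torus_smooth_pd torus_smooth_inner
  have "tint (\<lambda>x. advect u b x \<bullet> u x) = (\<Sum>j\<in>UNIV. tint (\<lambda>x. (u x $ j *\<^sub>R u x) \<bullet> D j b x))"
  proof -
    have "advect u b x \<bullet> u x = (\<Sum>j\<in>UNIV. (u x $ j *\<^sub>R u x) \<bullet> D j b x)" for x
      by (simp add: advect_def inner_sum_left inner_sum_right inner_commute[of _ "u x"])
    then show ?thesis
      by (simp only:) (intro tint_sum finite smooth)
  qed
  also have "\<dots> = - (\<Sum>j\<in>UNIV. tint (\<lambda>x. D j (\<lambda>x. u x $ j *\<^sub>R u x) x \<bullet> b x))"
    unfolding sum_negf[symmetric] by (intro sum.cong refl tint_by_parts smooth)
  also have "(\<Sum>j\<in>UNIV. tint (\<lambda>x. D j (\<lambda>x. u x $ j *\<^sub>R u x) x \<bullet> b x)) =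
      tint (\<lambda>x. (\<Sum>j\<in>UNIV. D j (\<lambda>x. u x $ j *\<^sub>R u x) x) \<bullet> b x)"
    by (subst tint_sum[symmetric]) (simp_all add: smooth inner_sum_left)
  also have "(\<lambda>x. \<Sum>j\<in>UNIV. D j (\<lambda>x. u x $ j *\<^sub>R u x) x) = (\<lambda>x. advect u u x + divergence u x *\<^sub>R u x)"
    by (simp add: pd_scaleR smooth pd_nth sum.distrib advect_def divergence_eq scaleR_sum_left)
  finally show ?thesis
    by (simp add: div fun_eq_iff)
qed

text \<open>Cauchy-Schwarz gives \<open>S * l2 u * grad_l2 u\<close>; the factor 2 is the Poincare
  constant.\<close>

lemma advect_pairing_bound:
  fixes u b :: "real ^ 2 \<Rightarrow> real ^ 2"
  assumes u: "torus_smooth u" "tint u = 0" and b: "torus_smooth b" and div: "\<And>x. divergence u x = 0"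
    and S: "\<And>x. norm (b x) \<le> S"
  shows "\<bar>tint (\<lambda>x. advect u b x \<bullet> u x)\<bar> \<le> 2 * S * (grad_l2 u)\<^sup>2"
proof -
  let ?D = "grad_l2 u"
  have S0: "S \<ge> 0"
    using S[of 0] norm_ge_zero order_trans by blast
  note c = torus_smooth_cont
  note cont = c[OF u(1)] c[OF torus_smooth_pd[OF u(1)]] c[OF b]
  have adv: "torus_smooth (advect u u)"
    unfolding advect_def [abs_def] by (intro torus_smooth_sum torus_smooth_scaleR torus_smooth_nth torus_smooth_pd u)
  have "\<bar>tint (\<lambda>x. advect u b x \<bullet> u x)\<bar> = norm (tint (\<lambda>x. advect u u x \<bullet> b x))"
    by (simp add: advect_by_parts u b div)
  also have "\<dots> \<le> tint (\<lambda>x. S * (norm (u x) * norm (D 1 u x) + norm (u x) * norm (D 2 u x)))"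
  proof (intro integral_norm_bound_integral tint_integrable)
    fix x
    have "norm (advect u u x) \<le> (\<Sum>j\<in>UNIV. norm (u x) * norm (D j u x))"
      unfolding advect_def by (intro sum_norm_le) (auto intro: mult_right_mono component_le_norm_cart)
    then have "norm (advect u u x) * norm (b x) \<le> (\<Sum>j\<in>UNIV. norm (u x) * norm (D j u x)) * S"
      using S S0 by (intro mult_mono) (auto intro: sum_nonneg)
    then show "norm (advect u u x \<bullet> b x) \<le> S * (norm (u x) * norm (D 1 u x) + norm (u x) * norm (D 2 u x))"
      using Cauchy_Schwarz_ineq2[of "advect u u x" "b x"] by (simp add: sum_2 mult.commute)
  qed (intro continuous_intros cont c[OF adv])+
  also have "\<dots> = S * (tint (\<lambda>x. norm (u x) * norm (D 1 u x)) + tint (\<lambda>x. norm (u x) * norm (D 2 u x)))"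
    by (simp, subst integral_add) (auto intro!: tint_integrable continuous_intros cont)
  also have "\<dots> \<le> S * (l2 u * l2 (D 1 u) + l2 u * l2 (D 2 u))"
  proof -
    have "tint (\<lambda>x. norm (u x) * norm (D i u x)) \<le> l2 u * l2 (D i u)" for i
      using tint_Cauchy_Schwarz[of "\<lambda>x. norm (u x)" "\<lambda>x. norm (D i u x)"]
      by (simp add: l2_norm continuous_intros cont)
    then show ?thesis
      by (intro mult_left_mono add_mono S0)
  qed
  also have "\<dots> = S * (l2 u * ?D)"
    by (simp add: distrib_left)
  also have "\<dots> \<le> S * (2 * ?D * ?D)"
    by (intro mult_left_mono mult_right_mono Poincare u S0) simp
  finally show ?thesis
    by (simp only: power2_eq_square mult_ac)
qed

text \<open>The coefficient on the left is positive exactly for \<open>S < \<mu> / 4\<close>, the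
  origin of the threshold.\<close>

lemma stokes_form_ge:
  fixes u b :: "real ^ 2 \<Rightarrow> real ^ 2"
  assumes A: "elliptic A \<mu>" and u: "torus_smooth u" "tint u = 0" and b: "torus_smooth b"
    and div: "\<And>x. divergence u x = 0" and S: "\<And>x. norm (b x) \<le> S"
  shows "(\<mu> / 2 - 2 * S) * (grad_l2 u)\<^sup>2 \<le> form A (grad_op b) u u"
  using elliptic_form_ge[OF A u(1) torus_smooth_grad_op[OF b]] advect_pairing_bound[OF u b div S]
  by (simp add: advect_eq_grad_op left_diff_distrib)

theorem stokes_solution:
  fixes b f :: "real ^ 2 \<Rightarrow> real ^ 2"
  assumes ell: "elliptic A \<mu>" and b: "torus_smooth b" and S: "\<And>x. norm (b x) \<le> S" "S < \<mu> / 4"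
    and f: "torus_smooth f" "tint f = 0"
  obtains u p where "torus_smooth u" "tint u = 0" "\<And>x. divergence u x = 0" "torus_smooth p"
    "\<And>x. - div_flux A u x + advect u b x + gradient p x = f x"
proof -
  interpret elliptic_form A "grad_op b" kperp "\<mu> / 2 - 2 * S"
  proof
    show "(\<mu> / 2 - 2 * S) * (grad_l2 u)\<^sup>2 \<le> form A (grad_op b) u u"
      if "u \<in> trig_span kperp N" for u N
      using stokes_form_ge[OF ell torus_smooth_trig_span[OF that] tint_trig_span[OF that] b
          divergence_trig_span[OF that] S(1)] .
  qed (use ellipticD[OF ell] S(2) b in \<open>auto intro: torus_smooth_grad_op\<close>)
  obtain u v where u: "torus_smooth u" "tint u = 0"
    and v: "\<And>n :: nat. \<exists>N. v n \<in> trig_span kperp N" "\<And>i x. (\<lambda>n. D i (v n) x) \<longlonglongrightarrow> D i u x"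
    and w: "\<And>N \<phi>. \<phi> \<in> trig_span kperp N \<Longrightarrow> form A (grad_op b) u \<phi> = tint (\<lambda>x. f x \<bullet> \<phi> x)"
    by (rule weak_solution[OF f(1)]) (rule that)
  have div: "divergence u x = 0" for x
  proof -
    \<comment> \<open>The divergence only involves first derivatives, which converge
      pointwise.\<close>
    have "(\<lambda>n. \<Sum>i\<in>UNIV. D i (v n) x $ i) \<longlonglongrightarrow> (\<Sum>i\<in>UNIV. D i u x $ i)"
      by (intro tendsto_sum tendsto_vec_nth v)
    moreover have "(\<Sum>i\<in>UNIV. D i (v n) x $ i) = 0" for n
      using v(1)[of n] divergence_trig_span divergence_eq torus_smooth_trig_span by metis
    ultimately show ?thesis
      by (simp add: divergence_eq u LIMSEQ_const_iff)
  qed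
  define L where "L x = advect u b x - div_flux A u x" for x
  have adv: "torus_smooth (advect u b)"
    unfolding advect_eq_grad_op [abs_def] by (intro torus_smooth_blinfun torus_smooth_grad_op b u)
  note smooth = torus_smooth_pd torus_smooth_flux[OF ellipticD(2)[OF ell] u(1)] adv
  have L: "torus_smooth L"
    unfolding L_def [abs_def] by (intro torus_smooth_diff torus_smooth_sum smooth)
  \<comment> \<open>A gradient of a periodic function has zero mean, so the residual must have it
    too; vanishing divergence of \<open>u\<close> puts this term into divergence form.\<close>
  have "tint (advect u b) = 0"
  proof -
    have "advect u b = (\<lambda>x. \<Sum>i\<in>UNIV. D i (\<lambda>x. u x $ i *\<^sub>R b x) x)"
    proof
      fix x
      have "(\<Sum>i\<in>UNIV. D i (\<lambda>x. u x $ i *\<^sub>R b x) x) = advect u b x + divergence u x *\<^sub>R b x"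
        by (simp add: pd_scaleR torus_smooth_nth u b pd_nth sum.distrib advect_def divergence_eq scaleR_sum_left)
      then show "advect u b x = (\<Sum>i\<in>UNIV. D i (\<lambda>x. u x $ i *\<^sub>R b x) x)"
        by (simp add: div)
    qed
    then show ?thesis
      by (simp add: tint_sum tint_partial_deriv torus_smooth_pd torus_smooth_scaleR torus_smooth_nth u b)
  qed
  moreover have "tint (\<lambda>x. \<Sum>i\<in>UNIV. D i (flux A u i) x) = 0"
    by (simp add: tint_sum smooth tint_partial_deriv)
  ultimately have L0: "tint L = 0"
    unfolding L_def [abs_def] by (subst tint_diff) (intro torus_smooth_sum smooth | simp)+
  \<comment> \<open>By the weak equation the residual is orthogonal to all divergence-free modes,
    hence a gradient.\<close>
  obtain p where p: "torus_smooth p" "\<And>x. gradient p x = f x - L x"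
  proof (rule potential_of_orthogonal[of "\<lambda>x. f x - L x"])
    show "torus_smooth (\<lambda>x. f x - L x)"
      by (intro torus_smooth_diff f L)
    show "tint (\<lambda>x. f x - L x) = 0"
      by (simp add: tint_diff f L L0)
    fix N \<phi> assume \<phi>: "\<phi> \<in> trig_span kperp N"
    note \<phi>s = torus_smooth_trig_span[OF \<phi>]
    have "tint (\<lambda>x. L x \<bullet> \<phi> x) = tint (\<lambda>x. f x \<bullet> \<phi> x)"
      unfolding w[OF \<phi>, symmetric] L_def advect_eq_grad_op
      by (rule form_eq[symmetric]) (intro ellipticD(2)[OF ell] torus_smooth_grad_op b u \<phi>s)+
    then show "tint (\<lambda>x. (f x - L x) \<bullet> \<phi> x) = 0"
      by (simp add: inner_diff_left tint_diff torus_smooth_inner f L \<phi>s)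
  qed (rule that)
  show ?thesis
    by (rule that[OF u div p(1)]) (simp add: p(2) L_def)
qed

text \<open>Tested with \<open>u\<close>, the pressure disappears: integration by parts turns its
  gradient term into the divergence of \<open>u\<close> against \<open>p\<close>. Coercivity forces
  the gradient norm of \<open>u\<close> to vanish.\<close>

theorem stokes_unique:
  fixes u b :: "real ^ 2 \<Rightarrow> real ^ 2"
  assumes ell: "elliptic A \<mu>" and b: "torus_smooth b" and S: "\<And>x. norm (b x) \<le> S" "S < \<mu> / 4"
    and u: "torus_smooth u" "tint u = 0" and div: "\<And>x. divergence u x = 0" and p: "torus_smooth p"
    and eq: "\<And>x. - div_flux A u x + advect u b x + gradient p x = 0"
  shows "u = (\<lambda>x. 0)"
proof (rule coercive_unique[OF u])
  have "tint (\<lambda>x. gradient p x \<bullet> u x) = (\<Sum>i\<in>UNIV. tint (\<lambda>x. u x $ i * D i p x))"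
    by (subst tint_sum[symmetric])
      (simp_all add: torus_smooth_mult torus_smooth_nth torus_smooth_pd u p inner_vec_def gradient_nth mult.commute)
  also have "\<dots> = - (\<Sum>i\<in>UNIV. tint (\<lambda>x. D i (\<lambda>x. u x $ i) x * p x))"
    using tint_by_parts[of "\<lambda>x. u x $ _" p] by (simp add: torus_smooth_nth u p sum_negf)
  also have "(\<Sum>i\<in>UNIV. tint (\<lambda>x. D i (\<lambda>x. u x $ i) x * p x)) = tint (\<lambda>x. divergence u x * p x)"
    by (subst tint_sum[symmetric])
      (simp_all add: torus_smooth_mult torus_smooth_nth torus_smooth_pd u p divergence_def sum_distrib_right)
  finally have gp: "tint (\<lambda>x. gradient p x \<bullet> u x) = 0"
    by (simp add: div)
  have "form A (grad_op b) u u = tint (\<lambda>x. (advect u b x - div_flux A u x) \<bullet> u x)"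
    unfolding advect_eq_grad_op by (rule form_eq) (intro ellipticD(2)[OF ell] torus_smooth_grad_op b u)+
  also have "\<dots> = tint (\<lambda>x. - (gradient p x \<bullet> u x))"
  proof -
    have "advect u b x - div_flux A u x = - gradient p x" for x
      using eq[of x] by (simp add: algebra_simps eq_neg_iff_add_eq_0)
    then show ?thesis by simp
  qed
  finally have "form A (grad_op b) u u = 0"
    by (simp add: gp)
  then show "(\<mu> / 2 - 2 * S) * (grad_l2 u)\<^sup>2 \<le> 0"
    using stokes_form_ge[OF ell u b div S(1)] by simp
qed (use S(2) in simp)

section \<open>Vertical averages\<close>

definition up :: "2 \<Rightarrow> 3" where
  "up i = (if i = 1 then 1 else 2)"

lemma at_height_nth: "at_height y t $ 1 = y $ 1" "at_height y t $ 2 = y $ 2" "at_height y t $ 3 = t"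
  by (simp_all add: at_height_def vector_3)

lemma horiz_nth: "horiz x $ 1 = x $ 1" "horiz x $ 2 = x $ 2"
  by (simp_all add: horiz_def vector_2)

lemma horiz_nth_up: "horiz x $ i = x $ up i"
  using exhaust_2[of i] by (auto simp: horiz_nth up_def)

lemma horiz_at_height [simp]: "horiz (at_height y t) = y"
  by (simp add: vec_eq_iff forall_2 horiz_nth at_height_nth)

lemma at_height_eq: "at_height y t = at_height y 0 + t *\<^sub>R axis 3 1"
  by (simp add: vec_eq_iff forall_3 at_height_nth axis_def)

lemma at_height_add_axis: "at_height (y + axis i 1) t = at_height y t + axis (up i) 1"
  using exhaust_2[of i] by (auto simp: vec_eq_iff forall_3 at_height_nth axis_def up_def)

lemma bounded_linear_horiz: "bounded_linear horiz"
  unfolding linear_conv_bounded_linear[symmetric]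
  by (rule linearI) (simp_all add: vec_eq_iff forall_2 horiz_nth)

lemma bounded_linear_at_height: "bounded_linear (\<lambda>y. at_height y 0)"
  unfolding linear_conv_bounded_linear[symmetric]
  by (rule linearI) (simp_all add: vec_eq_iff forall_3 at_height_nth)

lemma has_derivative_at_height: "((\<lambda>y. at_height y t) has_derivative (\<lambda>h. at_height h 0)) (at y)"
proof -
  have "(\<lambda>y. at_height y t) = (\<lambda>y. at_height y 0 + t *\<^sub>R axis 3 1)"
    by (rule ext) (rule at_height_eq)
  then show ?thesis
    using has_derivative_add[OF bounded_linear_imp_has_derivative[OF bounded_linear_at_height] has_derivative_const]
    by simp
qed

lemma continuous_on_at_height:
  assumes "continuous_on UNIV f" "continuous_on S g" "continuous_on S h"
  shows "continuous_on S (\<lambda>x. f (at_height (g x) (h x)))"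
proof (rule continuous_on_compose2[OF assms(1)])
  have "(\<lambda>x. at_height (g x) (h x)) = (\<lambda>x. at_height (g x) 0 + h x *\<^sub>R axis 3 1)"
    by (rule ext) (rule at_height_eq)
  then show "continuous_on S (\<lambda>x. at_height (g x) (h x))"
    by (simp only:) (intro continuous_on_add continuous_on_scaleR continuous_on_const assms
        bounded_linear.continuous_on[OF bounded_linear_at_height assms(2)])
qed auto

lemma has_derivative_along_sheet:
  fixes f :: "real ^ 3 \<Rightarrow> 'b::real_normed_vector"
  assumes "smooth f"
  shows "((\<lambda>y. f (at_height y t)) has_derivative
    (\<lambda>h. \<Sum>j\<in>UNIV. h $ j *\<^sub>R D (up j) f (at_height y t))) (at y)"
  using has_derivative_compose[OF has_derivative_at_height smooth_has_derivative[OF assms], of t y]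
  by (simp add: sum_2 sum_3 at_height_nth up_def)

text \<open>Differentiation under the integral sign. The derivative of the integrand is packaged as
  the operator \<open>fx y t\<close>, because the Leibniz rule asks for joint continuity in the
  operator norm.\<close>

lemma has_derivative_vert_avg:
  fixes f :: "real ^ 3 \<Rightarrow> 'b::euclidean_space"
  assumes f: "smooth f"
  shows "(vert_avg f has_derivative (\<lambda>h. \<Sum>j\<in>UNIV. h $ j *\<^sub>R vert_avg (D (up j) f) y)) (at y)"
proof -
  define fx where "fx y t =
    (\<Sum>j\<in>UNIV. blinfun_scaleR_left (D (up j) f (at_height y t)) o\<^sub>L blinfun_inner_right (axis j (1 :: real)))"
    for y :: "real ^ 2" and t
  have fx_apply: "blinfun_apply (fx y t) h = (\<Sum>j\<in>UNIV. h $ j *\<^sub>R D (up j) f (at_height y t))" for y t h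
    by (simp add: fx_def blinfun.sum_left inner_axis')
  then have fx_eq: "blinfun_apply (fx y t) = (\<lambda>h. \<Sum>j\<in>UNIV. h $ j *\<^sub>R D (up j) f (at_height y t))" for y t
    by (rule ext)
  have cont_d: "continuous_on S (\<lambda>x. D i f (at_height (g x) (h x)))"
    if "continuous_on S g" "continuous_on S h" for i S and g :: "'c::topological_space \<Rightarrow> real ^ 2" and h
    by (rule continuous_on_at_height[OF smooth_continuous_on[OF smooth_partial_deriv[OF f]] that])
  have fx_cont: "continuous_on S (\<lambda>x. fx (g x) (h x))"
    if "continuous_on S g" "continuous_on S h" for S and g :: "'c::topological_space \<Rightarrow> real ^ 2" and h
    unfolding fx_def
    by (intro continuous_on_sum bounded_bilinear.continuous_on[OF bounded_bilinear_blinfun_compose]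
        bounded_linear.continuous_on[OF bounded_linear_blinfun_scaleR_left] cont_d that continuous_on_const)
  have der: "((\<lambda>y. integral (cbox 0 1) (\<lambda>t. f (at_height y t))) has_derivative integral (cbox 0 1) (fx y)) (at y within UNIV)"
  proof (rule leibniz_rule)
    show "((\<lambda>y. f (at_height y t)) has_derivative blinfun_apply (fx y t)) (at y within UNIV)" for y t
      using has_derivative_along_sheet[OF f, of t y] by (simp add: fx_eq)
    show "(\<lambda>t. f (at_height y t)) integrable_on cbox 0 1" for y
      by (intro integrable_continuous continuous_on_at_height[OF smooth_continuous_on[OF f]]
          continuous_on_const continuous_on_id)
    show "continuous_on (UNIV \<times> cbox 0 1) (\<lambda>(y, t). fx y t)"
      unfolding split_beta by (intro fx_cont continuous_on_fst continuous_on_snd continuous_on_id)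
  qed auto
  have "blinfun_apply (integral (cbox 0 1) (fx y)) h = (\<Sum>j\<in>UNIV. h $ j *\<^sub>R vert_avg (D (up j) f) y)" for h
  proof -
    have "blinfun_apply (integral (cbox 0 1) (fx y)) h = integral (cbox 0 1) (\<lambda>t. blinfun_apply (fx y t) h)"
      using integral_linear[OF integrable_continuous[OF fx_cont[OF continuous_on_const continuous_on_id]]
          blinfun.bounded_linear_left[of h], of 0 1 y]
      by (simp add: comp_def)
    also have "\<dots> = (\<Sum>j\<in>UNIV. integral (cbox 0 1) (\<lambda>t. h $ j *\<^sub>R D (up j) f (at_height y t)))"
      unfolding fx_apply
      by (intro integral_sum integrable_continuous continuous_on_scaleR continuous_on_const cont_d
          continuous_on_id finite)
    finally show ?thesis
      by (simp add: vert_avg_def)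
  qed
  then have "blinfun_apply (integral (cbox 0 1) (fx y)) = (\<lambda>h. \<Sum>j\<in>UNIV. h $ j *\<^sub>R vert_avg (D (up j) f) y)"
    by (rule ext)
  moreover have "vert_avg f = (\<lambda>y. integral (cbox 0 1) (\<lambda>t. f (at_height y t)))"
    by (simp add: vert_avg_def fun_eq_iff)
  ultimately show ?thesis
    using der by simp
qed

lemma partial_deriv_vert_avg:
  fixes f :: "real ^ 3 \<Rightarrow> 'b::euclidean_space"
  assumes "smooth f"
  shows "D j (vert_avg f) = vert_avg (D (up j) f)"
  using partial_deriv_eqI[OF has_derivative_vert_avg[OF assms], of j]
  by (auto simp: axis_def if_distrib[of "\<lambda>c. c *\<^sub>R _"] cong: if_cong)

lemma torus_smooth_vert_avg:
  fixes f :: "real ^ 3 \<Rightarrow> 'b::euclidean_space"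
  assumes "torus_smooth f"
  shows "torus_smooth (vert_avg f)"
proof -
  have diff: "vert_avg f differentiable (at y)" if "smooth f" for f :: "real ^ 3 \<Rightarrow> 'b" and y
    unfolding differentiable_def by (rule exI, rule has_derivative_vert_avg[OF that])
  have "C_k k (vert_avg f)" if "smooth f" for k and f :: "real ^ 3 \<Rightarrow> 'b"
    using that
  proof (induction k arbitrary: f)
    case 0
    then show ?case
      by (auto intro!: continuous_at_imp_continuous_on differentiable_imp_continuous_within diff)
  next
    case (Suc k)
    then show ?case
      by (simp add: diff partial_deriv_vert_avg smooth_partial_deriv)
  qed
  moreover have "torus_periodic (vert_avg f)"
    using assms by (simp add: torus_periodic_def vert_avg_def at_height_add_axis torus_smooth_iff)
  ultimately show ?thesis
    using assms by (simp add: torus_smooth_iff smooth_def)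
qed

text \<open>The average runs over a full period. This removes the vertical part of a divergence
  under averaging.\<close>

lemma vert_avg_partial_3:
  fixes f :: "real ^ 3 \<Rightarrow> 'b::euclidean_space"
  assumes "torus_smooth f"
  shows "vert_avg (D 3 f) y = 0"
  using integral_partial_line[OF assms, of 3 "at_height y 0"]
  by (simp add: vert_avg_def at_height_eq[of y, symmetric])

lemma vert_avg_integrable:
  fixes f :: "real ^ 3 \<Rightarrow> 'b::euclidean_space"
  shows "torus_smooth f \<Longrightarrow> (\<lambda>t. f (at_height y t)) integrable_on {0..1}"
  by (intro integrable_continuous_interval continuous_on_at_height[OF torus_smooth_cont]
      continuous_on_const continuous_on_id)

lemma vert_avg_sum:
  fixes f :: "'a \<Rightarrow> real ^ 3 \<Rightarrow> 'b::euclidean_space"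
  assumes "finite J" "\<And>j. j \<in> J \<Longrightarrow> torus_smooth (f j)"
  shows "vert_avg (\<lambda>x. \<Sum>j\<in>J. f j x) y = (\<Sum>j\<in>J. vert_avg (f j) y)"
  unfolding vert_avg_def using assms by (intro integral_sum vert_avg_integrable)

lemma tint_vert_avg:
  fixes f :: "real ^ 3 \<Rightarrow> 'b::euclidean_space"
  assumes f: "continuous_on UNIV f"
  shows "tint (vert_avg f) = integral (cbox 0 1) f"
proof -
  let ?g = "\<lambda>p. at_height (fst p) (snd p)"
  have "integral (cbox (?g (0, 0)) (?g (1, 1))) f = integral (cbox (0, 0) (1, 1)) (\<lambda>p. f (?g p))"
  proof (rule integral_cbox_reparam[where h = "\<lambda>x. (horiz x, x $ 3)"])
    show "continuous_on UNIV ?g"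
      by (rule continuous_on_at_height[of "\<lambda>x. x"]) (intro continuous_intros)+
    show "?g (horiz x, x $ 3) = x" for x
      by (simp add: at_height_nth vec_eq_iff forall_3 horiz_nth)
    show "?g p \<in> cbox (?g u) (?g v) \<longleftrightarrow> p \<in> cbox u v" for u v p
      by (cases u; cases v; cases p) (simp add: mem_box_cart forall_2 forall_3 at_height_nth)
    show "measure lborel (cbox (?g u) (?g v)) = measure lborel (cbox u v)"
      if "cbox u v \<noteq> {}" "cbox (?g u) (?g v) \<noteq> {}" for u v
    proof -
      obtain a b c d where uv: "u = (a, c)" "v = (b, d)"
        by (cases u; cases v)
      have ab: "cbox a b \<noteq> {}" and cd: "c \<le> d"
        using that(1) by (auto simp: uv cbox_Pair_eq)
      have "measure lborel (cbox (?g u) (?g v)) = (\<Prod>i\<in>UNIV. b $ i - a $ i) * (d - c)"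
        unfolding content_cbox_cart[OF that(2)]
        unfolding prod_UNIV_2 prod_UNIV_3 uv fst_conv snd_conv at_height_nth ..
      also have "\<dots> = measure lborel (cbox u v)"
        by (simp only: uv content_Pair content_cbox_cart[OF ab]) (simp add: cd)
      finally show ?thesis .
    qed
  qed (simp_all add: f at_height_nth)
  moreover have "?g (0, 0) = 0" "?g (1, 1) = 1"
    by (simp_all add: vec_eq_iff forall_3 at_height_nth)
  ultimately have "integral (cbox 0 1) f = integral (cbox (0, 0) (1, 1)) (\<lambda>p. f (?g p))"
    by simp
  also have "\<dots> = integral (cbox 0 1) (\<lambda>y. integral (cbox 0 1) (\<lambda>t. f (?g (y, t))))"
    by (rule integral_prod_continuous) (intro continuous_on_at_height[OF f] continuous_on_fst continuous_on_snd continuous_on_id)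
  finally show ?thesis
    by (simp add: vert_avg_def [abs_def])
qed

section \<open>The averaged operator and its ellipticity\<close>

lemma advect_horiz:
  fixes u :: "real ^ 2 \<Rightarrow> 'b::real_normed_vector"
  assumes u: "torus_smooth u"
  shows "advect B (\<lambda>x. u (horiz x)) x = (\<Sum>j\<in>UNIV. B x $ up j *\<^sub>R D j u (horiz x))"
proof -
  have "D i (\<lambda>x. u (horiz x)) x = (\<Sum>j\<in>UNIV. horiz (axis i 1) $ j *\<^sub>R D j u (horiz x))" for i
    by (rule partial_deriv_linear_reparam[OF bounded_linear_horiz torus_smooth_differentiable[OF u]])
  then have "D 1 (\<lambda>x. u (horiz x)) x = D 1 u (horiz x)" "D 2 (\<lambda>x. u (horiz x)) x = D 2 u (horiz x)"
    "D 3 (\<lambda>x. u (horiz x)) x = 0"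
    by (simp_all add: sum_2 horiz_nth axis_def)
  then show ?thesis
    by (simp add: advect_def sum_3 sum_2 up_def)
qed

lemma horiz_axis: "horiz (x + axis i 1) = (if i = 3 then horiz x else horiz x + axis (if i = 1 then 1 else 2) 1)"
  using exhaust_3[of i] by (auto simp: vec_eq_iff forall_2 horiz_nth axis_def)

lemma torus_smooth_horiz:
  assumes u: "torus_smooth u"
  shows "torus_smooth (\<lambda>x. u (horiz x))"
  unfolding torus_smooth_iff torus_periodic_def horiz_axis
  using u smooth_linear_reparam[OF bounded_linear_horiz torus_smooth_smooth[OF u]]
  by (simp add: torus_smooth_iff torus_periodicD)

lemma advect_div_free:
  fixes h :: "real ^ 'n \<Rightarrow> 'b::real_normed_vector"
  assumes B: "torus_smooth B" "\<And>x. divergence B x = 0" and h: "torus_smooth h"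
  shows "advect B h x = (\<Sum>i\<in>UNIV. D i (\<lambda>x. B x $ i *\<^sub>R h x) x)"
proof -
  have "(\<Sum>i\<in>UNIV. D i (\<lambda>x. B x $ i *\<^sub>R h x) x) = advect B h x + divergence B x *\<^sub>R h x"
    by (simp add: pd_scaleR torus_smooth_nth B h sum.distrib advect_def divergence_def scaleR_sum_left)
  then show ?thesis
    by (simp add: B)
qed

definition avg_coeff :: "(real ^ 3 \<Rightarrow> real ^ 3) \<Rightarrow> 2 \<Rightarrow> 2 \<Rightarrow> real ^ 2 \<Rightarrow> real" where
  "avg_coeff B i j = vert_avg (\<lambda>x. B x $ up i * B x $ up j)"

lemma torus_smooth_coeff: "torus_smooth B \<Longrightarrow> torus_smooth (avg_coeff B i j)"
  unfolding avg_coeff_def by (intro torus_smooth_vert_avg torus_smooth_mult torus_smooth_nth)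

text \<open>The outer derivative is written as a divergence, whose vertical part averages to zero
  and whose horizontal part commutes with averaging. The inner one acts on a function of the
  horizontal variable, so \<open>D j u\<close> can be taken out of the vertical integral.\<close>

theorem avg_B_grad_sq_eq:
  fixes u :: "real ^ 2 \<Rightarrow> 'b::euclidean_space"
  assumes B: "torus_smooth B" "\<And>x. divergence B x = 0" and u: "torus_smooth u"
  shows "avg_B_grad_sq B u y = div_flux (avg_coeff B) u y"
proof -
  define h where "h x = (\<Sum>j\<in>UNIV. B x $ up j *\<^sub>R D j u (horiz x))" for x
  have h: "torus_smooth h"
    unfolding h_def [abs_def]
    by (intro torus_smooth_sum torus_smooth_scaleR torus_smooth_nth torus_smooth_horiz torus_smooth_pd B u)
  have Bh: "torus_smooth (\<lambda>x. B x $ i *\<^sub>R h x)" for i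
    by (intro torus_smooth_scaleR torus_smooth_nth B h)
  have fl: "vert_avg (\<lambda>x. B x $ up i *\<^sub>R h x) = flux (avg_coeff B) u i" for i
  proof
    fix y
    have Bij: "torus_smooth (\<lambda>x. B x $ up i * B x $ up j)" for j
      by (intro torus_smooth_mult torus_smooth_nth B)
    have "vert_avg (\<lambda>x. B x $ up i *\<^sub>R h x) y =
        integral {0..1} (\<lambda>t. \<Sum>j\<in>UNIV. (B (at_height y t) $ up i * B (at_height y t) $ up j) *\<^sub>R D j u y)"
      by (simp add: vert_avg_def h_def scaleR_sum_right)
    also have "\<dots> = (\<Sum>j\<in>UNIV. integral {0..1} (\<lambda>t. (B (at_height y t) $ up i * B (at_height y t) $ up j) *\<^sub>R D j u y))"
      by (intro integral_sum finite integrable_on_scaleR_left vert_avg_integrable[OF Bij])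
    also have "\<dots> = flux (avg_coeff B) u i y"
      unfolding flux_def avg_coeff_def vert_avg_def
      by (intro sum.cong refl integral_unique[OF has_integral_scaleR_left]
          integrable_integral vert_avg_integrable[OF Bij])
    finally show "vert_avg (\<lambda>x. B x $ up i *\<^sub>R h x) y = flux (avg_coeff B) u i y" .
  qed
  have "advect B (\<lambda>x. u (horiz x)) = h"
    by (rule ext) (simp add: advect_horiz u h_def)
  moreover have "advect B h = (\<lambda>x. \<Sum>i\<in>UNIV. D i (\<lambda>x. B x $ i *\<^sub>R h x) x)"
    by (rule ext) (rule advect_div_free[OF B h])
  ultimately have "avg_B_grad_sq B u y = (\<Sum>i\<in>UNIV. vert_avg (D i (\<lambda>x. B x $ i *\<^sub>R h x)) y)"
    by (simp add: avg_B_grad_sq_def vert_avg_sum torus_smooth_pd Bh)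
  also have "\<dots> = (\<Sum>i\<in>UNIV. vert_avg (D (up i) (\<lambda>x. B x $ up i *\<^sub>R h x)) y)"
    using vert_avg_partial_3[OF Bh, of 3 y] by (simp add: sum_2 sum_3 up_def)
  also have "\<dots> = div_flux (avg_coeff B) u y"
    by (simp add: partial_deriv_vert_avg[symmetric] torus_smooth_smooth Bh fl)
  finally show ?thesis .
qed

lemma coeff_quadratic:
  assumes B: "torus_smooth B"
  shows "vert_avg (\<lambda>x. (horiz (B x) \<bullet> \<xi>)\<^sup>2) y = (\<Sum>i\<in>UNIV. \<Sum>j\<in>UNIV. avg_coeff B i j y * \<xi> $ j * \<xi> $ i)"
proof -
  have Bij: "torus_smooth (\<lambda>x. B x $ up i * B x $ up j)" for i j
    by (intro torus_smooth_mult torus_smooth_nth B)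
  have "vert_avg (\<lambda>x. (horiz (B x) \<bullet> \<xi>)\<^sup>2) y =
      vert_avg (\<lambda>x. \<Sum>i\<in>UNIV. \<Sum>j\<in>UNIV. (\<xi> $ j * \<xi> $ i) * (B x $ up i * B x $ up j)) y"
    by (simp add: inner_vec_def horiz_nth_up power2_eq_square sum_product mult_ac)
  also have "\<dots> = (\<Sum>i\<in>UNIV. \<Sum>j\<in>UNIV. vert_avg (\<lambda>x. (\<xi> $ j * \<xi> $ i) * (B x $ up i * B x $ up j)) y)"
    by (simp add: vert_avg_sum torus_smooth_sum torus_smooth_mult[OF torus_smooth_const] Bij)
  also have "\<dots> = (\<Sum>i\<in>UNIV. \<Sum>j\<in>UNIV. avg_coeff B i j y * \<xi> $ j * \<xi> $ i)"
    by (simp add: vert_avg_def avg_coeff_def mult_ac)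
  finally show ?thesis .
qed

text \<open>Were the average zero, \<open>horiz (B x)\<close> would be orthogonal to
  \<open>\<xi>\<close> all along the vertical line and so would keep the direction perpendicular to
  \<open>\<xi>\<close>.\<close>

lemma quadratic_pos:
  assumes B: "torus_smooth B" and dir: "\<not> constant_direction (\<lambda>t. horiz (B (at_height y t)))" and \<xi>: "norm \<xi> = 1"
  shows "vert_avg (\<lambda>x. (horiz (B x) \<bullet> \<xi>)\<^sup>2) y > 0"
proof (rule ccontr)
  let ?w = "\<lambda>t. horiz (B (at_height y t))"
  have cont: "continuous_on {0..1} (\<lambda>t. (?w t \<bullet> \<xi>)\<^sup>2)"
    by (intro continuous_intros continuous_on_compose2[OF linear_continuous_on[OF bounded_linear_horiz]]
        continuous_on_at_height[OF torus_smooth_cont[OF B]]) auto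
  have "integral {0..1} (\<lambda>t. (?w t \<bullet> \<xi>)\<^sup>2) \<ge> 0"
    by (intro integral_nonneg integrable_continuous_interval cont) auto
  moreover assume "\<not> vert_avg (\<lambda>x. (horiz (B x) \<bullet> \<xi>)\<^sup>2) y > 0"
  ultimately have "integral {0..1} (\<lambda>t. (?w t \<bullet> \<xi>)\<^sup>2) = 0"
    by (simp add: vert_avg_def)
  then have zero: "?w t \<bullet> \<xi> = 0" if "t \<in> {0..1}" for t
    using integral_eq_0_iff[OF cont] that by auto
  \<comment> \<open>\<open>constant_direction\<close> speaks of all real heights; periodicity leads
    back to one period.\<close>
  have all: "?w t \<bullet> \<xi> = 0" for t
  proof -
    have "B (at_height y (frac t) + of_int \<lfloor>t\<rfloor> *\<^sub>R axis 3 1) = B (at_height y (frac t))"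
      using B by (intro torus_periodic_int) (simp add: torus_smooth_iff)
    moreover have "at_height y (frac t) + of_int \<lfloor>t\<rfloor> *\<^sub>R axis 3 1 = at_height y t"
      by (simp add: vec_eq_iff forall_3 at_height_nth axis_def frac_def)
    ultimately show ?thesis
      using zero[of "frac t"] by (simp add: frac_lt_1 less_imp_le)
  qed
  \<comment> \<open>\<open>\<xi>\<close> turned by a right angle.\<close>
  let ?e = "vector [\<xi> $ 2, - \<xi> $ 1] :: real ^ 2"
  have \<xi>1: "\<xi> $ 1 * \<xi> $ 1 + \<xi> $ 2 * \<xi> $ 2 = 1"
    using \<xi> by (simp add: norm_eq_1 inner_vec_def sum_2)
  have "constant_direction ?w"
    unfolding constant_direction_def
  proof (intro exI[of _ ?e] conjI allI)
    show "?e \<noteq> 0"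
      using \<xi>1 by (auto simp: vec_eq_iff forall_2 vector_2)
    fix t
    define a b where "a = ?w t $ 1" and "b = ?w t $ 2"
    have ab: "a * \<xi> $ 1 + b * \<xi> $ 2 = 0"
      using all[of t] by (simp add: a_def b_def inner_vec_def sum_2)
    let ?c = "a * \<xi> $ 2 - b * \<xi> $ 1"
    \<comment> \<open>A unit factor is inserted and a multiple of the orthogonality relation
      subtracted, which leaves a multiple of \<open>?e\<close>.\<close>
    have "a = a * (\<xi> $ 1 * \<xi> $ 1 + \<xi> $ 2 * \<xi> $ 2) - (a * \<xi> $ 1 + b * \<xi> $ 2) * \<xi> $ 1"
      unfolding \<xi>1 ab by simp
    then have "a = ?c * \<xi> $ 2"
      by (simp add: algebra_simps)
    moreover have "b = b * (\<xi> $ 1 * \<xi> $ 1 + \<xi> $ 2 * \<xi> $ 2) - (a * \<xi> $ 1 + b * \<xi> $ 2) * \<xi> $ 2"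
      unfolding \<xi>1 ab by simp
    then have "b = ?c * (- \<xi> $ 1)"
      by (simp add: algebra_simps)
    ultimately have "?w t = ?c *\<^sub>R ?e"
      unfolding vec_eq_iff forall_2 vector_scaleR_component vector_2 real_scaleR_def
        a_def [symmetric] b_def [symmetric] by (rule conjI)
    then show "\<exists>c. ?w t = c *\<^sub>R ?e"
      by blast
  qed
  then show False
    using dir by blast
qed

text \<open>The quadratic form has a positive minimum on the compact product of unit cube and unit
  circle, and periodicity makes it a lower bound over the whole plane. So the infimum in
  \<open>ellipticity\<close> is positive; homogeneity extends the estimate from unit vectors to
  all.\<close>

theorem elliptic_coeff:
  assumes B: "torus_smooth B" and dir: "\<And>y. \<not> constant_direction (\<lambda>t. horiz (B (at_height y t)))"
  shows "elliptic (avg_coeff B) (ellipticity B)"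
proof -
  define q where "q y \<xi> = (\<Sum>i\<in>UNIV. \<Sum>j\<in>UNIV. avg_coeff B i j y * \<xi> $ j * \<xi> $ i)" for y and \<xi> :: "real ^ 2"
  have q_eq: "vert_avg (\<lambda>x. (horiz (B x) \<bullet> \<xi>)\<^sup>2) y = q y \<xi>" for y \<xi>
    unfolding q_def by (rule coeff_quadratic[OF B])
  have q_pos: "q y \<xi> > 0" if "norm \<xi> = 1" for y \<xi>
    using quadratic_pos[OF B dir that] by (simp add: q_eq)
  have ell: "ellipticity B = (INF p \<in> UNIV \<times> sphere 0 1. q (fst p) (snd p))"
    by (simp add: ellipticity_def q_eq split_beta)
  have e1: "axis 1 1 \<in> sphere (0 :: real ^ 2) 1"
    by (simp add: norm_axis_1)
  have "continuous_on S (\<lambda>p. avg_coeff B i j (fst p))" for S :: "((real ^ 2) \<times> (real ^ 2)) set" and i j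
    by (rule continuous_on_compose2[OF torus_smooth_cont[OF torus_smooth_coeff[OF B], of UNIV]])
      (auto intro: continuous_intros)
  then have cont: "continuous_on (cbox 0 1 \<times> sphere 0 1) (\<lambda>p. q (fst p) (snd p))"
    unfolding q_def by (intro continuous_intros)
  have "compact (cbox 0 (1 :: real ^ 2) \<times> sphere (0 :: real ^ 2) 1)"
    by (intro compact_Times) auto
  moreover have "cbox 0 (1 :: real ^ 2) \<times> sphere (0 :: real ^ 2) 1 \<noteq> {}"
    using e1 by (auto simp: interval_ne_empty_cart)
  ultimately obtain p where p: "p \<in> cbox 0 1 \<times> sphere 0 1"
    "\<And>r. r \<in> cbox 0 1 \<times> sphere 0 1 \<Longrightarrow> q (fst p) (snd p) \<le> q (fst r) (snd r)"
    using continuous_attains_inf[OF _ _ cont] by blast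
  let ?m = "q (fst p) (snd p)"
  have "?m > 0"
    using p(1) by (intro q_pos) auto
  have ge: "?m \<le> q y \<xi>" if "norm \<xi> = 1" for y \<xi>
  proof -
    have "torus_periodic (\<lambda>y. q y \<xi>)"
      using torus_smooth_coeff[OF B] by (simp add: torus_smooth_iff torus_periodic_def q_def)
    then obtain z where "z \<in> cbox 0 1" "q y \<xi> = q z \<xi>"
      by (rule torus_periodic_cube)
    then show ?thesis
      using p(2)[of "(z, \<xi>)"] that by simp
  qed
  have "?m \<le> ellipticity B"
    unfolding ell using e1 ge by (intro cINF_greatest) auto
  then have pos: "ellipticity B > 0"
    using \<open>?m > 0\<close> by simp
  have unit: "ellipticity B \<le> q y \<xi>" if "norm \<xi> = 1" for y \<xi>
    unfolding ell
  proof (rule cINF_lower2[where x = "(y, \<xi>)"])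
    \<comment> \<open>A real infimum is a lower bound only when the set is bounded below.\<close>
    show "bdd_below ((\<lambda>p. q (fst p) (snd p)) ` (UNIV \<times> sphere 0 1))"
      using ge by (intro bdd_belowI[of _ ?m]) auto
  qed (use that in auto)
  have "ellipticity B * (norm \<xi>)\<^sup>2 \<le> q y \<xi>" for y \<xi>
  proof (cases "\<xi> = 0")
    case True
    then show ?thesis by (simp add: q_def)
  next
    case False
    define \<eta> where "\<eta> = \<xi> /\<^sub>R norm \<xi>"
    have \<eta>: "norm \<eta> = 1" "\<xi> = norm \<xi> *\<^sub>R \<eta>"
      using False by (simp_all add: \<eta>_def)
    have "q y (c *\<^sub>R \<eta>) = c\<^sup>2 * q y \<eta>" for c
      by (simp add: q_def sum_distrib_left power2_eq_square mult_ac)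
    from this[of "norm \<xi>"] have "q y \<xi> = (norm \<xi>)\<^sup>2 * q y \<eta>"
      by (simp flip: \<eta>(2))
    then show ?thesis
      using mult_right_mono[OF unit[OF \<eta>(1), of y], of "(norm \<xi>)\<^sup>2"] by (simp add: mult.commute)
  qed
  then show ?thesis
    using pos torus_smooth_coeff[OF B] by (simp add: elliptic_def q_def)
qed

lemma torus_smooth_avg_B_grad_Bh:
  assumes "torus_smooth B"
  shows "torus_smooth (avg_B_grad_Bh B)"
proof -
  have "torus_smooth (\<lambda>x. horiz (B x))"
    by (rule bounded_linear.torus_smooth_compose[OF bounded_linear_horiz assms])
  then have "torus_smooth (advect B (\<lambda>x. horiz (B x)))"
    unfolding advect_def [abs_def]
    by (intro torus_smooth_sum torus_smooth_scaleR torus_smooth_nth torus_smooth_pd assms)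
  then show ?thesis
    unfolding avg_B_grad_Bh_def by (rule torus_smooth_vert_avg)
qed

text \<open>Serves both right-hand sides, with \<open>l\<close> the third coordinate or
  \<open>horiz\<close>. By Fubini zero mean over the three-dimensional torus passes to the
  averages.\<close>

lemma tint_vert_avg_linear:
  fixes F :: "real ^ 3 \<Rightarrow> real ^ 3" and l :: "real ^ 3 \<Rightarrow> 'b::euclidean_space"
  assumes l: "bounded_linear l" and F: "torus_smooth F" "torus_mean_zero F"
  shows "torus_smooth (vert_avg (\<lambda>x. l (F x)))" "tint (vert_avg (\<lambda>x. l (F x))) = 0"
proof -
  have lF: "torus_smooth (\<lambda>x. l (F x))"
    by (rule bounded_linear.torus_smooth_compose[OF l F(1)])
  then show "torus_smooth (vert_avg (\<lambda>x. l (F x)))"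
    by (rule torus_smooth_vert_avg)
  have "F integrable_on cbox 0 1"
    by (intro integrable_continuous torus_smooth_cont F)
  then have "integral (cbox 0 1) (\<lambda>x. l (F x)) = l (integral (cbox 0 1) F)"
    using integral_linear[OF _ l] by (simp add: comp_def)
  then show "tint (vert_avg (\<lambda>x. l (F x))) = 0"
    using F(2) by (simp add: tint_vert_avg torus_smooth_cont[OF lF] torus_mean_zero_def
        linear_0[OF bounded_linear.linear[OF l]])
qed

section \<open>Existence and uniqueness for the averaged equations\<close>

lemma flux_diff:
  assumes "torus_smooth u" "torus_smooth v"
  shows "flux A (\<lambda>x. u x - v x) i = (\<lambda>x. flux A u i x - flux A v i x)"
  using assms by (simp add: flux_def fun_eq_iff pd_diff scaleR_diff_right sum_subtractf)

lemma div_flux_diff: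
  assumes "\<And>i j. torus_smooth (A i j)" "torus_smooth u" "torus_smooth v"
  shows "div_flux A (\<lambda>x. u x - v x) x =
    div_flux A u x - div_flux A v x"
  using assms by (simp add: flux_diff pd_diff torus_smooth_flux sum_subtractf)

theorem vert_solution_ex1:
  assumes B: "torus_smooth B" "\<And>x. divergence B x = 0"
    and dir: "\<And>y. \<not> constant_direction (\<lambda>t. horiz (B (at_height y t)))"
    and F: "torus_smooth F" "torus_mean_zero F"
  shows "\<exists>!u. torus_smooth u \<and> torus_mean_zero u \<and> vert_solution B F u"
proof -
  note ell = elliptic_coeff[OF B(1) dir]
  note f = tint_vert_avg_linear[OF bounded_linear_vec_nth[of 3] F]
  have sol: "vert_solution B F u \<longleftrightarrow> (\<forall>x. - div_flux (avg_coeff B) u x = vert_avg (\<lambda>x. F x $ 3) x)"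
    if "torus_smooth u" for u
    using that by (simp add: vert_solution_def avg_B_grad_sq_eq B)
  obtain u where u: "torus_smooth u" "tint u = 0"
    "\<And>x. - div_flux (avg_coeff B) u x = vert_avg (\<lambda>x. F x $ 3) x"
    using scalar_solution[OF ell f] by blast
  show ?thesis
  proof (rule ex1I[of _ u])
    show "torus_smooth u \<and> torus_mean_zero u \<and> vert_solution B F u"
      using u by (simp add: torus_mean_zero_def sol)
    fix v assume v: "torus_smooth v \<and> torus_mean_zero v \<and> vert_solution B F v"
    then have vs: "torus_smooth v" "tint v = 0"
      "\<And>x. - div_flux (avg_coeff B) v x = vert_avg (\<lambda>x. F x $ 3) x"
      by (auto simp: torus_mean_zero_def sol)
    have "(\<lambda>x. v x - u x) = (\<lambda>x. 0)"
    proof (rule scalar_unique[OF ell])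
      show "torus_smooth (\<lambda>x. v x - u x)"
        by (intro torus_smooth_diff u vs)
      show "tint (\<lambda>x. v x - u x) = 0"
        by (simp add: tint_diff u vs)
      show "div_flux (avg_coeff B) (\<lambda>x. v x - u x) x = 0" for x
      proof -
        have "div_flux (avg_coeff B) (\<lambda>x. v x - u x) x =
            div_flux (avg_coeff B) v x - div_flux (avg_coeff B) u x"
          by (intro div_flux_diff torus_smooth_coeff B u vs)
        then show ?thesis
          using u(3)[of x] vs(3)[of x] by linarith
      qed
    qed
    then show "v = u"
      by (simp add: fun_eq_iff)
  qed
qed

theorem horiz_solution_ex1:
  assumes B: "torus_smooth B" "\<And>x. divergence B x = 0"
    and dir: "\<And>y. \<not> constant_direction (\<lambda>t. horiz (B (at_height y t)))"
    and small: "(SUP y. norm (avg_B_grad_Bh B y)) < ellipticity B / 4"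
    and F: "torus_smooth F" "torus_mean_zero F"
  shows "\<exists>!u. torus_smooth u \<and> torus_mean_zero u \<and> horiz_solution B F u"
proof -
  note ell = elliptic_coeff[OF B(1) dir]
  note f = tint_vert_avg_linear[OF bounded_linear_horiz F]
  let ?b = "avg_B_grad_Bh B" and ?f = "vert_avg (\<lambda>x. horiz (F x))"
  note b = torus_smooth_avg_B_grad_Bh[OF B(1)]
  obtain K where K: "\<And>y. norm (?b y) \<le> K"
    using torus_smooth_bounded[OF b] by blast
  \<comment> \<open>Boundedness of \<open>?b\<close> is what makes the real supremum an upper
    bound.\<close>
  have S: "norm (?b y) \<le> (SUP y. norm (?b y))" for y
    using K by (intro cSUP_upper bdd_aboveI[of _ K]) auto
  have sol: "horiz_solution B F u \<longleftrightarrow> (\<exists>p. torus_smooth p \<and>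
      (\<forall>x. - div_flux (avg_coeff B) u x + advect u ?b x + gradient p x = ?f x)) \<and>
      (\<forall>x. divergence u x = 0)" if "torus_smooth u" for u
    using that by (simp add: horiz_solution_def avg_B_grad_sq_eq B)
  obtain u p where u: "torus_smooth u" "tint u = 0" "\<And>x. divergence u x = 0" "torus_smooth p"
    "\<And>x. - div_flux (avg_coeff B) u x + advect u ?b x + gradient p x = ?f x"
    by (rule stokes_solution[OF ell b S small f]) (rule that)
  show ?thesis
  proof (rule ex1I[of _ u])
    show "torus_smooth u \<and> torus_mean_zero u \<and> horiz_solution B F u"
      using u by (auto simp: torus_mean_zero_def sol)
    fix v assume v: "torus_smooth v \<and> torus_mean_zero v \<and> horiz_solution B F v"
    then have vs: "torus_smooth v" "tint v = 0" "\<And>x. divergence v x = 0"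
      by (auto simp: torus_mean_zero_def sol)
    obtain r where r: "torus_smooth r"
      "\<And>x. - div_flux (avg_coeff B) v x + advect v ?b x + gradient r x = ?f x"
      using v sol[OF vs(1)] by blast
    \<comment> \<open>The two solutions come with their own pressures; \<open>r - p\<close> is the
      pressure belonging to \<open>v - u\<close>.\<close>
    have "(\<lambda>x. v x - u x) = (\<lambda>x. 0)"
    proof (rule stokes_unique[OF ell b S small])
      show "torus_smooth (\<lambda>x. v x - u x)" "torus_smooth (\<lambda>x. r x - p x)"
        by (intro torus_smooth_diff u vs r)+
      show "tint (\<lambda>x. v x - u x) = 0"
        by (simp add: tint_diff u vs)
      show "divergence (\<lambda>x. v x - u x) x = 0" for x
        using u(3)[of x] vs(3)[of x]
        by (simp add: divergence_eq torus_smooth_diff u(1) vs(1) pd_diff sum_subtractf)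
      have "advect (\<lambda>x. v x - u x) ?b x = advect v ?b x - advect u ?b x" for x
        by (simp add: advect_def scaleR_diff_left sum_subtractf)
      moreover have "gradient (\<lambda>x. r x - p x) x = gradient r x - gradient p x" for x
        by (simp add: vec_eq_iff gradient_nth pd_diff r u(4))
      moreover have "div_flux (avg_coeff B) (\<lambda>x. v x - u x) x =
          div_flux (avg_coeff B) v x - div_flux (avg_coeff B) u x" for x
        by (intro div_flux_diff torus_smooth_coeff B u vs)
      ultimately have "- div_flux (avg_coeff B) (\<lambda>x. v x - u x) x +
          advect (\<lambda>x. v x - u x) ?b x + gradient (\<lambda>x. r x - p x) x =
          (- div_flux (avg_coeff B) v x + advect v ?b x + gradient r x) -
          (- div_flux (avg_coeff B) u x + advect u ?b x + gradient p x)" for x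
        by simp
      then show "- div_flux (avg_coeff B) (\<lambda>x. v x - u x) x +
          advect (\<lambda>x. v x - u x) ?b x + gradient (\<lambda>x. r x - p x) x = 0" for x
        unfolding u(5) r(2) by simp
    qed
    then show "v = u"
      by (simp add: fun_eq_iff)
  qed
qed

text \<open>Smallness is made precise by a threshold function chosen before \<open>B\<close>, so
  that the bound depends on \<open>B\<close> only through its ellipticity constant. The witness, a
  quarter of that constant, is the one for which the form of the horizontal system is
  coercive.\<close>

theorem proposition1p1:
  shows "\<exists>\<epsilon> :: real \<Rightarrow> real. \<forall>B :: real ^ 3 \<Rightarrow> real ^ 3.
    torus_smooth B \<and> (\<forall>x. divergence B x = 0) \<and>
    (\<forall>xh. \<not> constant_direction (\<lambda>t. horiz (B (at_height xh t)))) \<longrightarrow>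
      0 < \<epsilon> (ellipticity B) \<and>
      ((SUP xh. norm (avg_B_grad_Bh B xh)) < \<epsilon> (ellipticity B) \<longrightarrow>
        (\<forall>F :: real ^ 3 \<Rightarrow> real ^ 3. torus_smooth F \<and> torus_mean_zero F \<longrightarrow>
          (\<exists>!u. torus_smooth u \<and> torus_mean_zero u \<and> horiz_solution B F u) \<and>
          (\<exists>!u. torus_smooth u \<and> torus_mean_zero u \<and> vert_solution B F u)))"
proof (rule exI[of _ "\<lambda>l. l / 4"], intro allI impI, elim conjE, intro conjI impI allI)
  fix B :: "real ^ 3 \<Rightarrow> real ^ 3"
  assume B: "torus_smooth B" "\<forall>x. divergence B x = 0"
    and dir: "\<forall>xh. \<not> constant_direction (\<lambda>t. horiz (B (at_height xh t)))"
  show "0 < ellipticity B / 4"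
    using ellipticD(1)[OF elliptic_coeff[OF B(1)]] dir by simp
  fix F :: "real ^ 3 \<Rightarrow> real ^ 3"
  assume small: "(SUP xh. norm (avg_B_grad_Bh B xh)) < ellipticity B / 4"
    and F: "torus_smooth F \<and> torus_mean_zero F"
  show "\<exists>!u. torus_smooth u \<and> torus_mean_zero u \<and> horiz_solution B F u"
    using B dir F by (intro horiz_solution_ex1 small) auto
  show "\<exists>!u. torus_smooth u \<and> torus_mean_zero u \<and> vert_solution B F u"
    using B dir F by (intro vert_solution_ex1) auto
qed

end
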